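(* Let $a\in\mathbb R\setminus\{0\}$, $b\in\mathbb R\setminus[-1,0]$ and consider the system $$x'=-x^2-a(y^2+z^2)+F(x,y,z),\quad y'=bxy-z+G(x,y,z),\quad z'=bxz+y+H(x,y,z),$$ where $F,G,H$ are real-analytic near the origin, each is $\mathcal O(|(x,y,z)|^3)$, and $F(-x,-z,-y)=F(x,y,z)$, $G(-x,-z,-y)=H(x,y,z)$. Write it in cylindrical coordinates $(x,\rho,\theta)$ defined by $y=\rho\cos\theta$, $z=\rho\sin\theta$ (complexified). Fix $\chi\in(0,\pi)$. Then, for $\delta>0$ and $\xi>0$ sufficiently small, there are invariant manifolds of the graph form $$\rho=x\,\Phi^\pm(x,\theta),\qquad x\in S^\pm(\delta,\chi),\ \theta\in\mathbb T_\xi,$$ where $\Phi^\pm:S^\pm(\delta,\chi)\times\mathbb T_\xi\to\mathbb C$, with $$\Phi^\pm(0,\theta)\equiv i\sqrt{\frac{1+b}{a}},$$ are $1$-sums (with respect to $x$, uniformly with respect to $\theta\in\mathbb T_\xi$) of a Gevrey-$1$ formal series along the directions defined by $x\in S^\pm(\delta,\chi)$, respectively.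
   Context: $\mathbb T_\xi:=\{\theta\in\mathbb C/(2\pi\mathbb Z):|\operatorname{Im}\theta|<\xi\}$; $$S^\pm(\delta,\chi)=\{x\in\mathbb C:0<|x|<\delta,\ |\operatorname{Arg}(\pm x)|<\tfrac{\pi+\chi}2\}.$$ $\Phi^\pm(0,\theta)$ denotes the limit as $x\to0$ in the sector. Invariant means that the (complexified) vector field is tangent to the graph. A formal series $\sum_{\beta\ge0}W_\beta(\theta)x^\beta$ with $W_\beta$ analytic on $\mathbb T_\xi$ is Gevrey-$1$ (uniformly in $\theta$) if $\sup_\theta|W_\beta(\theta)|\le A\tau^\beta\beta!$ for some $A,\tau>0$. Its Borel transform (of the part without constant term) is $\widehat W(w,\theta)=\sum_{\beta\ge1}W_\beta(\theta)\frac{w^{\beta-1}}{(\beta-1)!}$. Its $1$-sum in the direction $\varphi$ (here $\varphi=0$ for $+$, $\varphi=\pi$ for $-$) exists if $\widehat W$ continues analytically in $w$ along (a sectorial neighborhood of) the ray $w=re^{i\varphi}$, $r\ge0$, with $|\widehat W(w,\theta)|=\mathcal O(e^{\eta|w|})$ for some $\eta>0$, uniformly in $\theta$, and it is then $W_0(\theta)+\int_0^{\infty e^{i\varphi}}\widehat W(w,\theta)e^{-w/x}dw$ (continued analytically by rotating the ray) on a local sector of opening greater than $\pi$ centered along $\varphi$. *)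

theory Defs
  imports "HOL-Analysis.Analysis" "HOL-Library.Landau_Symbols"
begin

text \<open>
  Real-analytic functions of three variables and their complexification.  The same real
  coefficients are used for \<open>'a = real\<close> and \<open>'a = complex\<close>.
\<close>

definition monomial3 :: "('a::real_normed_field) \<times> 'a \<times> 'a \<Rightarrow> nat \<times> nat \<times> nat \<Rightarrow> 'a" where
  "monomial3 = (\<lambda>(x, y, z) (i, j, k). x ^ i * y ^ j * z ^ k)"

definition has_expansion ::
    "(real \<times> real \<times> real \<Rightarrow> real) \<Rightarrow> (nat \<times> nat \<times> nat \<Rightarrow> real) \<Rightarrow> bool" where
  "has_expansion f c \<longleftrightarrow> (\<exists>r>0. \<forall>x y z. \<bar>x\<bar> < r \<and> \<bar>y\<bar> < r \<and> \<bar>z\<bar> < r \<longrightarrow>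
     ((\<lambda>m. c m *\<^sub>R monomial3 (x, y, z) m) has_sum f (x, y, z)) UNIV)"

definition real_analytic_at_0 :: "(real \<times> real \<times> real \<Rightarrow> real) \<Rightarrow> bool" where
  "real_analytic_at_0 f \<longleftrightarrow> (\<exists>c. has_expansion f c)"

text \<open>The expansion is unique, so the choice below selects the Taylor coefficients at the origin.\<close>

definition taylor_coeffs :: "(real \<times> real \<times> real \<Rightarrow> real) \<Rightarrow> nat \<times> nat \<times> nat \<Rightarrow> real" where
  "taylor_coeffs f = (SOME c. has_expansion f c)"

definition complexify ::
    "(real \<times> real \<times> real \<Rightarrow> real) \<Rightarrow> complex \<times> complex \<times> complex \<Rightarrow> complex" where
  "complexify f p = (\<Sum>\<^sub>\<infinity>m. taylor_coeffs f m *\<^sub>R monomial3 p m)"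

text \<open>
  The value of \<^const>\<open>complexify\<close> is meaningful only where the series converges; on the open set
  below it is holomorphic.
\<close>

definition convergence_domain ::
    "(real \<times> real \<times> real \<Rightarrow> real) \<Rightarrow> (complex \<times> complex \<times> complex) set" where
  "convergence_domain f = interior {p. (\<lambda>m. taylor_coeffs f m *\<^sub>R monomial3 p m) summable_on UNIV}"

text \<open>The complexified vector field, in Cartesian and in cylindrical coordinates.\<close>

definition vfield ::
    "real \<Rightarrow> real \<Rightarrow> (real \<times> real \<times> real \<Rightarrow> real) \<Rightarrow> (real \<times> real \<times> real \<Rightarrow> real) \<Rightarrow>
     (real \<times> real \<times> real \<Rightarrow> real) \<Rightarrow> complex \<times> complex \<times> complex \<Rightarrow> complex \<times> complex \<times> complex" where
  "vfield a b F G H = (\<lambda>(x, y, z).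
     (- x\<^sup>2 - of_real a * (y\<^sup>2 + z\<^sup>2) + complexify F (x, y, z),
      of_real b * x * y - z + complexify G (x, y, z),
      of_real b * x * z + y + complexify H (x, y, z)))"

definition cyl :: "complex \<times> complex \<times> complex \<Rightarrow> complex \<times> complex \<times> complex" where
  "cyl = (\<lambda>(x, \<rho>, \<theta>). (x, \<rho> * cos \<theta>, \<rho> * sin \<theta>))"

text \<open>
  From \<open>y = \<rho> cos \<theta>\<close>, \<open>z = \<rho> sin \<theta>\<close> one gets \<open>\<rho>' = y' cos \<theta> + z' sin \<theta>\<close> and
  \<open>\<rho> \<theta>' = z' cos \<theta> - y' sin \<theta>\<close>; the coordinates are nondegenerate only for \<open>\<rho> \<noteq> 0\<close>.
\<close>

definition cyl_vfield ::
    "real \<Rightarrow> real \<Rightarrow> (real \<times> real \<times> real \<Rightarrow> real) \<Rightarrow> (real \<times> real \<times> real \<Rightarrow> real) \<Rightarrow>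
     (real \<times> real \<times> real \<Rightarrow> real) \<Rightarrow> complex \<times> complex \<times> complex \<Rightarrow> complex \<times> complex \<times> complex" where
  "cyl_vfield a b F G H = (\<lambda>(x, \<rho>, \<theta>).
     (case vfield a b F G H (cyl (x, \<rho>, \<theta>)) of (x', y', z') \<Rightarrow>
       (x', y' * cos \<theta> + z' * sin \<theta>, (z' * cos \<theta> - y' * sin \<theta>) / \<rho>)))"

definition cyl_domain ::
    "(real \<times> real \<times> real \<Rightarrow> real) \<Rightarrow> (real \<times> real \<times> real \<Rightarrow> real) \<Rightarrow>
     (real \<times> real \<times> real \<Rightarrow> real) \<Rightarrow> (complex \<times> complex \<times> complex) set" where
  "cyl_domain F G H = {(x, \<rho>, \<theta>). \<rho> \<noteq> 0 \<and>
     cyl (x, \<rho>, \<theta>) \<in> convergence_domain F \<inter> convergence_domain G \<inter> convergence_domain H}"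

text \<open>
  The graph \<open>\<rho> = h (x, \<theta>)\<close> over \<open>U\<close> is a complex manifold (\<open>h\<close> has a complex-linear
  Frechet derivative), lies in the domain \<open>D\<close> of the vector field \<open>V\<close>, and \<open>V\<close> is tangent to it.
\<close>

definition invariant_graph ::
    "(complex \<times> complex \<times> complex \<Rightarrow> complex \<times> complex \<times> complex) \<Rightarrow>
     (complex \<times> complex \<times> complex) set \<Rightarrow> (complex \<times> complex) set \<Rightarrow>
     (complex \<times> complex \<Rightarrow> complex) \<Rightarrow> bool" where
  "invariant_graph V D U h \<longleftrightarrow> (\<forall>(x, \<theta>)\<in>U. (x, h (x, \<theta>), \<theta>) \<in> D \<and>
     (\<exists>A B. (h has_derivative (\<lambda>(u, v). A * u + B * v)) (at (x, \<theta>)) \<and>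
       (case V (x, h (x, \<theta>), \<theta>) of (x', \<rho>', \<theta>') \<Rightarrow> \<rho>' = A * x' + B * \<theta>')))"

text \<open>
  Functions on the strip \<open>{\<theta> \<in> \<complex>/2\<pi>\<int>. \<bar>Im \<theta>\<bar> < \<xi>}\<close> are represented as \<open>2\<pi>\<close>-periodic functions
  on its preimage in the complex plane.
\<close>

definition strip :: "real \<Rightarrow> complex set" where
  "strip \<xi> = {\<theta>. \<bar>Im \<theta>\<bar> < \<xi>}"

definition periodic_on_strip :: "real \<Rightarrow> (complex \<Rightarrow> complex) \<Rightarrow> bool" where
  "periodic_on_strip \<xi> f \<longleftrightarrow> (\<forall>\<theta>\<in>strip \<xi>. f (\<theta> + 2 * of_real pi) = f \<theta>)"

definition sector_plus :: "real \<Rightarrow> real \<Rightarrow> complex set" where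
  "sector_plus \<delta> \<omega> = {x. 0 < norm x \<and> norm x < \<delta> \<and> \<bar>Arg x\<bar> < (pi + \<omega>) / 2}"

definition sector_minus :: "real \<Rightarrow> real \<Rightarrow> complex set" where
  "sector_minus \<delta> \<omega> = {x. 0 < norm x \<and> norm x < \<delta> \<and> \<bar>Arg (- x)\<bar> < (pi + \<omega>) / 2}"

definition gevrey1 :: "real \<Rightarrow> (nat \<Rightarrow> complex \<Rightarrow> complex) \<Rightarrow> bool" where
  "gevrey1 \<xi> W \<longleftrightarrow>
     (\<forall>n. W n holomorphic_on strip \<xi> \<and> periodic_on_strip \<xi> (W n)) \<and>
     (\<exists>A>0. \<exists>\<tau>>0. \<forall>n. \<forall>\<theta>\<in>strip \<xi>. norm (W n \<theta>) \<le> A * \<tau> ^ n * fact n)"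

text \<open>Coefficients of the Borel transform, indexed by the power of \<open>w\<close> (that is, \<open>n = \<beta> - 1\<close>).\<close>

definition borel_coeff :: "(nat \<Rightarrow> complex \<Rightarrow> complex) \<Rightarrow> complex \<Rightarrow> nat \<Rightarrow> complex" where
  "borel_coeff W \<theta> n = W (Suc n) \<theta> / fact n"

text \<open>A sectorial neighborhood (with vertex disc) of the ray \<open>{t * cis \<phi> | t \<ge> 0}\<close>.\<close>

definition ray_nbhd :: "real \<Rightarrow> real \<Rightarrow> real \<Rightarrow> complex set" where
  "ray_nbhd \<phi> \<kappa> r = ball 0 r \<union> {of_real t * cis \<psi> | t \<psi>. 0 < t \<and> \<bar>\<psi> - \<phi>\<bar> < \<kappa>}"

definition laplace_ray :: "real \<Rightarrow> (complex \<Rightarrow> complex) \<Rightarrow> complex \<Rightarrow> complex" where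
  "laplace_ray \<psi> g x =
     (LBINT t:{0<..}. cis \<psi> * g (of_real t * cis \<psi>) * exp (- (of_real t * cis \<psi> / x)))"

text \<open>
  \<open>\<Phi>\<close> is the 1-sum on \<open>S\<close> of the series \<open>W\<close> in the direction \<open>\<phi>\<close>, uniformly on the strip.
  \<open>B\<close> is the continued Borel transform.  The integral along the ray of argument \<open>\<psi>\<close>
  converges for \<open>Re (cis \<psi> / x) > \<eta>\<close>; the 1-sum is continued by rotating this ray, and every
  point of \<open>S\<close> has to be reached in this way.
\<close>

definition is_one_sum ::
    "real \<Rightarrow> complex set \<Rightarrow> real \<Rightarrow> (nat \<Rightarrow> complex \<Rightarrow> complex) \<Rightarrow>
     (complex \<Rightarrow> complex \<Rightarrow> complex) \<Rightarrow> bool" where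
  "is_one_sum \<phi> S \<xi> W \<Phi> \<longleftrightarrow> (\<exists>\<kappa>>0. \<exists>r>0. \<exists>\<eta>>0. \<exists>K. \<exists>B :: complex \<Rightarrow> complex \<Rightarrow> complex.
     (\<forall>\<theta>\<in>strip \<xi>.
        (\<lambda>w. B w \<theta>) holomorphic_on ray_nbhd \<phi> \<kappa> r \<and>
        (\<forall>w\<in>ball 0 r. (\<lambda>n. borel_coeff W \<theta> n * w ^ n) sums B w \<theta>) \<and>
        (\<forall>w\<in>ray_nbhd \<phi> \<kappa> r. norm (B w \<theta>) \<le> K * exp (\<eta> * norm w))) \<and>
     (\<forall>x\<in>S.
        (\<exists>\<psi>. \<bar>\<psi> - \<phi>\<bar> < \<kappa> \<and> \<eta> < Re (cis \<psi> / x)) \<and>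
        (\<forall>\<psi>. \<bar>\<psi> - \<phi>\<bar> < \<kappa> \<and> \<eta> < Re (cis \<psi> / x) \<longrightarrow>
          (\<forall>\<theta>\<in>strip \<xi>. \<Phi> x \<theta> = W 0 \<theta> + laplace_ray \<psi> (\<lambda>w. B w \<theta>) x))))"

end

theory Submission
  imports Defs "HOL-Complex_Analysis.Complex_Analysis"
begin

text \<open>
  Write \<open>\<rho> = x (\<phi>0 + u)\<close> with \<open>a \<phi>0\<^sup>2 = - (1 + b)\<close> and \<open>u = x s\<close>.  Divided by \<open>x\<^sup>2\<close>, the tangency
  condition becomes \<open>s\<^sub>\<theta> + b x\<^sup>2 s\<^sub>x + (3 b + 2) x \<langle>s\<rangle> = \<dots>\<close>, where \<open>\<langle>s\<rangle>\<close> is the mean over \<open>\<theta>\<close> and the right-hand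
  side consists of small terms: every occurrence of \<open>s\<close> there comes with a factor \<open>x\<close>.
  The Borel transform in \<open>x\<close> turns products into convolutions, multiplication by \<open>x\<close> into integration
  from \<open>0\<close>, and \<open>x\<^sup>2 \<partial>\<^sub>x\<close> into multiplication by \<open>w\<close>.  The linear part is then inverted explicitly.  On
  \<open>\<theta>\<close>-independent data this is the Euler integral \<open>\<integral> t^(\<alpha> - 1) g (t w) dt\<close> over \<open>[0, 1]\<close> with \<open>\<alpha> = (3 b + 2) / b\<close>,
  bounded since \<open>\<alpha> > 1\<close>, which for \<open>b \<noteq> 0\<close> means exactly \<open>b \<notin> [-1, 0]\<close>.  On data of mean zero it is
  \<open>(\<partial>\<^sub>\<theta> + b w)\<^sup>-\<^sup>1\<close>, bounded as long as \<open>b w\<close> stays away from the nonzero integer multiples of \<open>i\<close>; a wedge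
  \<open>\<bar>Im w\<bar> < r + m \<bar>Re w\<bar>\<close> around the real axis has this property.
  On functions on the wedge, with the sup norm weighted by \<open>exp (\<eta> \<bar>w\<bar>) / (1 + (\<eta> \<bar>w\<bar>)\<^sup>2)\<close> suitably
  scaled, convolution is submultiplicative and integration has norm \<open>4 \<pi> / \<eta>\<close>, so for large \<open>\<eta>\<close> the
  nonlinear equation is a contraction.
  The wedge contains a sectorial neighborhood of both real half-axes, so the two Laplace transforms of the one
  solution are the two 1-sums, and since the Laplace transform is multiplicative their graphs are invariant.
\<close>

text \<open>At \<open>x = 0\<close> the tangency condition forces 1 + b + a \<phi>0^2 = 0 for a
  nonzero constant \<phi>0. Linearizing there, with x u_x = u + x^2 s_x, gives b (2 u + x^2 s_x) - b
  u - 2 a \<phi>0^2 u = b x^2 s_x + (3 b + 2) u, the origin of 3 b + 2. Only the mean of u = x s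
  stays in the linear part: on means x^2 s_x and x s have the same strength, whereas on the
  oscillating part \<partial>\<theta> + b x^2 \<partial>x is already invertible and the factor x
  makes the term small. The obstacle is that s_\<theta> and x^2 s_x occur next to nonlinear factors,
  while neither is controlled by a bound on s. Therefore the unknown is the whole linear expression,
  from which u, s_\<theta> and x^2 s_x are all recovered by bounded operators. No Cauchy estimate is
  spent in the iteration, so neither the strip nor the wedge shrinks and an ordinary contraction
  suffices. Its small parameter is \<epsilon> = 4 \<pi> / \<eta>, the norm of the multiplication by
  x.\<close>

type_synonym borel_fun = "complex \<Rightarrow> complex \<Rightarrow> complex"

section \<open>Integrals of holomorphic families\<close>

text \<open>Discs of radius \<open>d/4\<close> around points of the half ball stay in the ball, so
  Cauchy's inequality bounds the derivative there. The bound dominates difference quotients under an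
  integral and controls mixed differences.\<close>

lemma holomorphic_lipschitz_half_ball:
  assumes hol: "f holomorphic_on ball z0 d" and d: "0 < d"
    and bd: "\<And>z. z \<in> ball z0 d \<Longrightarrow> norm (f z) \<le> M"
    and zz: "z \<in> ball z0 (d/2)" "z' \<in> ball z0 (d/2)"
  shows "norm (f z - f z') \<le> 4 * M / d * norm (z - z')"
proof (rule field_differentiable_bound[where S="ball z0 (d/2)" and f'="deriv f"])
  show "convex (ball z0 (d/2))" by simp
  show "z \<in> ball z0 (d/2)" "z' \<in> ball z0 (d/2)" using zz by auto
  fix y assume y: "y \<in> ball z0 (d/2)"
  then have yd: "y \<in> ball z0 d" using d by auto
  show "(f has_field_derivative deriv f y) (at y within ball z0 (d/2))"
    using holomorphic_derivI[OF hol open_ball yd] has_field_derivative_at_within by blast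
  have sub: "cball y (d/4) \<subseteq> ball z0 d"
  proof
    fix t assume "t \<in> cball y (d/4)"
    then have "dist z0 t \<le> dist z0 y + d/4"
      using dist_triangle[of z0 t y] by simp
    then show "t \<in> ball z0 d" using y d by auto
  qed
  have "norm ((deriv ^^ 1) f y) \<le> fact 1 * M / (d/4) ^ 1"
  proof (rule Cauchy_inequality)
    show "f holomorphic_on ball y (d/4)"
      using hol sub ball_subset_cball holomorphic_on_subset by blast
    show "continuous_on (cball y (d/4)) f"
      using hol sub holomorphic_on_imp_continuous_on holomorphic_on_subset by blast
    show "0 < d/4" using d by simp
    fix x assume "norm (y - x) = d/4"
    then have "x \<in> cball y (d/4)" by (simp add: dist_norm)
    then show "norm (f x) \<le> M" using sub bd by blast
  qed
  then show "norm (deriv f y) \<le> 4 * M / d" using d by (simp add: field_simps)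
qed

text \<open>The difference quotients are dominated by \<open>4 * B t / d\<close>, so dominated
  convergence applies along every sequence tending to \<open>z0\<close>. The derivative is
  measurable in \<open>t\<close> as a pointwise limit of quotients.\<close>

lemma has_field_derivative_lebesgue_integral:
  fixes h :: "'t \<Rightarrow> complex \<Rightarrow> complex"
  assumes d: "0 < d" and hol: "\<And>t. t \<in> space M \<Longrightarrow> h t holomorphic_on ball z0 d"
    and meas: "\<And>z. z \<in> ball z0 d \<Longrightarrow> (\<lambda>t. h t z) \<in> borel_measurable M"
    and bd: "\<And>t z. t \<in> space M \<Longrightarrow> z \<in> ball z0 d \<Longrightarrow> norm (h t z) \<le> B t"
    and intB: "integrable M B"
  shows "integrable M (\<lambda>t. deriv (h t) z0)"
    and "((\<lambda>z. \<integral>t. h t z \<partial>M) has_field_derivative (\<integral>t. deriv (h t) z0 \<partial>M)) (at z0)"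
proof -
  let ?Q = "\<lambda>z t. (h t z - h t z0) / (z - z0)"
  have int: "integrable M (\<lambda>t. h t z)" if "z \<in> ball z0 d" for z
    using meas[OF that] bd[OF _ that] intB
    by (auto intro!: Bochner_Integration.integrable_bound[OF intB] AE_I2 order_trans[OF bd[OF _ that]])
  have z0: "z0 \<in> ball z0 d" using d by simp
  have Q_lim: "((\<lambda>z. ?Q z t) \<longlongrightarrow> deriv (h t) z0) (at z0)" if "t \<in> space M" for t
    using holomorphic_derivI[OF hol[OF that] open_ball z0]
    by (simp add: has_field_derivative_iff)
  have seq: "integrable M (\<lambda>t. deriv (h t) z0) \<and>
      (\<lambda>n. \<integral>t. ?Q (X n) t \<partial>M) \<longlonglongrightarrow> (\<integral>t. deriv (h t) z0 \<partial>M)"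
    if X: "\<And>n. X n \<in> ball z0 (d/2) - {z0}" "X \<longlonglongrightarrow> z0" for X
  proof -
    have Xd: "X n \<in> ball z0 d" for n using X(1)[of n] d by auto
    have Qm: "?Q (X n) \<in> borel_measurable M" for n
      using meas[OF Xd] meas[OF z0] by simp
    have lim: "(\<lambda>n. ?Q (X n) t) \<longlonglongrightarrow> deriv (h t) z0" if "t \<in> space M" for t
      using Q_lim[OF that] X unfolding tendsto_at_iff_sequentially comp_def by blast
    have dm: "(\<lambda>t. deriv (h t) z0) \<in> borel_measurable M"
      by (rule borel_measurable_LIMSEQ_metric[OF Qm lim])
    have le: "norm (?Q (X n) t) \<le> 4 * B t / d" if "t \<in> space M" for t n
    proof -
      have "norm (h t (X n) - h t z0) \<le> 4 * B t / d * norm (X n - z0)"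
        using holomorphic_lipschitz_half_ball[OF hol[OF that] d bd[OF that]] X(1)[of n] d by auto
      then show ?thesis using X(1)[of n] d by (simp add: norm_divide pos_divide_le_eq)
    qed
    have i4: "integrable M (\<lambda>t. 4 * B t / d)" using intB by simp
    show ?thesis
      using integrable_dominated_convergence[OF dm Qm i4 AE_I2[OF lim] AE_I2[OF le]]
        integral_dominated_convergence[OF dm Qm i4 AE_I2[OF lim] AE_I2[OF le]] by auto
  qed
  \<comment> \<open>A single concrete sequence is enough to extract integrability of the derivative
    from \<open>seq\<close>.\<close>
  define X where "X = (\<lambda>n::nat. z0 + of_real (d / 4) * of_real (inverse (real (Suc n))))"
  have "X n \<in> ball z0 (d/2) - {z0}" for n
  proof -
    have "inverse (real (Suc n)) \<le> 1" by (simp add: inverse_le_1_iff)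
    then have "d/4 * inverse (real (Suc n)) < d/2"
      using mult_left_mono[of "inverse (real (Suc n))" 1 "d/4"] d by simp
    then show ?thesis using d
      by (simp add: X_def dist_norm norm_mult norm_inverse del: of_nat_Suc)
  qed
  moreover have "X \<longlonglongrightarrow> z0 + of_real (d/4) * of_real 0"
    unfolding X_def by (intro tendsto_intros LIMSEQ_inverse_real_of_nat)
  ultimately show "integrable M (\<lambda>t. deriv (h t) z0)" using seq[of X]
    by simp
  show "((\<lambda>z. \<integral>t. h t z \<partial>M) has_field_derivative (\<integral>t. deriv (h t) z0 \<partial>M)) (at z0)"
  proof -
    have *: "at z0 = at z0 within ball z0 (d/2)"
      using d by (intro at_within_open[symmetric]) auto
    have Qint: "(\<integral>t. ?Q z t \<partial>M) = ((\<integral>t. h t z \<partial>M) - (\<integral>t. h t z0 \<partial>M)) / (z - z0)"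
      if "z \<in> ball z0 d" for z
      using Bochner_Integration.integral_diff[OF int[OF that] int[OF z0]]
      by simp
    show ?thesis
      unfolding has_field_derivative_iff
      apply (subst *)
      unfolding tendsto_at_iff_sequentially comp_def
    proof (intro allI impI)
      fix X assume X: "\<forall>i. X i \<in> ball z0 (d/2) - {z0}" "X \<longlonglongrightarrow> z0"
      then have "X n \<in> ball z0 d" for n using d by (auto dest!: spec[of _ n])
      then show "(\<lambda>n. ((\<integral>t. h t (X n) \<partial>M) - (\<integral>t. h t z0 \<partial>M)) / (X n - z0))
          \<longlonglongrightarrow> (\<integral>t. deriv (h t) z0 \<partial>M)"
        using seq[of X, THEN conjunct2] X by (simp only: Qint)
    qed
  qed
qed

text \<open>Hartogs with a uniform bound: the mixed second difference of \<open>f\<close> is \<open>O(\<bar>u\<bar> \<bar>v\<bar>)\<close> by Cauchy estimates.\<close>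

lemma has_derivative_separately_holomorphic:
  fixes f :: "complex \<times> complex \<Rightarrow> complex"
  assumes d: "0 < d"
    and h1: "\<And>y. y \<in> ball y0 d \<Longrightarrow> (\<lambda>x. f (x, y)) holomorphic_on ball x0 d"
    and h2: "\<And>x. x \<in> ball x0 d \<Longrightarrow> (\<lambda>y. f (x, y)) holomorphic_on ball y0 d"
    and bd: "\<And>x y. x \<in> ball x0 d \<Longrightarrow> y \<in> ball y0 d \<Longrightarrow> norm (f (x, y)) \<le> M"
    and A: "((\<lambda>x. f (x, y0)) has_field_derivative A) (at x0)"
    and B: "((\<lambda>y. f (x0, y)) has_field_derivative B) (at y0)"
  shows "(f has_derivative (\<lambda>(u, v). A * u + B * v)) (at (x0, y0))"
proof -
  define r1 where "r1 = (\<lambda>u. f (x0 + u, y0) - f (x0, y0) - A * u)"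
  define r2 where "r2 = (\<lambda>v. f (x0, y0 + v) - f (x0, y0) - B * v)"
  define r3 where "r3 = (\<lambda>u v. f (x0 + u, y0 + v) - f (x0 + u, y0) - (f (x0, y0 + v) - f (x0, y0)))"
  have M0: "M \<ge> 0" using bd[of x0 y0] d norm_ge_zero[of "f (x0, y0)"]
    by (meson centre_in_ball order_trans)
  have r1: "((\<lambda>u. norm (r1 u) / norm u) \<longlongrightarrow> 0) (at 0)"
    using A unfolding has_field_derivative_def has_derivative_at r1_def by simp
  have r2: "((\<lambda>u. norm (r2 u) / norm u) \<longlongrightarrow> 0) (at 0)"
    using B unfolding has_field_derivative_def has_derivative_at r2_def by simp
  have r3: "norm (r3 u v) \<le> 16 * M / d\<^sup>2 * norm u * norm v * 2"
    if "norm u < d/2" "norm v < d/2" for u v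
  proof -
    \<comment> \<open>Lipschitz in \<open>y\<close> for each fixed \<open>x\<close>; this small
      bound then serves as the \<open>M\<close> of a second application, in
      \<open>x\<close>.\<close>
    have lip: "norm (f (x, y0 + v) - f (x, y0)) \<le> 4 * M / d * norm v" if x: "x \<in> ball x0 d" for x
      using holomorphic_lipschitz_half_ball[OF h2[OF x] d bd[OF x], of "y0 + v" y0] \<open>norm v < d/2\<close> d
      by (simp add: dist_norm)
    define g where "g = (\<lambda>x. f (x, y0 + v) - f (x, y0))"
    have "norm (g (x0 + u) - g x0) \<le> 4 * (4 * M / d * norm v) / d * norm (x0 + u - x0)"
    proof (rule holomorphic_lipschitz_half_ball)
      show "g holomorphic_on ball x0 d"
        unfolding g_def using \<open>norm v < d/2\<close> d
        by (intro holomorphic_on_diff h1) (auto simp: dist_norm)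
    qed (use that d lip in \<open>auto simp: dist_norm g_def\<close>)
    moreover have "4 * (4 * M / d * norm v) / d * norm (x0 + u - x0) = 16 * M / d\<^sup>2 * norm u * norm v"
      by (simp add: power2_eq_square)
    moreover have "0 \<le> 16 * M / d\<^sup>2 * norm u * norm v"
      using M0 by simp
    ultimately show ?thesis unfolding r3_def g_def by linarith
  qed
  have bl: "bounded_linear (\<lambda>(u, v). A * u + B * v)"
    unfolding case_prod_beta
    by (intro bounded_linear_add bounded_linear_compose[OF bounded_linear_mult_right]
        bounded_linear_fst bounded_linear_snd)
  have "\<exists>\<delta>>0. \<forall>p. norm p < \<delta> \<longrightarrow>
      norm (f ((x0, y0) + p) - f (x0, y0) - (case p of (u, v) \<Rightarrow> A * u + B * v)) \<le> e * norm p"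
    if e: "e > 0" for e
  proof -
    obtain d1 where d1: "d1 > 0" "\<And>u. u \<noteq> 0 \<Longrightarrow> norm u < d1 \<Longrightarrow> norm (r1 u) / norm u < e/3"
      using r1 e unfolding tendsto_iff eventually_at
      by (force dest: spec[of _ "e/3"])
    obtain d2 where d2: "d2 > 0" "\<And>u. u \<noteq> 0 \<Longrightarrow> norm u < d2 \<Longrightarrow> norm (r2 u) / norm u < e/3"
      using r2 e unfolding tendsto_iff eventually_at
      by (force dest: spec[of _ "e/3"])
    have r1': "norm (r1 u) \<le> e/3 * norm u" if "norm u < d1" for u
      using d1(2)[of u] that by (cases "u = 0") (auto simp: r1_def field_simps)
    have r2': "norm (r2 u) \<le> e/3 * norm u" if "norm u < d2" for u
      using d2(2)[of u] that by (cases "u = 0") (auto simp: r2_def field_simps)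
    define C where "C = 32 * M / d\<^sup>2"
    have C0: "C \<ge> 0" using M0 by (simp add: C_def)
    define \<delta> where "\<delta> = min (min d1 d2) (min (d/2) (e / 3 / (C + 1)))"
    have "\<delta> > 0" using d1 d2 d e C0 by (simp add: \<delta>_def)
    moreover have "norm (f ((x0, y0) + p) - f (x0, y0) - (case p of (u, v) \<Rightarrow> A * u + B * v)) \<le> e * norm p"
      if p: "norm p < \<delta>" for p
    proof -
      obtain u v where uv: "p = (u, v)" by force
      have nu: "norm u \<le> norm p" and nv: "norm v \<le> norm p"
        using norm_fst_le[of u v] norm_snd_le[of v u] unfolding uv by simp_all
      have eq: "f ((x0, y0) + p) - f (x0, y0) - (case p of (u, v) \<Rightarrow> A * u + B * v) = r1 u + r2 v + r3 u v"
        unfolding uv r1_def r2_def r3_def by simp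
      have n3: "norm (r3 u v) \<le> C * norm u * norm v"
        using r3[of u v] nu nv p by (simp add: \<delta>_def C_def)
      have "C * norm u \<le> e/3"
      proof -
        have "norm u \<le> e / 3 / (C + 1)" using nu p by (simp add: \<delta>_def)
        then have "(C+1) * norm u \<le> e/3" using C0 by (simp add: pos_le_divide_eq algebra_simps)
        moreover have "C * norm u \<le> (C+1) * norm u" by (simp add: mult_right_mono)
        ultimately show ?thesis by linarith
      qed
      then have "C * norm u * norm v \<le> e/3 * norm v" by (rule mult_right_mono) simp
      moreover have "e/3 * norm u \<le> e/3 * norm p" "e/3 * norm v \<le> e/3 * norm p"
        using nu nv e by (auto intro!: mult_left_mono)
      moreover have "norm (r1 u) \<le> e/3 * norm u" "norm (r2 v) \<le> e/3 * norm v"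
        using r1'[of u] r2'[of v] nu nv p by (auto simp: \<delta>_def)
      ultimately have "norm (r3 u v) \<le> e/3 * norm p" "norm (r1 u) \<le> e/3 * norm p" "norm (r2 v) \<le> e/3 * norm p"
        using n3 by linarith+
      moreover have "norm (r1 u + r2 v + r3 u v) \<le> norm (r1 u) + norm (r2 v) + norm (r3 u v)"
        by (meson norm_triangle_ineq order_trans add_right_mono)
      ultimately have "norm (r1 u + r2 v + r3 u v) \<le> e/3 * norm p + e/3 * norm p + e/3 * norm p"
        by linarith
      then show ?thesis unfolding eq by (simp add: field_simps)
    qed
    ultimately show ?thesis by blast
  qed
  then show ?thesis
    unfolding has_derivative_at_alt using bl
    by (metis (no_types, lifting) add.commute diff_add_cancel)
qed

section \<open>Integrals over the unit interval\<close>

text \<open>Segments are rescaled to one finite measure, so that a constant bound gives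
  integrability. On the open interval, continuity at the end points is not asked for.\<close>

definition U01 :: "real measure" where
  "U01 = restrict_space lborel {0<..<1}"

lemma space_U01 [simp]: "space U01 = {0<..<1}"
  by (simp add: U01_def space_restrict_space)

interpretation U01: finite_measure U01
  by (rule finite_measureI) (simp add: U01_def space_restrict_space emeasure_restrict_space)

lemma measure_U01 [simp]: "measure U01 {0<..<1} = 1"
  by (simp add: U01_def measure_restrict_space)

lemma borel_measurable_U01:
  fixes f :: "real \<Rightarrow> 'b::topological_space"
  assumes "continuous_on {0<..<1} f"
  shows "f \<in> borel_measurable U01"
  using borel_measurable_continuous_on_restrict[OF assms] 
  by (simp add: U01_def cong: measurable_cong_sets sets_restrict_space_cong)

lemma integrable_U01:
  fixes f :: "real \<Rightarrow> 'b::{banach, second_countable_topology}"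
  assumes "continuous_on {0<..<1} f" "\<And>t. 0 < t \<Longrightarrow> t < 1 \<Longrightarrow> norm (f t) \<le> B"
  shows "integrable U01 f"
  using assms by (intro U01.integrable_const_bound[where B=B] borel_measurable_U01) (auto intro!: AE_I2)

text \<open>A non-integrable \<open>f\<close> has integral 0 by default, so the estimate holds
  without any measurability check on \<open>f\<close>.\<close>

lemma norm_integral_U01_le:
  fixes f :: "real \<Rightarrow> 'b::{banach, second_countable_topology}"
  assumes "\<And>t. 0 < t \<Longrightarrow> t < 1 \<Longrightarrow> norm (f t) \<le> g t" "integrable U01 g"
  shows "norm (\<integral>t. f t \<partial>U01) \<le> (\<integral>t. g t \<partial>U01)"
proof (cases "integrable U01 f")
  case True
  then have "norm (\<integral>t. f t \<partial>U01) \<le> (\<integral>t. norm (f t) \<partial>U01)" by simp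
  also have "\<dots> \<le> (\<integral>t. g t \<partial>U01)"
    using True assms by (intro integral_mono) auto
  finally show ?thesis .
next
  case False
  have "0 \<le> (\<integral>t. g t \<partial>U01)"
    using assms(1) by (intro integral_nonneg_AE AE_I2) (auto intro: order_trans[OF norm_ge_zero])
  then show ?thesis using False by (simp add: not_integrable_integral_eq)
qed

lemma norm_integral_U01_le_const:
  fixes f :: "real \<Rightarrow> 'b::{banach, second_countable_topology}"
  assumes "\<And>t. 0 < t \<Longrightarrow> t < 1 \<Longrightarrow> norm (f t) \<le> B"
  shows "norm (\<integral>t. f t \<partial>U01) \<le> B"
  using norm_integral_U01_le[of f "\<lambda>_. B"] assms by simp

text \<open>Passes to the gauge integral, where the derivative is needed only in the interior; this
  avoids the end point 0 for \<open>t powr \<alpha>\<close>.\<close>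

lemma integral_U01_FTC:
  fixes F :: "real \<Rightarrow> 'b::euclidean_space"
  assumes "continuous_on {0..1} F"
    and "\<And>t. 0 < t \<Longrightarrow> t < 1 \<Longrightarrow> (F has_vector_derivative f t) (at t)"
    and "integrable U01 f"
  shows "(\<integral>t. f t \<partial>U01) = F 1 - F 0"
proof -
  have si: "set_integrable lborel {0<..<1} f"
    using assms(3) by (simp add: U01_def set_integrable_restrict_space set_integrable_def
        integrable_restrict_space)
  have "(\<integral>t. f t \<partial>U01) = (LINT t:{0<..<1}|lborel. f t)"
    by (simp add: U01_def set_lebesgue_integral_def integral_restrict_space)
  also have "\<dots> = integral {0<..<1} f"
    by (rule set_borel_integral_eq_integral(2)[OF si])
  also have "\<dots> = integral {0..1} f"
    by (simp add: integral_open_interval_real)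
  also have "\<dots> = F 1 - F 0"
    by (rule integral_unique, rule fundamental_theorem_of_calculus_interior) (use assms in auto)
  finally show ?thesis .
qed

lemma integral_U01_complex_FTC:
  fixes F f :: "complex \<Rightarrow> complex"
  assumes F: "\<And>t. 0 \<le> t \<Longrightarrow> t \<le> 1 \<Longrightarrow> (F has_field_derivative f (a + of_real t * d)) (at (a + of_real t * d))"
    and f: "continuous_on {0..1} (\<lambda>t. f (a + of_real t * d))"
  shows "(\<integral>t. f (a + of_real t * d) * d \<partial>U01) = F (a + d) - F a"
proof -
  have der: "((\<lambda>t. F (a + of_real t * d)) has_vector_derivative f (a + of_real t * d) * d) (at t)"
    if "0 \<le> t" "t \<le> 1" for t
  proof -
    have "((\<lambda>t. a + of_real t * d) has_vector_derivative d) (at t)"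
      by (auto intro!: derivative_eq_intros simp: has_vector_derivative_def scaleR_conv_of_real)
    from field_vector_diff_chain_at[OF this F[OF that]] show ?thesis
      by (simp add: o_def mult.commute)
  qed
  have c: "continuous_on {0..1} (\<lambda>t. f (a + of_real t * d) * d)"
    using f by (intro continuous_intros)
  then have "bounded ((\<lambda>t. f (a + of_real t * d) * d) ` {0..1})"
    by (intro compact_imp_bounded compact_continuous_image) auto
  then obtain B where "\<And>t. t \<in> {0..1} \<Longrightarrow> norm (f (a + of_real t * d) * d) \<le> B"
    unfolding bounded_iff by blast
  then have "integrable U01 (\<lambda>t. f (a + of_real t * d) * d)"
    by (intro integrable_U01[where B=B] continuous_on_subset[OF c]) auto
  then have "(\<integral>t. f (a + of_real t * d) * d \<partial>U01) = F (a + of_real 1 * d) - F (a + of_real 0 * d)"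
    by (intro integral_U01_FTC)
      (auto intro!: der continuous_at_imp_continuous_on
        has_vector_derivative_continuous[OF der])
  then show ?thesis by simp
qed

lemma holomorphic_on_integral_U01:
  fixes h :: "real \<Rightarrow> complex \<Rightarrow> complex"
  assumes S: "open S"
    and hol: "\<And>t. 0 < t \<Longrightarrow> t < 1 \<Longrightarrow> h t holomorphic_on S"
    and cont: "\<And>z. z \<in> S \<Longrightarrow> continuous_on {0<..<1} (\<lambda>t. h t z)"
    and bd: "\<And>z0. z0 \<in> S \<Longrightarrow> \<exists>d>0. \<exists>M. \<forall>t z. 0 < t \<and> t < 1 \<and> z \<in> S \<inter> ball z0 d \<longrightarrow> norm (h t z) \<le> M"
  shows "(\<lambda>z. \<integral>t. h t z \<partial>U01) holomorphic_on S"
    and "\<And>z. z \<in> S \<Longrightarrow> integrable U01 (\<lambda>t. deriv (h t) z)"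
    and "\<And>z. z \<in> S \<Longrightarrow>
      ((\<lambda>z. \<integral>t. h t z \<partial>U01) has_field_derivative (\<integral>t. deriv (h t) z \<partial>U01)) (at z)"
proof -
  have *: "integrable U01 (\<lambda>t. deriv (h t) z) \<and>
    ((\<lambda>z. \<integral>t. h t z \<partial>U01) has_field_derivative (\<integral>t. deriv (h t) z \<partial>U01)) (at z)"
    if z: "z \<in> S" for z
  proof -
    obtain d M where d: "d > 0" "\<And>t x. 0 < t \<Longrightarrow> t < 1 \<Longrightarrow> x \<in> S \<inter> ball z d \<Longrightarrow> norm (h t x) \<le> M"
      using bd[OF z] by auto
    obtain e where e: "e > 0" "ball z e \<subseteq> S"
      using S z open_contains_ball by blast
    define r where "r = min d e"
    have r: "r > 0" "ball z r \<subseteq> S \<inter> ball z d" using d e by (auto simp: r_def)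
    have bd': "norm (h t x) \<le> M" if "t \<in> space U01" "x \<in> ball z r" for t x
      using d(2)[of t x] that subsetD[OF r(2)] by simp
    have hol': "h t holomorphic_on ball z r" if "t \<in> space U01" for t
      using hol[of t] that r(2) holomorphic_on_subset[of "h t" S "ball z r"] by auto
    have meas: "(\<lambda>t. h t x) \<in> borel_measurable U01" if "x \<in> ball z r" for x
      using that r(2) by (intro borel_measurable_U01 cont) auto
    show ?thesis
      using has_field_derivative_lebesgue_integral[OF r(1) hol' meas bd'] by simp
  qed
  then show "\<And>z. z \<in> S \<Longrightarrow> integrable U01 (\<lambda>t. deriv (h t) z)"
    and "\<And>z. z \<in> S \<Longrightarrow>
      ((\<lambda>z. \<integral>t. h t z \<partial>U01) has_field_derivative (\<integral>t. deriv (h t) z \<partial>U01)) (at z)"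
    by auto
  show "(\<lambda>z. \<integral>t. h t z \<partial>U01) holomorphic_on S"
    using * S by (auto simp: holomorphic_on_open)
qed

lemma open_strip: "open (strip \<xi>)"
proof -
  have "strip \<xi> = {z. Im z < \<xi>} \<inter> {z. Im z > - \<xi>}" by (auto simp: strip_def)
  then show ?thesis by (simp add: open_Int open_halfspace_Im_lt open_halfspace_Im_gt)
qed

lemma convex_strip: "convex (strip \<xi>)"
proof -
  have "strip \<xi> = {z. Im z < \<xi>} \<inter> {z. Im z > - \<xi>}" by (auto simp: strip_def)
  then show ?thesis by (simp add: convex_Int convex_halfspace_Im_lt convex_halfspace_Im_gt)
qed

lemma strip_mono: "\<xi> \<le> \<xi>' \<Longrightarrow> strip \<xi> \<subseteq> strip \<xi>'"
  by (auto simp: strip_def)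

lemma strip_shift: "\<theta> \<in> strip \<xi> \<Longrightarrow> \<theta> + of_real s \<in> strip \<xi>" "\<theta> \<in> strip \<xi> \<Longrightarrow> \<theta> - of_real s \<in> strip \<xi>"
  by (auto simp: strip_def)

section \<open>Convolution on a star-shaped domain\<close>

text \<open>
  \<open>\<Omega>\<close> is the domain of the Borel variable \<open>w\<close> and \<open>\<mu>\<close> the weight of the norm; \<open>mu_conv\<close> says
  \<open>\<mu> * \<mu> \<le> \<mu>\<close> for the convolution, and by \<open>mu_one\<close> the number \<open>\<epsilon>\<close> bounds the norm of the constant \<open>1\<close>,
  hence of the multiplication by \<open>x\<close>.
\<close>

locale borel_domain =
  fixes \<Omega> :: "complex set" and \<mu> :: "real \<Rightarrow> real" and \<epsilon> :: real
  assumes open_\<Omega>: "open \<Omega>" and zero_\<Omega>: "0 \<in> \<Omega>"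
    and star_\<Omega>: "\<And>w t. w \<in> \<Omega> \<Longrightarrow> 0 \<le> t \<Longrightarrow> t \<le> 1 \<Longrightarrow> of_real t * w \<in> \<Omega>"
    and eps_pos: "0 < \<epsilon>"
    and mu_mono: "\<And>s t. 0 \<le> s \<Longrightarrow> s \<le> t \<Longrightarrow> \<mu> s \<le> \<mu> t"
    and mu_one: "\<And>t. 0 \<le> t \<Longrightarrow> 1 \<le> \<epsilon> * \<mu> t"
    and mu_cont: "continuous_on {0..} \<mu>"
    and mu_conv: "\<And>t. 0 \<le> t \<Longrightarrow> t * (\<integral>\<tau>. \<mu> (\<tau> * t) * \<mu> ((1 - \<tau>) * t) \<partial>U01) \<le> \<mu> t"
begin

declare of_real_diff [simp del]

lemma mu_pos: "0 \<le> t \<Longrightarrow> 0 < \<mu> t"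
  using mu_one[of t] eps_pos by (metis linorder_not_less mult_nonneg_nonpos2 not_one_le_zero order_trans mult.commute less_le_not_le)

definition separately_hol :: "borel_fun \<Rightarrow> bool" where
  "separately_hol f \<longleftrightarrow> (\<forall>\<theta>\<in>strip 1. (\<lambda>w. f w \<theta>) holomorphic_on \<Omega>) \<and>
     (\<forall>w\<in>\<Omega>. f w holomorphic_on strip 1 \<and> periodic_on_strip 1 (f w))"

text \<open>\<open>elem R\<close> is the closed ball of radius \<open>R\<close> of the weighted space; all estimates are phrased with these balls.\<close>

definition elem :: "real \<Rightarrow> borel_fun \<Rightarrow> bool" where
  "elem R f \<longleftrightarrow> separately_hol f \<and> (\<forall>w\<in>\<Omega>. \<forall>\<theta>\<in>strip 1. norm (f w \<theta>) \<le> R * \<mu> (norm w))"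

lemma zero_strip: "0 \<in> strip 1" by (simp add: strip_def)

lemma separately_holD:
  assumes "separately_hol f"
  shows "\<theta> \<in> strip 1 \<Longrightarrow> (\<lambda>w. f w \<theta>) holomorphic_on \<Omega>"
    and "w \<in> \<Omega> \<Longrightarrow> f w holomorphic_on strip 1"
    and "w \<in> \<Omega> \<Longrightarrow> \<theta> \<in> strip 1 \<Longrightarrow> f w (\<theta> + 2 * of_real pi) = f w \<theta>"
  using assms by (auto simp: separately_hol_def periodic_on_strip_def)

lemma separately_holI:
  assumes "\<And>\<theta>. \<theta> \<in> strip 1 \<Longrightarrow> (\<lambda>w. f w \<theta>) holomorphic_on \<Omega>"
    and "\<And>w. w \<in> \<Omega> \<Longrightarrow> f w holomorphic_on strip 1"
    and "\<And>w \<theta>. w \<in> \<Omega> \<Longrightarrow> \<theta> \<in> strip 1 \<Longrightarrow> f w (\<theta> + 2 * of_real pi) = f w \<theta>"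
  shows "separately_hol f"
  using assms by (auto simp: separately_hol_def periodic_on_strip_def)

lemma elemD: "elem R f \<Longrightarrow> w \<in> \<Omega> \<Longrightarrow> \<theta> \<in> strip 1 \<Longrightarrow> norm (f w \<theta>) \<le> R * \<mu> (norm w)"
  and elem_separately_hol: "elem R f \<Longrightarrow> separately_hol f"
  by (auto simp: elem_def)

lemma elemI: "separately_hol f \<Longrightarrow> (\<And>w \<theta>. w \<in> \<Omega> \<Longrightarrow> \<theta> \<in> strip 1 \<Longrightarrow> norm (f w \<theta>) \<le> R * \<mu> (norm w)) \<Longrightarrow> elem R f"
  by (auto simp: elem_def)

lemma elem_nonneg: "elem R f \<Longrightarrow> 0 \<le> R"
  using elemD[OF _ zero_\<Omega> zero_strip, of R f] mu_pos[of 0] norm_ge_zero[of "f 0 0"]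
  by (smt (verit) norm_zero zero_le_mult_iff)

lemma elem_mono: "elem R f \<Longrightarrow> R \<le> R' \<Longrightarrow> elem R' f"
  by (rule elemI, erule elem_separately_hol, rule order_trans[OF elemD], assumption+,
      rule mult_right_mono) (auto intro: less_imp_le[OF mu_pos])

lemma strip_add_2pi: "\<theta> \<in> strip 1 \<Longrightarrow> \<theta> + 2 * of_real pi \<in> strip 1"
  by (auto simp: strip_def)

lemma separately_hol_cong:
  assumes "separately_hol f" "\<And>w \<theta>. w \<in> \<Omega> \<Longrightarrow> \<theta> \<in> strip 1 \<Longrightarrow> f w \<theta> = g w \<theta>"
  shows "separately_hol g"
proof (rule separately_holI)
  show "(\<lambda>w. g w \<theta>) holomorphic_on \<Omega>" if "\<theta> \<in> strip 1" for \<theta>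
    using separately_holD(1)[OF assms(1) that] assms(2) that by (subst holomorphic_cong[OF refl, of _ _ "\<lambda>w. f w \<theta>"]) auto
  show "g w holomorphic_on strip 1" if "w \<in> \<Omega>" for w
    using separately_holD(2)[OF assms(1) that] assms(2) that by (subst holomorphic_cong[OF refl, of _ _ "f w"]) auto
  show "g w (\<theta> + 2 * of_real pi) = g w \<theta>" if "w \<in> \<Omega>" "\<theta> \<in> strip 1" for w \<theta>
    using separately_holD(3)[OF assms(1) that] assms(2) that strip_add_2pi by metis
qed

lemma elem_cong:
  assumes "elem R f" "\<And>w \<theta>. w \<in> \<Omega> \<Longrightarrow> \<theta> \<in> strip 1 \<Longrightarrow> f w \<theta> = g w \<theta>"
  shows "elem R g"
  using assms by (auto simp: elem_def intro: separately_hol_cong[of f g])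

lemma elem_zero: "elem 0 (\<lambda>w \<theta>. 0)"
  by (auto simp: elem_def separately_hol_def periodic_on_strip_def)

lemma elem_one: "elem \<epsilon> (\<lambda>w \<theta>. 1)"
  using mu_one by (auto simp: elem_def separately_hol_def periodic_on_strip_def)

lemma elem_add: "elem R f \<Longrightarrow> elem S g \<Longrightarrow> elem (R + S) (\<lambda>w \<theta>. f w \<theta> + g w \<theta>)"
  by (auto intro!: elemI separately_holI holomorphic_intros norm_triangle_le add_mono
      simp: distrib_right elemD separately_holD dest!: elem_def[THEN iffD1])

lemma elem_diff: "elem R f \<Longrightarrow> elem S g \<Longrightarrow> elem (R + S) (\<lambda>w \<theta>. f w \<theta> - g w \<theta>)"
  by (auto intro!: elemI separately_holI holomorphic_intros norm_triangle_le_diff add_mono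
      simp: distrib_right elemD separately_holD dest!: elem_def[THEN iffD1])

text \<open>Multipliers that depend on \<theta> alone, such as \<open>cos\<close> and
  \<open>sin\<close>: multiplication by them commutes with the Borel transform in x, so they are not
  convolved.\<close>

definition coef :: "real \<Rightarrow> (complex \<Rightarrow> complex) \<Rightarrow> bool" where
  "coef C c \<longleftrightarrow> c holomorphic_on strip 1 \<and> periodic_on_strip 1 c \<and> (\<forall>\<theta>\<in>strip 1. norm (c \<theta>) \<le> C)"

lemma elem_scale: 
  assumes c: "coef C c" and f: "elem R f" shows "elem (C * R) (\<lambda>w \<theta>. c \<theta> * f w \<theta>)"
proof (rule elemI)
  show "separately_hol (\<lambda>w \<theta>. c \<theta> * f w \<theta>)"
    using c separately_holD[OF elem_separately_hol[OF f]] by (auto intro!: separately_holI holomorphic_intros simp: coef_def periodic_on_strip_def)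
  fix w \<theta> assume *: "w \<in> \<Omega>" "\<theta> \<in> strip 1"
  have "norm (c \<theta>) * norm (f w \<theta>) \<le> C * (R * \<mu> (norm w))"
    using c * elemD[OF f *] by (intro mult_mono) (auto simp: coef_def intro: order_trans[OF norm_ge_zero])
  then show "norm (c \<theta> * f w \<theta>) \<le> C * R * \<mu> (norm w)" by (simp add: norm_mult)
qed

lemma coef_const: "coef (norm c) (\<lambda>_. c)"
  by (simp add: coef_def periodic_on_strip_def)

text \<open>Since \<open>D\<close> is monotone, the bound is locally uniform in \<open>w\<close>: on
  the unit ball around \<open>w0\<close> it is at most \<open>D (norm w0 + 1)\<close>. This is what
  differentiation under the integral asks for.\<close>

lemma separately_hol_integral:
  assumes k: "\<And>t. 0 < t \<Longrightarrow> t < 1 \<Longrightarrow> separately_hol (k t)"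
    and cont: "\<And>w \<theta>. w \<in> \<Omega> \<Longrightarrow> \<theta> \<in> strip 1 \<Longrightarrow> continuous_on {0<..<1} (\<lambda>t. k t w \<theta>)"
    and bd: "\<And>t w \<theta>. 0 < t \<Longrightarrow> t < 1 \<Longrightarrow> w \<in> \<Omega> \<Longrightarrow> \<theta> \<in> strip 1 \<Longrightarrow> norm (k t w \<theta>) \<le> D (norm w)"
    and D: "\<And>s t. 0 \<le> s \<Longrightarrow> s \<le> t \<Longrightarrow> D s \<le> (D t :: real)"
  shows "separately_hol (\<lambda>w \<theta>. \<integral>t. k t w \<theta> \<partial>U01)"
proof (rule separately_holI)
  fix \<theta> assume \<theta>: "\<theta> \<in> strip 1"
  show "(\<lambda>w. \<integral>t. k t w \<theta> \<partial>U01) holomorphic_on \<Omega>"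
  proof (rule holomorphic_on_integral_U01(1)[OF open_\<Omega>])
    fix w0 assume "w0 \<in> \<Omega>"
    have "norm (k t z \<theta>) \<le> D (norm w0 + 1)" if "0 < t" "t < 1" "z \<in> \<Omega>" "z \<in> ball w0 1" for t z
    proof -
      have "norm z \<le> norm w0 + 1"
        using that(4) norm_triangle_ineq2[of z w0] by (simp add: dist_norm norm_minus_commute)
      then show ?thesis using bd[OF that(1-3) \<theta>] D[of "norm z"] by force
    qed
    then show "\<exists>d>0. \<exists>M. \<forall>t z. 0 < t \<and> t < 1 \<and> z \<in> \<Omega> \<inter> ball w0 d \<longrightarrow> norm (k t z \<theta>) \<le> M"
      by (intro exI[of _ 1]) auto
  qed (use cont separately_holD(1)[OF k] \<theta> in auto)
next
  fix w assume w: "w \<in> \<Omega>"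
  show "(\<lambda>\<theta>. \<integral>t. k t w \<theta> \<partial>U01) holomorphic_on strip 1"
  proof (rule holomorphic_on_integral_U01(1)[OF open_strip])
    fix \<theta> assume "\<theta> \<in> strip 1"
    show "\<exists>d>0. \<exists>M. \<forall>t z. 0 < t \<and> t < 1 \<and> z \<in> strip 1 \<inter> ball \<theta> d \<longrightarrow> norm (k t w z) \<le> M"
      using bd[OF _ _ w] by (intro exI[of _ 1]) auto
  qed (use cont separately_holD(2)[OF k] w in auto)
next
  fix w \<theta> assume *: "w \<in> \<Omega>" "\<theta> \<in> strip 1"
  show "(\<integral>t. k t w (\<theta> + 2 * of_real pi) \<partial>U01) = (\<integral>t. k t w \<theta> \<partial>U01)"
    using separately_holD(3)[OF k *] by (intro Bochner_Integration.integral_cong) auto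
qed

text \<open>The integral of f(s) g(w - s) from 0 to w, with \<open>s = t * w\<close>; both arguments
  stay in \<open>\<Omega>\<close> because it is star-shaped about 0.\<close>

definition conv :: "borel_fun \<Rightarrow> borel_fun \<Rightarrow> borel_fun" where
  "conv f g w \<theta> = w * (\<integral>t. f (of_real t * w) \<theta> * g (of_real (1 - t) * w) \<theta> \<partial>U01)"

lemma separately_hol_dilate:
  assumes "separately_hol f" "0 \<le> t" "t \<le> 1" shows "separately_hol (\<lambda>w. f (of_real t * w))"
proof (rule separately_holI)
  fix \<theta> assume "\<theta> \<in> strip 1"
  have "((\<lambda>w. f w \<theta>) \<circ> (\<lambda>w. of_real t * w)) holomorphic_on \<Omega>"
    using separately_holD(1)[OF assms(1) \<open>\<theta> \<in> strip 1\<close>] star_\<Omega> assms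
    by (intro holomorphic_on_compose_gen[where t=\<Omega>] holomorphic_intros) auto
  then show "(\<lambda>w. f (of_real t * w) \<theta>) holomorphic_on \<Omega>" by (simp add: o_def)
qed (use separately_holD[OF assms(1)] star_\<Omega> assms in auto)

lemma continuous_on_ray:
  assumes "separately_hol f" "w \<in> \<Omega>" "\<theta> \<in> strip 1"
  shows "continuous_on {0..1} (\<lambda>t. f (of_real t * w) \<theta>)"
proof -
  have "continuous_on {0..1} ((\<lambda>w. f w \<theta>) \<circ> (\<lambda>t. of_real t * w))"
    using holomorphic_on_imp_continuous_on[OF separately_holD(1)[OF assms(1,3)]] star_\<Omega> assms
    by (intro continuous_on_compose continuous_intros) (auto intro: continuous_on_subset)
  then show ?thesis by (simp add: o_def)
qed

lemma continuous_on_ray_rev: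
  assumes "separately_hol f" "w \<in> \<Omega>" "\<theta> \<in> strip 1"
  shows "continuous_on {0..1} (\<lambda>t. f (of_real (1 - t) * w) \<theta>)"
proof -
  have "continuous_on {0..1} ((\<lambda>t. f (of_real t * w) \<theta>) \<circ> (\<lambda>t. 1 - t))"
    by (intro continuous_on_compose continuous_intros continuous_on_subset[OF continuous_on_ray[OF assms]]) auto
  then show ?thesis by (simp add: o_def)
qed

lemma separately_hol_mult: "separately_hol f \<Longrightarrow> separately_hol g \<Longrightarrow> separately_hol (\<lambda>w \<theta>. f w \<theta> * g w \<theta>)"
  by (auto intro!: separately_holI holomorphic_intros simp: separately_holD)

lemma separately_hol_w: "separately_hol (\<lambda>w \<theta>. w)" by (auto intro!: separately_holI holomorphic_intros)

lemma mu_scale_le: "0 \<le> s \<Longrightarrow> 0 \<le> t \<Longrightarrow> t \<le> 1 \<Longrightarrow> \<mu> (t * s) \<le> \<mu> s"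
  by (rule mu_mono) (auto simp: mult_left_le_one_le)

lemma elem_dilate_bound:
  assumes "elem R f" "w \<in> \<Omega>" "\<theta> \<in> strip 1" "0 \<le> t" "t \<le> 1"
  shows "norm (f (of_real t * w) \<theta>) \<le> R * \<mu> (t * norm w)"
  using elemD[OF assms(1) star_\<Omega>[OF assms(2,4,5)] assms(3)] assms(4) by (simp add: norm_mult)

lemma conv_integrand_bound:
  assumes f: "elem R f" and g: "elem S g" and "w \<in> \<Omega>" "\<theta> \<in> strip 1" "0 \<le> t" "t \<le> 1"
  shows "norm (f (of_real t * w) \<theta> * g (of_real (1 - t) * w) \<theta>) \<le> R * S * (\<mu> (t * norm w) * \<mu> ((1 - t) * norm w))"
proof -
  have "norm (f (of_real t * w) \<theta>) * norm (g (of_real (1 - t) * w) \<theta>) \<le> (R * \<mu> (t * norm w)) * (S * \<mu> ((1-t) * norm w))"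
    using elem_dilate_bound[OF f assms(3,4), of t] elem_dilate_bound[OF g assms(3,4), of "1-t"] assms
    by (intro mult_mono) (auto intro: order_trans[OF norm_ge_zero])
  then show ?thesis by (simp add: norm_mult ac_simps)
qed

text \<open>Cruder than the previous bound but free of \<open>t\<close>: it serves integrability and
  holomorphy, the sharp one serves the norm.\<close>

lemma conv_integrand_bound':
  assumes f: "elem R f" and g: "elem S g" and *: "w \<in> \<Omega>" "\<theta> \<in> strip 1" "0 \<le> t" "t \<le> 1"
  shows "norm (f (of_real t * w) \<theta> * g (of_real (1 - t) * w) \<theta>) \<le> R * S * (\<mu> (norm w) * \<mu> (norm w))"
proof -
  have "\<mu> (t * norm w) * \<mu> ((1 - t) * norm w) \<le> \<mu> (norm w) * \<mu> (norm w)"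
    using * by (intro mult_mono mu_scale_le less_imp_le[OF mu_pos]) auto
  then show ?thesis
    using conv_integrand_bound[OF assms] mult_left_mono[of _ _ "R * S"] elem_nonneg[OF f] elem_nonneg[OF g]
    by (meson mult_nonneg_nonneg order_trans)
qed

lemma conv_integrand_cont:
  assumes "separately_hol f" "separately_hol g" "w \<in> \<Omega>" "\<theta> \<in> strip 1"
  shows "continuous_on {0<..<1} (\<lambda>t. f (of_real t * w) \<theta> * g (of_real (1 - t) * w) \<theta>)"
  using assms by (intro continuous_intros continuous_on_subset[OF continuous_on_ray]
      continuous_on_subset[OF continuous_on_ray_rev]) auto

lemma conv_integrable:
  assumes "elem R f" "elem S g" "w \<in> \<Omega>" "\<theta> \<in> strip 1"
  shows "integrable U01 (\<lambda>t. f (of_real t * w) \<theta> * g (of_real (1 - t) * w) \<theta>)"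
  by (rule integrable_U01[OF conv_integrand_cont[OF elem_separately_hol elem_separately_hol, OF assms]])
    (rule conv_integrand_bound'[OF assms], auto)

lemma mu_conv_integrable:
  assumes "0 \<le> s" shows "integrable U01 (\<lambda>t. \<mu> (t * s) * \<mu> ((1 - t) * s))"
proof (rule integrable_U01[where B="\<mu> s * \<mu> s"])
  show "continuous_on {0<..<1} (\<lambda>t. \<mu> (t * s) * \<mu> ((1 - t) * s))"
    using assms by (intro continuous_intros continuous_on_compose2[OF mu_cont]) auto
  fix t :: real assume t: "0 < t" "t < 1"
  then have "\<mu> (t * s) * \<mu> ((1 - t) * s) \<le> \<mu> s * \<mu> s"
    using assms by (intro mult_mono mu_scale_le less_imp_le[OF mu_pos]) auto
  then show "norm (\<mu> (t * s) * \<mu> ((1 - t) * s)) \<le> \<mu> s * \<mu> s"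
    using t assms mu_pos[of "t * s"] mu_pos[of "(1 - t) * s"] by simp
qed

text \<open>The integral along the ray is dominated by the convolution of the weight with itself, so
  by \<open>mu_conv\<close> the radii simply multiply.\<close>

lemma elem_conv:
  assumes f: "elem R f" and g: "elem S g"
  shows "elem (R * S) (conv f g)"
proof (rule elemI)
  have "separately_hol (\<lambda>w \<theta>. \<integral>t. f (of_real t * w) \<theta> * g (of_real (1 - t) * w) \<theta> \<partial>U01)"
  proof (rule separately_hol_integral[where D="\<lambda>s. R * S * (\<mu> s * \<mu> s)"])
    fix s t :: real assume "0 \<le> s" "s \<le> t"
    then have "\<mu> s * \<mu> s \<le> \<mu> t * \<mu> t"
      by (intro mult_mono mu_mono less_imp_le[OF mu_pos]) auto
    then show "R * S * (\<mu> s * \<mu> s) \<le> R * S * (\<mu> t * \<mu> t)"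
      using elem_nonneg[OF f] elem_nonneg[OF g] by (intro mult_left_mono) auto
  qed (use conv_integrand_bound'[OF f g] conv_integrand_cont elem_separately_hol[OF f] elem_separately_hol[OF g] 
      in \<open>auto intro!: separately_hol_mult separately_hol_dilate\<close>)
  then show "separately_hol (conv f g)"
    unfolding conv_def[abs_def] by (intro separately_hol_mult separately_hol_w)
next
  fix w \<theta> assume *: "w \<in> \<Omega>" "\<theta> \<in> strip 1"
  have "norm (\<integral>t. f (of_real t * w) \<theta> * g (of_real (1 - t) * w) \<theta> \<partial>U01)
      \<le> (\<integral>t. R * S * (\<mu> (t * norm w) * \<mu> ((1 - t) * norm w)) \<partial>U01)"
    using conv_integrand_bound[OF f g *] mu_conv_integrable[of "norm w"]
    by (intro norm_integral_U01_le) auto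
  also have "\<dots> = R * S * (\<integral>t. \<mu> (t * norm w) * \<mu> ((1 - t) * norm w) \<partial>U01)" by simp
  finally have "norm (conv f g w \<theta>) \<le> norm w * (R * S * (\<integral>t. \<mu> (t * norm w) * \<mu> ((1 - t) * norm w) \<partial>U01))"
    by (simp add: conv_def norm_mult mult_left_mono)
  also have "\<dots> = R * S * (norm w * (\<integral>t. \<mu> (t * norm w) * \<mu> ((1 - t) * norm w) \<partial>U01))" by simp
  also have "\<dots> \<le> R * S * \<mu> (norm w)"
    using elem_nonneg[OF f] elem_nonneg[OF g] by (intro mult_left_mono mu_conv) auto
  finally show "norm (conv f g w \<theta>) \<le> R * S * \<mu> (norm w)" .
qed

lemma conv_diff_left:
  assumes "elem R f" "elem R' f'" "elem S g" "w \<in> \<Omega>" "\<theta> \<in> strip 1"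
  shows "conv (\<lambda>w \<theta>. f w \<theta> - f' w \<theta>) g w \<theta> = conv f g w \<theta> - conv f' g w \<theta>"
  using conv_integrable[OF assms(1,3-5)] conv_integrable[OF assms(2,3-5)]
  by (simp add: conv_def left_diff_distrib Bochner_Integration.integral_diff right_diff_distrib)

lemma conv_diff_right:
  assumes "elem R f" "elem R' f'" "elem S g" "w \<in> \<Omega>" "\<theta> \<in> strip 1"
  shows "conv g (\<lambda>w \<theta>. f w \<theta> - f' w \<theta>) w \<theta> = conv g f w \<theta> - conv g f' w \<theta>"
  using conv_integrable[OF assms(3,1,4,5)] conv_integrable[OF assms(3,2,4,5)]
  by (simp add: conv_def right_diff_distrib Bochner_Integration.integral_diff)

lemma holomorphic_on_suminf_Mtest:
  fixes f :: "nat \<Rightarrow> complex \<Rightarrow> complex"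
  assumes S: "open S" and f: "\<And>n. f n holomorphic_on S"
    and bd: "\<And>z0. z0 \<in> S \<Longrightarrow> \<exists>d>0. \<exists>B. summable B \<and> (\<forall>n. \<forall>z\<in>S \<inter> ball z0 d. norm (f n z) \<le> B n)"
  shows "(\<lambda>z. \<Sum>n. f n z) holomorphic_on S"
proof (rule holomorphic_uniform_sequence[OF S, where f="\<lambda>N z. \<Sum>n<N. f n z"])
  show "(\<lambda>z. \<Sum>n<N. f n z) holomorphic_on S" for N
    using f by (intro holomorphic_intros)
  fix z0 assume z0: "z0 \<in> S"
  obtain d B where d: "d > 0" "summable B" "\<And>n z. z \<in> S \<inter> ball z0 d \<Longrightarrow> norm (f n z) \<le> B n"
    using bd[OF z0] by auto
  obtain e where e: "e > 0" "cball z0 e \<subseteq> S" using S z0 open_contains_cball by blast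
  define r where "r = min (d/2) e"
  have r: "r > 0" "cball z0 r \<subseteq> S \<inter> ball z0 d" using d e by (auto simp: r_def)
  have "uniform_limit (cball z0 r) (\<lambda>N z. \<Sum>n<N. f n z) (\<lambda>z. \<Sum>n. f n z) sequentially"
    using subsetD[OF r(2)] d by (intro Weierstrass_m_test[where M=B]) auto
  then show "\<exists>d>0. cball z0 d \<subseteq> S \<and> uniform_limit (cball z0 d) (\<lambda>N z. \<Sum>n<N. f n z) (\<lambda>z. \<Sum>n. f n z) sequentially"
    using r by auto
qed

text \<open>Near \<open>w0\<close> the terms are majorized by
  \<open>R n * \<mu> (norm w0 + 1)\<close>, so the convergence is locally uniform. This replaces
  completeness of the weighted space.\<close>

lemma elem_suminf:
  assumes f: "\<And>n. elem (R n) (f n)" and R: "summable R"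
  shows "elem (\<Sum>n. R n) (\<lambda>w \<theta>. \<Sum>n. f n w \<theta>)"
    and "\<And>w \<theta>. w \<in> \<Omega> \<Longrightarrow> \<theta> \<in> strip 1 \<Longrightarrow> summable (\<lambda>n. f n w \<theta>)"
proof -
  have sum: "summable (\<lambda>n. R n * c)" for c using R by (rule summable_mult2)
  have sn: "summable (\<lambda>n. norm (f n w \<theta>))" if "w \<in> \<Omega>" "\<theta> \<in> strip 1" for w \<theta>
    using elemD[OF f that] by (intro summable_comparison_test[OF _ sum[of "\<mu> (norm w)"]]) auto
  then show s: "\<And>w \<theta>. w \<in> \<Omega> \<Longrightarrow> \<theta> \<in> strip 1 \<Longrightarrow> summable (\<lambda>n. f n w \<theta>)"
    by (rule summable_norm_cancel)
  show "elem (\<Sum>n. R n) (\<lambda>w \<theta>. \<Sum>n. f n w \<theta>)"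
  proof (rule elemI)
    fix w \<theta> assume *: "w \<in> \<Omega>" "\<theta> \<in> strip 1"
    have "norm (\<Sum>n. f n w \<theta>) \<le> (\<Sum>n. norm (f n w \<theta>))" by (rule summable_norm[OF sn[OF *]])
    also have "\<dots> \<le> (\<Sum>n. R n * \<mu> (norm w))" by (intro suminf_le sn * sum elemD[OF f])
    also have "\<dots> = (\<Sum>n. R n) * \<mu> (norm w)" by (rule suminf_mult2[OF R, symmetric])
    finally show "norm (\<Sum>n. f n w \<theta>) \<le> (\<Sum>n. R n) * \<mu> (norm w)" .
  next
    show "separately_hol (\<lambda>w \<theta>. \<Sum>n. f n w \<theta>)"
    proof (rule separately_holI)
      fix \<theta> assume \<theta>: "\<theta> \<in> strip 1"
      show "(\<lambda>w. \<Sum>n. f n w \<theta>) holomorphic_on \<Omega>"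
      proof (rule holomorphic_on_suminf_Mtest[OF open_\<Omega> separately_holD(1)[OF elem_separately_hol[OF f] \<theta>]])
        fix w0 assume "w0 \<in> \<Omega>"
        have "norm (f n z \<theta>) \<le> R n * \<mu> (norm w0 + 1)" if "z \<in> \<Omega> \<inter> ball w0 1" for n z
        proof -
          have "norm z \<le> norm w0 + 1"
            using that norm_triangle_ineq2[of z w0] by (simp add: dist_norm norm_minus_commute)
          then have "R n * \<mu> (norm z) \<le> R n * \<mu> (norm w0 + 1)"
            by (intro mult_left_mono mu_mono elem_nonneg[OF f]) auto
          then show ?thesis
            using elemD[OF f, of z \<theta> n] that \<theta> by auto
        qed
        then show "\<exists>d>0. \<exists>B. summable B \<and> (\<forall>n. \<forall>z\<in>\<Omega> \<inter> ball w0 d. norm (f n z \<theta>) \<le> B n)"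
          using sum by (intro exI[of _ 1] conjI exI[of _ "\<lambda>n. R n * \<mu> (norm w0 + 1)"]) auto
      qed
    next
      fix w assume w: "w \<in> \<Omega>"
      show "(\<lambda>\<theta>. \<Sum>n. f n w \<theta>) holomorphic_on strip 1"
        using elemD[OF f w] sum
        by (intro holomorphic_on_suminf_Mtest[OF open_strip separately_holD(2)[OF elem_separately_hol[OF f] w]]
            exI[of _ "1::real"] conjI exI[of _ "\<lambda>n. R n * \<mu> (norm w)"]) simp_all
    qed (simp add: separately_holD(3)[OF elem_separately_hol[OF f]])
  qed
qed

section \<open>Bounded operators\<close>

text \<open>Additivity is stated as compatibility with differences, the form that Lipschitz
  estimates use, and only on \<open>\<Omega>\<close> times the strip, because the values of a
  \<open>borel_fun\<close> elsewhere are arbitrary.\<close>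

definition bounded_op :: "real \<Rightarrow> (borel_fun \<Rightarrow> borel_fun) \<Rightarrow> bool" where
  "bounded_op C P \<longleftrightarrow> (\<forall>R f. elem R f \<longrightarrow> elem (C * R) (P f)) \<and>
     (\<forall>R S f g w \<theta>. elem R f \<longrightarrow> elem S g \<longrightarrow> w \<in> \<Omega> \<longrightarrow> \<theta> \<in> strip 1 \<longrightarrow>
        P (\<lambda>w \<theta>. f w \<theta> - g w \<theta>) w \<theta> = P f w \<theta> - P g w \<theta>)"

lemma separately_hol_const: "separately_hol (\<lambda>w \<theta>. c)"
  by (rule separately_holI) auto

lemma bounded_opI:
  assumes "\<And>R f. elem R f \<Longrightarrow> elem (C * R) (P f)"
    and "\<And>R S f g w \<theta>. elem R f \<Longrightarrow> elem S g \<Longrightarrow> w \<in> \<Omega> \<Longrightarrow> \<theta> \<in> strip 1 \<Longrightarrow>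
        P (\<lambda>w \<theta>. f w \<theta> - g w \<theta>) w \<theta> = P f w \<theta> - P g w \<theta>"
  shows "bounded_op C P"
  using assms unfolding bounded_op_def by blast

lemma bounded_op_elem: "bounded_op C P \<Longrightarrow> elem R f \<Longrightarrow> elem (C * R) (P f)"
  and bounded_op_diff: "bounded_op C P \<Longrightarrow> elem R f \<Longrightarrow> elem S g \<Longrightarrow> w \<in> \<Omega> \<Longrightarrow> \<theta> \<in> strip 1 \<Longrightarrow>
        P (\<lambda>w \<theta>. f w \<theta> - g w \<theta>) w \<theta> = P f w \<theta> - P g w \<theta>"
  unfolding bounded_op_def by blast+

lemma elem_cmult: "elem R f \<Longrightarrow> elem (norm c * R) (\<lambda>w \<theta>. c * f w \<theta>)"
  using elem_scale[OF coef_const] .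

lemma bounded_op_id: "bounded_op 1 (\<lambda>f. f)" by (rule bounded_opI) auto

lemma bounded_op_add:
  assumes P: "bounded_op C P" and Q: "bounded_op D Q" shows "bounded_op (C + D) (\<lambda>f w \<theta>. P f w \<theta> + Q f w \<theta>)"
proof (rule bounded_opI)
  show "elem ((C + D) * R) (\<lambda>w \<theta>. P f w \<theta> + Q f w \<theta>)" if "elem R f" for R f
    using elem_add[OF bounded_op_elem[OF P that] bounded_op_elem[OF Q that]] by (simp only: distrib_right)
qed (simp only: bounded_op_diff[OF P] bounded_op_diff[OF Q] add_diff_add)

lemma bounded_op_sub:
  assumes P: "bounded_op C P" and Q: "bounded_op D Q" shows "bounded_op (C + D) (\<lambda>f w \<theta>. P f w \<theta> - Q f w \<theta>)"
proof (rule bounded_opI)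
  show "elem ((C + D) * R) (\<lambda>w \<theta>. P f w \<theta> - Q f w \<theta>)" if "elem R f" for R f
    using elem_diff[OF bounded_op_elem[OF P that] bounded_op_elem[OF Q that]] by (simp only: distrib_right)
qed (simp add: bounded_op_diff[OF P] bounded_op_diff[OF Q])

lemma bounded_op_scale:
  assumes P: "bounded_op C P" shows "bounded_op (norm c * C) (\<lambda>f w \<theta>. c * P f w \<theta>)"
proof (rule bounded_opI)
  show "elem (norm c * C * R) (\<lambda>w \<theta>. c * P f w \<theta>)" if "elem R f" for R f
    using elem_cmult[OF bounded_op_elem[OF P that], of c] by (simp only: mult.assoc)
qed (simp only: bounded_op_diff[OF P] right_diff_distrib)

lemma bounded_op_mono:
  assumes P: "bounded_op C P" and "C \<le> D" shows "bounded_op D P"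
proof (rule bounded_opI)
  show "elem (D * R) (P f)" if f: "elem R f" for R f
    by (rule elem_mono[OF bounded_op_elem[OF P f] mult_right_mono[OF \<open>C \<le> D\<close> elem_nonneg[OF f]]])
qed (rule bounded_op_diff[OF P])

text \<open>The difference of two functions that agree on the domain lies in the ball of radius 0,
  hence so does its image: a bounded operator cannot see values outside the domain.\<close>

lemma bounded_op_cong_elem:
  assumes Q: "bounded_op D Q" and "\<And>w \<theta>. w \<in> \<Omega> \<Longrightarrow> \<theta> \<in> strip 1 \<Longrightarrow> f w \<theta> = g w \<theta>"
    and "elem R f" "elem S g" "w \<in> \<Omega>" "\<theta> \<in> strip 1"
  shows "Q f w \<theta> = Q g w \<theta>"
proof -
  have "elem 0 (\<lambda>w \<theta>. f w \<theta> - g w \<theta>)" by (rule elem_cong[OF elem_zero]) (use assms in auto)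
  then have "elem (D * 0) (Q (\<lambda>w \<theta>. f w \<theta> - g w \<theta>))" by (rule bounded_op_elem[OF Q])
  then have "norm (Q (\<lambda>w \<theta>. f w \<theta> - g w \<theta>) w \<theta>) \<le> 0" using elemD[of "D * 0"] assms by force
  then show ?thesis using bounded_op_diff[OF Q assms(3-6)] by simp
qed

lemma bounded_op_comp: 
  assumes P: "bounded_op C P" and Q: "bounded_op D Q" shows "bounded_op (D * C) (\<lambda>f. Q (P f))"
proof (rule bounded_opI)
  show "elem (D * C * R) (Q (P f))" if "elem R f" for R f
    using bounded_op_elem[OF Q bounded_op_elem[OF P that]] by (simp add: mult.assoc)
  show "Q (P (\<lambda>w \<theta>. f w \<theta> - g w \<theta>)) w \<theta> = Q (P f) w \<theta> - Q (P g) w \<theta>"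
    if *: "elem R f" "elem S g" "w \<in> \<Omega>" "\<theta> \<in> strip 1" for R S f g w \<theta>
  proof -
    note Pf = bounded_op_elem[OF P *(1)] and Pg = bounded_op_elem[OF P *(2)]
    have "Q (P (\<lambda>w \<theta>. f w \<theta> - g w \<theta>)) w \<theta> = Q (\<lambda>w \<theta>. P f w \<theta> - P g w \<theta>) w \<theta>"
      using bounded_op_cong_elem[OF Q bounded_op_diff[OF P *(1,2)] bounded_op_elem[OF P elem_diff[OF *(1,2)]]
          elem_diff[OF Pf Pg] *(3,4)] .
    also have "\<dots> = Q (P f) w \<theta> - Q (P g) w \<theta>" by (rule bounded_op_diff[OF Q Pf Pg *(3,4)])
    finally show ?thesis .
  qed
qed

text \<open>\<open>J\<close> is the Borel transform of the multiplication by \<open>x\<close>, because \<open>1\<close> is that of the function \<open>x\<close>.\<close>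

definition J :: "borel_fun \<Rightarrow> borel_fun" where
  "J f = conv (\<lambda>w \<theta>. 1) f"

lemma bounded_op_conv: "elem R f \<Longrightarrow> bounded_op R (conv f)"
  by (rule bounded_opI) (auto intro: elem_conv conv_diff_right)

lemma bounded_op_J: "bounded_op \<epsilon> J"
  unfolding J_def[abs_def] by (rule bounded_op_conv[OF elem_one])

lemma elem_J: "elem R f \<Longrightarrow> elem (\<epsilon> * R) (J f)"
  by (rule bounded_op_elem[OF bounded_op_J])

lemma separately_hol_primitive:
  assumes "separately_hol f" "\<theta> \<in> strip 1"
  obtains P where "\<And>w. w \<in> \<Omega> \<Longrightarrow> (P has_field_derivative f w \<theta>) (at w)"
proof -
  have star: "closed_segment 0 w \<subseteq> \<Omega>" if "w \<in> \<Omega>" for w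
    using star_\<Omega>[OF that] by (auto simp: closed_segment_def scaleR_conv_of_real)
  have "\<exists>g. \<forall>x\<in>\<Omega>. (g has_field_derivative f x \<theta>) (at x)"
  proof (rule holomorphic_starlike_primitive[of \<Omega> "\<lambda>w. f w \<theta>" "{}"])
    show "continuous_on \<Omega> (\<lambda>w. f w \<theta>)"
      using separately_holD(1)[OF assms] holomorphic_on_imp_continuous_on by blast
    show "starlike \<Omega>" using star zero_\<Omega> by (auto simp: starlike_def)
    show "open \<Omega>" by (rule open_\<Omega>)
    show "(\<lambda>w. f w \<theta>) field_differentiable at x" if "x \<in> \<Omega> - {}" for x
      using separately_holD(1)[OF assms] open_\<Omega> that holomorphic_on_imp_differentiable_at by auto
  qed auto
  then show ?thesis using that by auto
qed

lemma J_eq_primitive: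
  assumes f: "separately_hol f" "\<theta> \<in> strip 1" and P: "\<And>z. z \<in> \<Omega> \<Longrightarrow> (P has_field_derivative f z \<theta>) (at z)"
    and w: "w \<in> \<Omega>"
  shows "J f w \<theta> = P w - P 0"
proof -
  \<comment> \<open>\<open>J f\<close> evaluates \<open>f\<close> at \<open>(1 - t) * w\<close>, so
    the segment is traversed from \<open>w\<close> to 0.\<close>
  have seg: "w + of_real t * - w \<in> \<Omega>" if "0 \<le> t" "t \<le> 1" for t
    using star_\<Omega>[OF w, of "1 - t"] that by (simp add: algebra_simps of_real_diff)
  have "(\<integral>t. f (w + of_real t * - w) \<theta> * - w \<partial>U01) = P (w + - w) - P w"
  proof (rule integral_U01_complex_FTC)
    show "(P has_field_derivative f (w + of_real t * - w) \<theta>) (at (w + of_real t * - w))"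
      if "0 \<le> t" "t \<le> 1" for t
      using P seg that by auto
    show "continuous_on {0..1} (\<lambda>t. f (w + of_real t * - w) \<theta>)"
      using continuous_on_ray_rev[OF f(1) w f(2)] by (simp add: algebra_simps of_real_diff)
  qed
  moreover have "(\<lambda>t. f (of_real (1 - t) * w) \<theta>) = (\<lambda>t. f (w + of_real t * - w) \<theta>)"
    by (simp add: algebra_simps of_real_diff)
  ultimately show ?thesis
    by (simp add: J_def conv_def) (metis minus_diff_eq minus_equation_iff mult.commute)
qed

lemma J_has_field_derivative:
  assumes f: "separately_hol f" "\<theta> \<in> strip 1" and w: "w \<in> \<Omega>"
  shows "((\<lambda>w. J f w \<theta>) has_field_derivative f w \<theta>) (at w)"
proof -
  obtain P where P: "\<And>w. w \<in> \<Omega> \<Longrightarrow> (P has_field_derivative f w \<theta>) (at w)"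
    using separately_hol_primitive[OF f] by blast
  have "((\<lambda>w. P w - P 0) has_field_derivative f w \<theta>) (at w)"
    using P[OF w] by (auto intro!: derivative_eq_intros)
  then show ?thesis
    by (rule has_field_derivative_transform_within_open[OF _ open_\<Omega> w])
      (simp add: J_eq_primitive[OF f P])
qed

lemma J_zero [simp]: "J f 0 \<theta> = 0"
  by (simp add: J_def conv_def)

text \<open>Both sides vanish at 0 and have the same derivative. In this way an unbounded factor
  \<open>w\<close> is traded for \<open>J\<close> applied to an element of the space.\<close>

lemma w_mult_eq_J:
  assumes f: "elem R f" and g: "elem S g" and w: "w \<in> \<Omega>" "\<theta> \<in> strip 1"
    and der: "\<And>z. z \<in> \<Omega> \<Longrightarrow> \<exists>D. ((\<lambda>w. f w \<theta>) has_field_derivative D) (at z) \<and> z * D + f z \<theta> = g z \<theta>"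
  shows "w * f w \<theta> = J g w \<theta>"
proof -
  have "((\<lambda>w. w * f w \<theta>) has_field_derivative g z \<theta>) (at z)" if z: "z \<in> \<Omega>" for z
  proof -
    obtain D where D: "((\<lambda>w. f w \<theta>) has_field_derivative D) (at z)" "z * D + f z \<theta> = g z \<theta>"
      using der[OF z] by blast
    have "((\<lambda>w. w * f w \<theta>) has_field_derivative z * D + f z \<theta>) (at z)"
      using DERIV_mult[OF DERIV_ident D(1)] by (simp add: add.commute mult.commute)
    then show ?thesis using D(2) by simp
  qed
  from J_eq_primitive[OF elem_separately_hol[OF g] w(2) this w(1)] show ?thesis by simp
qed

lemma J_deriv_theta:
  assumes f: "elem R f" and w: "w \<in> \<Omega>" "\<theta> \<in> strip 1"
    and der: "\<And>z. z \<in> \<Omega> \<Longrightarrow> z \<noteq> 0 \<Longrightarrow> (f z has_field_derivative g z \<theta>) (at \<theta>)"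
  shows "(J f w has_field_derivative J g w \<theta>) (at \<theta>)"
proof (cases "w = 0")
  case True
  have "J f w = (\<lambda>\<theta>. 0)" "J g w \<theta> = 0" using True by (auto simp: fun_eq_iff)
  then show ?thesis by simp
next
  case False
  let ?h = "\<lambda>t::real. f (of_real (1 - t) * w)"
  have m: "of_real (1 - t) * w \<in> \<Omega>" if "0 < t" "t < 1" for t using star_\<Omega>[OF w(1), of "1 - t"] that by auto
  have "((\<lambda>z. \<integral>t. ?h t z \<partial>U01) has_field_derivative (\<integral>t. deriv (?h t) \<theta> \<partial>U01)) (at \<theta>)"
  proof (rule holomorphic_on_integral_U01(3)[OF open_strip, where h="?h"])
    show "?h t holomorphic_on strip 1" if "0 < t" "t < 1" for t :: real
      using separately_holD(2)[OF elem_separately_hol[OF f] m[OF that]] .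
    show "continuous_on {0<..<1} (\<lambda>t. ?h t z)" if "z \<in> strip 1" for z
      using continuous_on_ray_rev[OF elem_separately_hol[OF f] w(1) that] by (rule continuous_on_subset) auto
    show "\<exists>d>0. \<exists>M. \<forall>t z. 0 < t \<and> t < 1 \<and> z \<in> strip 1 \<inter> ball z0 d \<longrightarrow> norm (?h (t::real) z) \<le> M" 
      if "z0 \<in> strip 1" for z0
    proof (rule exI[of _ 1], rule conjI[OF zero_less_one], rule exI[of _ "R * \<mu> (norm w)"], intro allI impI)
      fix t :: real and z assume tz: "0 < t \<and> t < 1 \<and> z \<in> strip 1 \<inter> ball z0 1"
      then have "norm (?h t z) \<le> R * \<mu> ((1 - t) * norm w)"
        using elem_dilate_bound[OF f w(1), of z "1 - t"] by auto
      also have "\<dots> \<le> R * \<mu> (norm w)"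
        using tz by (intro mult_left_mono mu_scale_le elem_nonneg[OF f]) auto
      finally show "norm (?h t z) \<le> R * \<mu> (norm w)" .
    qed
  qed (use w in auto)
  moreover have "(\<integral>t. deriv (?h t) \<theta> \<partial>U01) = (\<integral>t. g (of_real (1 - t) * w) \<theta> \<partial>U01)"
    using False by (intro Bochner_Integration.integral_cong refl DERIV_imp_deriv der m) auto
  ultimately have "((\<lambda>z. w * (\<integral>t. ?h t z \<partial>U01)) has_field_derivative w * (\<integral>t. g (of_real (1 - t) * w) \<theta> \<partial>U01)) (at \<theta>)"
    by (intro DERIV_cmult) simp
  then show ?thesis by (simp add: J_def conv_def[abs_def])
qed

section \<open>Inverting the linear part\<close>

text \<open>The sign of the shift is that of the shifts \<theta> - 2 \<pi> t in the kernel of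
  \<open>K\<close>, which makes \<open>periodic_mean\<close> applicable.\<close>

definition mean_op :: "borel_fun \<Rightarrow> borel_fun" where
  "mean_op f w \<theta> = (\<integral>t. f w (- of_real (2 * pi * t)) \<partial>U01)"

lemma real_in_strip: "- of_real s \<in> strip 1" "of_real s \<in> strip 1"
  by (auto simp: strip_def)

lemma mean_op_integrable:
  assumes f: "elem R f" and w: "w \<in> \<Omega>"
  shows "integrable U01 (\<lambda>t. f w (- of_real (2 * pi * t)))"
    and "continuous_on A (\<lambda>t. f w (- of_real (2 * pi * t)))"
proof -
  show c: "continuous_on A (\<lambda>t. f w (- of_real (2 * pi * t)))" for A
    by (rule continuous_on_compose2[OF holomorphic_on_imp_continuous_on[OF separately_holD(2)[OF elem_separately_hol[OF f] w]]])
      (auto intro!: continuous_intros simp: strip_def)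
  show "integrable U01 (\<lambda>t. f w (- of_real (2 * pi * t)))"
    by (rule integrable_U01[OF c]) (rule elemD[OF f w real_in_strip(1)])
qed

lemma bounded_op_mean_op: "bounded_op 1 mean_op"
proof (rule bounded_opI)
  fix R f assume f: "elem R f"
  show "elem (1 * R) (mean_op f)"
  proof (rule elemI)
    show "separately_hol (mean_op f)" unfolding mean_op_def[abs_def]
    proof (rule separately_hol_integral[where D="\<lambda>s. R * \<mu> s"])
      show "separately_hol (\<lambda>w \<theta>. f w (- of_real (2 * pi * t)))" for t
        by (rule separately_holI) (use separately_holD(1)[OF elem_separately_hol[OF f] real_in_strip(1)] in \<open>simp_all del: of_real_mult\<close>)
    qed (use elemD[OF f _ real_in_strip(1)] mean_op_integrable(2)[OF f] elem_nonneg[OF f]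
         in \<open>auto intro!: mult_left_mono mu_mono simp del: of_real_mult\<close>)
    show "norm (mean_op f w \<theta>) \<le> 1 * R * \<mu> (norm w)" if "w \<in> \<Omega>" for w \<theta>
      unfolding mean_op_def using elemD[OF f that real_in_strip(1)]
      by (intro norm_integral_U01_le_const) (auto simp del: of_real_mult)
  qed
next
  fix R S f g w \<theta> assume *: "elem R f" "elem S g" "w \<in> \<Omega>" "\<theta> \<in> strip 1"
  show "mean_op (\<lambda>w \<theta>. f w \<theta> - g w \<theta>) w \<theta> = mean_op f w \<theta> - mean_op g w \<theta>"
    unfolding mean_op_def
    by (rule Bochner_Integration.integral_diff[OF mean_op_integrable(1)[OF *(1,3)] mean_op_integrable(1)[OF *(2,3)]])
qed

text \<open>Solves \<open>w g' + \<alpha> g = f\<close>.\<close>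

definition euler_op :: "real \<Rightarrow> borel_fun \<Rightarrow> borel_fun" where
  "euler_op \<alpha> f w \<theta> = (\<integral>t. of_real (t powr (\<alpha> - 1)) * f (of_real t * w) \<theta> \<partial>U01)"

context
  fixes \<alpha> :: real assumes alpha: "1 < \<alpha>"
begin

lemma euler_op_integrand_bound:
  assumes f: "elem R f" and w: "w \<in> \<Omega>" "\<theta> \<in> strip 1" and t: "0 < t" "t < 1"
  shows "norm (of_real (t powr (\<alpha> - 1)) * f (of_real t * w) \<theta>) \<le> R * \<mu> (norm w)"
proof -
  have "t powr (\<alpha> - 1) \<le> 1" using t alpha by (simp add: powr_le1)
  moreover have "norm (f (of_real t * w) \<theta>) \<le> R * \<mu> (norm w)"
    using elem_dilate_bound[OF f w, of t] t
      mult_left_mono[OF mu_scale_le[of "norm w" t] elem_nonneg[OF f]] by auto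
  ultimately have "t powr (\<alpha> - 1) * norm (f (of_real t * w) \<theta>) \<le> 1 * (R * \<mu> (norm w))"
    by (intro mult_mono) auto
  then show ?thesis by (simp add: norm_mult)
qed

lemma euler_op_integrand_cont:
  assumes f: "separately_hol f" and w: "w \<in> \<Omega>" "\<theta> \<in> strip 1"
  shows "continuous_on {0<..<1} (\<lambda>t. of_real (t powr (\<alpha> - 1)) * f (of_real t * w) \<theta>)"
  by (intro continuous_intros continuous_on_subset[OF continuous_on_ray[OF f w]]) auto

lemma euler_op_integrable:
  assumes f: "elem R f" and w: "w \<in> \<Omega>" "\<theta> \<in> strip 1"
  shows "integrable U01 (\<lambda>t. of_real (t powr (\<alpha> - 1)) * f (of_real t * w) \<theta>)"
  by (rule integrable_U01[OF euler_op_integrand_cont[OF elem_separately_hol[OF f] w] euler_op_integrand_bound[OF f w]])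

lemma bounded_op_euler_op: "bounded_op 1 (euler_op \<alpha>)"
proof (rule bounded_opI)
  fix R f assume f: "elem R f"
  show "elem (1 * R) (euler_op \<alpha> f)"
  proof (rule elemI)
    show "separately_hol (euler_op \<alpha> f)" unfolding euler_op_def[abs_def]
    proof (rule separately_hol_integral[where D="\<lambda>s. R * \<mu> s"])
      show "separately_hol (\<lambda>w \<theta>. of_real (t powr (\<alpha> - 1)) * f (of_real t * w) \<theta>)" if "0 < t" "t < 1" for t :: real
        using that by (intro separately_hol_mult[OF separately_hol_const] separately_hol_dilate[OF elem_separately_hol[OF f]]) auto
    qed (use euler_op_integrand_bound[OF f] euler_op_integrand_cont[OF elem_separately_hol[OF f]] elem_nonneg[OF f]
         in \<open>auto intro!: mult_left_mono mu_mono\<close>)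
    show "norm (euler_op \<alpha> f w \<theta>) \<le> 1 * R * \<mu> (norm w)" if "w \<in> \<Omega>" "\<theta> \<in> strip 1" for w \<theta>
      unfolding euler_op_def using euler_op_integrand_bound[OF f that]
      by (intro norm_integral_U01_le_const) auto
  qed
next
  fix R S f g w \<theta> assume *: "elem R f" "elem S g" "w \<in> \<Omega>" "\<theta> \<in> strip 1"
  show "euler_op \<alpha> (\<lambda>w \<theta>. f w \<theta> - g w \<theta>) w \<theta> = euler_op \<alpha> f w \<theta> - euler_op \<alpha> g w \<theta>"
    unfolding euler_op_def right_diff_distrib
    by (rule Bochner_Integration.integral_diff[OF euler_op_integrable[OF *(1,3,4)] euler_op_integrable[OF *(2,3,4)]])
qed

text \<open>Integrate the derivative of t^\<alpha> f(t w) with respect to t over [0, 1]: the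
  boundary term at 0 vanishes, the one at 1 is f(w), and the product rule yields the two terms of
  the equation.\<close>

lemma euler_op_ode:
  assumes f: "elem R f" and w: "w \<in> \<Omega>" "\<theta> \<in> strip 1"
  shows "\<exists>D. ((\<lambda>w. euler_op \<alpha> f w \<theta>) has_field_derivative D) (at w) \<and> w * D = f w \<theta> - of_real \<alpha> * euler_op \<alpha> f w \<theta>"
proof -
  let ?h = "\<lambda>t w. of_real (t powr (\<alpha> - 1)) * f (of_real t * w) \<theta>"
  let ?f' = "deriv (\<lambda>w. f w \<theta>)"
  have hh: "?h t holomorphic_on \<Omega>" if "0 < t" "t < 1" for t :: real
    using separately_holD(1)[OF separately_hol_dilate[OF elem_separately_hol[OF f], of t] w(2)] that by (intro holomorphic_intros) auto
  have bd: "\<exists>d>0. \<exists>M. \<forall>t z. 0 < t \<and> t < 1 \<and> z \<in> \<Omega> \<inter> ball z0 d \<longrightarrow> norm (?h (t::real) z) \<le> M"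
    if "z0 \<in> \<Omega>" for z0
  proof (rule exI[of _ 1], rule conjI[OF zero_less_one], rule exI[of _ "R * \<mu> (norm z0 + 1)"], intro allI impI)
    fix t :: real and z assume tz: "0 < t \<and> t < 1 \<and> z \<in> \<Omega> \<inter> ball z0 1"
    then have "norm z \<le> norm z0 + 1"
      using norm_triangle_ineq2[of z z0] by (simp add: dist_norm norm_minus_commute)
    then have "R * \<mu> (norm z) \<le> R * \<mu> (norm z0 + 1)"
      by (intro mult_left_mono mu_mono elem_nonneg[OF f]) auto
    then show "norm (?h t z) \<le> R * \<mu> (norm z0 + 1)"
      using euler_op_integrand_bound[OF f _ w(2), of z t] tz by force
  qed
  note L = holomorphic_on_integral_U01[OF open_\<Omega> hh euler_op_integrand_cont[OF elem_separately_hol[OF f] _ w(2)] bd]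
  have f': "((\<lambda>w. f w \<theta>) has_field_derivative ?f' z) (at z)" if "z \<in> \<Omega>" for z
    using holomorphic_derivI[OF separately_holD(1)[OF elem_separately_hol[OF f] w(2)] open_\<Omega> that] .
  have dh: "deriv (?h t) w = of_real (t powr \<alpha>) * ?f' (of_real t * w)" if "0 < t" "t < 1" for t :: real
  proof (rule DERIV_imp_deriv)
    have "((\<lambda>w. f (of_real t * w) \<theta>) has_field_derivative ?f' (of_real t * w) * of_real t) (at w)"
      by (rule DERIV_chain2[where f="\<lambda>w. f w \<theta>" and g="\<lambda>w. of_real t * w" and x=w, OF f'[OF star_\<Omega>[OF w(1)]]])
        (use that in \<open>auto intro!: derivative_eq_intros\<close>)
    then have "(?h t has_field_derivative of_real (t powr (\<alpha> - 1)) * (?f' (of_real t * w) * of_real t)) (at w)"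
      by (rule DERIV_cmult)
    moreover have "t powr (\<alpha> - 1) * t = t powr \<alpha>" using that by (simp add: powr_diff)
    then have "of_real (t powr (\<alpha> - 1)) * (?f' (of_real t * w) * of_real t) = of_real (t powr \<alpha>) * ?f' (of_real t * w)"
      by (metis mult.assoc mult.commute of_real_mult)
    ultimately show "(?h t has_field_derivative of_real (t powr \<alpha>) * ?f' (of_real t * w)) (at w)" by simp
  qed
  have int': "integrable U01 (\<lambda>t. of_real (t powr \<alpha>) * ?f' (of_real t * w))"
    using L(2)[of w] w(1) dh by (subst Bochner_Integration.integrable_cong[OF refl, of _ _ "\<lambda>t. deriv (?h t) w"]) auto
  have der: "((\<lambda>w. euler_op \<alpha> f w \<theta>) has_field_derivative (\<integral>t. of_real (t powr \<alpha>) * ?f' (of_real t * w) \<partial>U01)) (at w)"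
    using L(3)[of w] w(1) dh
    by (subst Bochner_Integration.integral_cong[OF refl, of _ _ "\<lambda>t. deriv (?h t) w"]) (auto simp: euler_op_def)
  let ?G = "\<lambda>t. of_real (t powr \<alpha>) * f (of_real t * w) \<theta>"
  let ?G' = "\<lambda>t. of_real \<alpha> * ?h t w + w * (of_real (t powr \<alpha>) * ?f' (of_real t * w))"
  have "(\<integral>t. ?G' t \<partial>U01) = ?G 1 - ?G 0"
  proof (rule integral_U01_FTC)
    show "continuous_on {0..1} ?G"
      using alpha by (intro continuous_on_mult continuous_on_of_real continuous_on_powr' continuous_on_id
          continuous_on_const continuous_on_ray[OF elem_separately_hol[OF f] w]) auto
    show "(?G has_vector_derivative ?G' t) (at t)" if t: "0 < t" "t < 1" for t :: real
    proof -
      have "((\<lambda>t. of_real t * w) has_vector_derivative w) (at t)"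
        by (auto intro!: derivative_eq_intros simp: has_vector_derivative_def scaleR_conv_of_real)
      from field_vector_diff_chain_at[OF this f'[OF star_\<Omega>[OF w(1)]]] t
      have a: "((\<lambda>t. f (of_real t * w) \<theta>) has_vector_derivative w * ?f' (of_real t * w)) (at t)"
        by (simp add: o_def)
      have "((\<lambda>t. t powr \<alpha>) has_real_derivative \<alpha> * t powr (\<alpha> - 1)) (at t)"
        using t by (auto intro!: derivative_eq_intros)
      then have b: "((\<lambda>t. complex_of_real (t powr \<alpha>)) has_vector_derivative of_real (\<alpha> * t powr (\<alpha> - 1))) (at t)"
        by (intro has_vector_derivative_of_real) (simp add: has_real_derivative_iff_has_vector_derivative)
      show ?thesis using has_vector_derivative_mult[OF b a] by (simp add: algebra_simps)
    qed
    show "integrable U01 ?G'"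
      using euler_op_integrable[OF f w] int' by (intro Bochner_Integration.integrable_add integrable_mult_right)
  qed
  moreover have "(\<integral>t. ?G' t \<partial>U01) = of_real \<alpha> * euler_op \<alpha> f w \<theta> + w * (\<integral>t. of_real (t powr \<alpha>) * ?f' (of_real t * w) \<partial>U01)"
    using euler_op_integrable[OF f w] int'
    by (subst Bochner_Integration.integral_add) (auto simp: euler_op_def)
  ultimately show ?thesis using der alpha
    by (intro exI[of _ "\<integral>t. of_real (t powr \<alpha>) * ?f' (of_real t * w) \<partial>U01"]) (auto simp: algebra_simps)
qed

end

end

section \<open>Periodic solutions of a linear equation on the strip\<close>

text \<open>The entire function (exp z - 1) / z. A quotient of its values expresses the kernel of
  the inverse operator without the removable singularity at \<beta> = 0.\<close>

definition E1 :: "complex \<Rightarrow> complex" where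
  "E1 z = (if z = 0 then 1 else (exp z - 1) / z)"

lemma holomorphic_E1: "E1 holomorphic_on A"
proof -
  have "(\<lambda>z. if z = 0 then deriv exp 0 else (exp z - exp 0) / (z - 0)) holomorphic_on UNIV"
    by (rule pole_lemma) (auto intro: holomorphic_intros)
  moreover have "deriv exp (0::complex) = 1"
    by (rule DERIV_imp_deriv) (auto intro!: derivative_eq_intros)
  ultimately have "E1 holomorphic_on UNIV" by (simp add: E1_def[abs_def] cong: if_cong)
  then show ?thesis by (rule holomorphic_on_subset) auto
qed

lemma E1_near_1:
  assumes "norm z \<le> 1/4" shows "norm (E1 z - 1) \<le> 1/2"
proof (cases "z = 0")
  case False
  have "norm (exp z - (\<Sum>k\<le>1. z ^ k / fact k)) \<le> exp \<bar>Re z\<bar> * norm z ^ Suc 1 / fact 1"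
    by (rule Taylor_exp)
  moreover have "exp \<bar>Re z\<bar> \<le> 3/2"
  proof -
    have "\<bar>Re z\<bar> \<le> 1/4" using abs_Re_le_cmod[of z] assms by linarith
    moreover have "norm (exp \<bar>Re z\<bar>) \<le> 1 + 2 * norm \<bar>Re z\<bar>"
      by (rule exp_bound_lemma) (use calculation in auto)
    ultimately show ?thesis by simp
  qed
  then have "exp \<bar>Re z\<bar> * norm z ^ Suc 1 \<le> 3/2 * norm z ^ Suc 1" by (rule mult_right_mono) simp
  ultimately have "norm (exp z - 1 - z) \<le> 3/2 * (norm z * norm z)"
    by (simp add: algebra_simps)
  also have "\<dots> \<le> 3/2 * (1/4 * norm z)" using assms by (intro mult_left_mono mult_right_mono) auto
  finally have *: "norm (exp z - 1 - z) \<le> 1/2 * norm z" using norm_ge_zero[of z] by linarith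
  have "E1 z - 1 = (exp z - 1 - z) / z" using False by (simp add: E1_def field_simps)
  then have "norm (E1 z - 1) = norm (exp z - 1 - z) / norm z" by (simp add: norm_divide)
  also have "\<dots> \<le> 1/2" using * False by (simp add: divide_le_eq)
  finally show ?thesis .
qed (simp add: E1_def)

lemma strip_primitive:
  assumes "h holomorphic_on strip \<xi>"
  obtains P where "\<And>\<theta>. \<theta> \<in> strip \<xi> \<Longrightarrow> (P has_field_derivative h \<theta>) (at \<theta>)"
proof -
  obtain P where P: "\<And>x. x \<in> strip \<xi> \<Longrightarrow> (P has_field_derivative h x) (at x within strip \<xi>)"
    using holomorphic_convex_primitive'[OF convex_strip open_strip assms] by blast
  show ?thesis
    by (rule that[of P]) (metis P at_within_open open_strip)
qed

lemma strip_FTC: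
  assumes h: "h holomorphic_on strip \<xi>" and \<theta>: "\<theta> \<in> strip \<xi>"
    and P: "\<And>\<theta>. \<theta> \<in> strip \<xi> \<Longrightarrow> (P has_field_derivative h \<theta>) (at \<theta>)"
  shows "2 * of_real pi * (\<integral>t. h (\<theta> - of_real (2 * pi * t)) \<partial>U01) = P \<theta> - P (\<theta> - 2 * of_real pi)"
proof -
  have eq: "\<theta> + of_real t * - (2 * of_real pi) = \<theta> - of_real (2 * pi * t)" for t by simp
  have "(\<integral>t. h (\<theta> + of_real t * - (2 * of_real pi)) * - (2 * of_real pi) \<partial>U01) = P (\<theta> + - (2 * of_real pi)) - P \<theta>"
  proof (rule integral_U01_complex_FTC, goal_cases)
    case (1 t)
    show ?case unfolding eq by (intro P strip_shift \<theta>)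
  next
    case 2
    show ?case unfolding eq
      by (rule continuous_on_compose2[OF holomorphic_on_imp_continuous_on[OF h]])
        (auto intro!: continuous_intros strip_shift \<theta> simp del: of_real_mult)
  qed
  then have "(\<integral>t. h (\<theta> - of_real (2 * pi * t)) \<partial>U01) * - (2 * of_real pi) = P (\<theta> - 2 * of_real pi) - P \<theta>"
    unfolding eq integral_mult_left_zero by simp
  then show ?thesis
    by (metis minus_diff_eq mult.commute mult_minus_left minus_minus)
qed

text \<open>The increment of a primitive over one period has derivative 0 by periodicity, hence is
  constant on the convex strip. So the mean is the same on every horizontal line.\<close>

lemma periodic_mean:
  assumes h: "h holomorphic_on strip \<xi>" and per: "periodic_on_strip \<xi> h" and \<theta>: "\<theta> \<in> strip \<xi>"
  shows "(\<integral>t. h (\<theta> - of_real (2 * pi * t)) \<partial>U01) = (\<integral>t. h (- of_real (2 * pi * t)) \<partial>U01)"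
proof -
  obtain P where P: "\<And>\<theta>. \<theta> \<in> strip \<xi> \<Longrightarrow> (P has_field_derivative h \<theta>) (at \<theta>)"
    using strip_primitive[OF h] by blast
  have z: "0 \<in> strip \<xi>" using \<theta> by (auto simp: strip_def)
  have m: "\<theta> - 2 * of_real pi \<in> strip \<xi>" if "\<theta> \<in> strip \<xi>" for \<theta>
    using strip_shift(2)[OF that, of "2 * pi"] by simp
  have "((\<lambda>\<theta>. P \<theta> - P (\<theta> - 2 * of_real pi)) has_field_derivative 0) (at \<theta> within strip \<xi>)" if "\<theta> \<in> strip \<xi>" for \<theta>
  proof -
    have "((\<lambda>\<theta>. P \<theta> - P (\<theta> - 2 * of_real pi)) has_field_derivative h \<theta> - h (\<theta> - 2 * of_real pi) * 1) (at \<theta>)"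
      by (intro DERIV_diff P that DERIV_chain2[where g="\<lambda>\<theta>. \<theta> - 2 * of_real pi"] m)
        (auto intro!: derivative_eq_intros)
    moreover have "h \<theta> = h (\<theta> - 2 * of_real pi)"
      using per m[OF that] unfolding periodic_on_strip_def by force
    ultimately show ?thesis by (simp add: has_field_derivative_at_within)
  qed
  from has_field_derivative_zero_constant[OF convex_strip this]
  obtain c where "\<And>\<theta>. \<theta> \<in> strip \<xi> \<Longrightarrow> P \<theta> - P (\<theta> - 2 * of_real pi) = c" by blast
  then have "2 * of_real pi * (\<integral>t. h (\<theta> - of_real (2 * pi * t)) \<partial>U01) = 2 * of_real pi * (\<integral>t. h (0 - of_real (2 * pi * t)) \<partial>U01)"
    by (simp only: strip_FTC[OF h \<theta> P] strip_FTC[OF h z P] \<theta> z)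
  then show ?thesis by simp
qed

text \<open>Variation of constants over one period: with P a primitive of exp(\<beta> \<theta>) h,
  the solution is exp(- \<beta> \<theta>) (P(\<theta>) - P(\<theta> - 2 \<pi>)) divided by 1 - exp(-
  2 \<pi> \<beta>), and periodicity of h closes the equation.\<close>

lemma periodic_ode:
  assumes h: "h holomorphic_on strip \<xi>" and per: "periodic_on_strip \<xi> h" and \<theta>: "\<theta> \<in> strip \<xi>"
    and \<beta>: "exp (- (2 * of_real pi * \<beta>)) \<noteq> 1"
  defines "v \<equiv> \<lambda>\<theta>. 2 * of_real pi / (1 - exp (- (2 * of_real pi * \<beta>))) *
    (\<integral>t. exp (- (of_real (2 * pi * t) * \<beta>)) * h (\<theta> - of_real (2 * pi * t)) \<partial>U01)"
  shows "(v has_field_derivative h \<theta> - \<beta> * v \<theta>) (at \<theta>)"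
proof -
  let ?g = "\<lambda>\<theta>. exp (\<beta> * \<theta>) * h \<theta>"
  let ?A = "1 - exp (- (2 * of_real pi * \<beta>))"
  have g: "?g holomorphic_on strip \<xi>" by (intro holomorphic_intros h)
  obtain P where P: "\<And>\<theta>. \<theta> \<in> strip \<xi> \<Longrightarrow> (P has_field_derivative ?g \<theta>) (at \<theta>)"
    using strip_primitive[OF g] by blast
  have m: "\<theta> - 2 * of_real pi \<in> strip \<xi>"
    using strip_shift(2)[OF \<theta>, of "2 * pi"] by simp
  have v: "v z = exp (- (\<beta> * z)) * (P z - P (z - 2 * of_real pi)) / ?A" if z: "z \<in> strip \<xi>" for z
  proof -
    have "exp (- (of_real (2 * pi * t) * \<beta>)) * h (z - of_real (2 * pi * t))
        = exp (- (\<beta> * z)) * ?g (z - of_real (2 * pi * t))" for t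
      by (simp only: mult.assoc[symmetric] exp_add[symmetric]) (simp add: algebra_simps)
    then have "(\<integral>t. exp (- (of_real (2 * pi * t) * \<beta>)) * h (z - of_real (2 * pi * t)) \<partial>U01)
        = exp (- (\<beta> * z)) * (\<integral>t. ?g (z - of_real (2 * pi * t)) \<partial>U01)"
      by (simp only: integral_mult_right_zero)
    then have "v z = exp (- (\<beta> * z)) * (2 * of_real pi * (\<integral>t. ?g (z - of_real (2 * pi * t)) \<partial>U01)) / ?A"
      by (simp add: v_def del: of_real_mult)
    then show ?thesis by (simp only: strip_FTC[OF g z P])
  qed
  let ?V = "\<lambda>z. exp (- (\<beta> * z)) * (P z - P (z - 2 * of_real pi)) / ?A"
  have e: "((\<lambda>z. exp (- (\<beta> * z))) has_field_derivative exp (- (\<beta> * \<theta>)) * - \<beta>) (at \<theta>)"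
    by (auto intro!: derivative_eq_intros)
  have "((\<lambda>z. P z - P (z - 2 * of_real pi)) has_field_derivative (?g \<theta> - ?g (\<theta> - 2 * of_real pi) * 1)) (at \<theta>)"
    by (intro DERIV_diff P \<theta> DERIV_chain2[where g="\<lambda>\<theta>. \<theta> - 2 * of_real pi"] m)
        (auto intro!: derivative_eq_intros)
  from DERIV_cdivide[OF DERIV_mult[OF e this], of ?A]
  have V: "(?V has_field_derivative (exp (- (\<beta> * \<theta>)) * - \<beta> * (P \<theta> - P (\<theta> - 2 * of_real pi))
      + (?g \<theta> - ?g (\<theta> - 2 * of_real pi) * 1) * exp (- (\<beta> * \<theta>))) / ?A) (at \<theta>)" .
  have hh: "h (\<theta> - 2 * of_real pi) = h \<theta>"
    using per m unfolding periodic_on_strip_def by force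
  have "?g \<theta> * exp (- (\<beta> * \<theta>)) = h \<theta>"
    by (simp add: exp_minus)
  moreover have "?g (\<theta> - 2 * of_real pi) * exp (- (\<beta> * \<theta>)) = h \<theta> * exp (- (2 * of_real pi * \<beta>))"
  proof -
    have "exp (\<beta> * (\<theta> - 2 * of_real pi)) * exp (- (\<beta> * \<theta>)) = exp (- (2 * of_real pi * \<beta>))"
      by (simp only: exp_add[symmetric]) (simp add: algebra_simps)
    then show ?thesis unfolding hh by (metis mult.assoc mult.commute)
  qed
  ultimately have eq: "(exp (- (\<beta> * \<theta>)) * - \<beta> * (P \<theta> - P (\<theta> - 2 * of_real pi))
      + (?g \<theta> - ?g (\<theta> - 2 * of_real pi) * 1) * exp (- (\<beta> * \<theta>))) / ?A = h \<theta> - \<beta> * v \<theta>"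
    unfolding left_diff_distrib mult_1_right v[OF \<theta>] using \<beta> by (simp add: divide_simps) (simp add: algebra_simps)
  show ?thesis
    by (rule has_field_derivative_transform_within_open[OF V[unfolded eq] open_strip \<theta>]) (simp add: v)
qed

lemma norm_one_minus_exp: "norm (1 - exp (- (2 * of_real pi * \<beta>))) \<ge> \<bar>1 - exp (- (2 * pi * Re \<beta>))\<bar>"
  for \<beta> :: complex
  using norm_triangle_ineq3[of 1 "exp (- (2 * of_real pi * \<beta>))"] by simp

lemma integral_exp_U01:
  assumes "x \<noteq> 0"
  shows "(\<integral>t. exp (- (2 * pi * t * x)) \<partial>U01) = (1 - exp (- (2 * pi * x))) / (2 * pi * x)"
    and "integrable U01 (\<lambda>t. exp (- (2 * pi * t * x)))"
proof -
  show i: "integrable U01 (\<lambda>t. exp (- (2 * pi * t * x)))"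
  proof (rule integrable_U01[where B="exp (2 * pi * \<bar>x\<bar>)"])
    fix t :: real assume t: "0 < t" "t < 1"
    have "- (2 * pi * t * x) \<le> 2 * pi * (t * \<bar>x\<bar>)"
      using t mult_left_mono[of "-x" "\<bar>x\<bar>" "2 * pi * t"] by simp
    also have "\<dots> \<le> 2 * pi * (1 * \<bar>x\<bar>)" using t by (intro mult_left_mono mult_right_mono) auto
    finally show "norm (exp (- (2 * pi * t * x))) \<le> exp (2 * pi * \<bar>x\<bar>)" by simp
  qed (intro continuous_intros)
  have "(\<integral>t. exp (- (2 * pi * t * x)) \<partial>U01) = - exp (- (2 * pi * 1 * x)) / (2 * pi * x) - - exp (- (2 * pi * 0 * x)) / (2 * pi * x)"
    using assms i
    by (intro integral_U01_FTC[where F="\<lambda>t. - exp (- (2 * pi * t * x)) / (2 * pi * x)"])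
      (auto intro!: continuous_intros derivative_eq_intros
        simp: has_real_derivative_iff_has_vector_derivative[symmetric])
  then show "(\<integral>t. exp (- (2 * pi * t * x)) \<partial>U01) = (1 - exp (- (2 * pi * x))) / (2 * pi * x)"
    by (simp add: diff_divide_distrib)
qed

text \<open>The L1 norm of the kernel: the integral of exp(- 2 \<pi> t Re \<beta>) cancels against
  the lower bound for the denominator from \<open>norm_one_minus_exp\<close>, and 1 / \<bar>Re
  \<beta>\<bar> is left.\<close>

lemma periodic_ode_bound:
  assumes H: "\<And>\<theta>. \<theta> \<in> strip \<xi> \<Longrightarrow> norm (h \<theta>) \<le> H" and \<theta>: "\<theta> \<in> strip \<xi>" and \<beta>: "Re \<beta> \<noteq> 0"
  shows "norm (2 * of_real pi / (1 - exp (- (2 * of_real pi * \<beta>))) *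
    (\<integral>t. exp (- (of_real (2 * pi * t) * \<beta>)) * h (\<theta> - of_real (2 * pi * t)) \<partial>U01)) \<le> H / \<bar>Re \<beta>\<bar>"
proof -
  let ?x = "Re \<beta>" and ?I = "\<integral>t. exp (- (of_real (2 * pi * t) * \<beta>)) * h (\<theta> - of_real (2 * pi * t)) \<partial>U01"
  have "norm ?I \<le> (\<integral>t. exp (- (2 * pi * t * ?x)) * H \<partial>U01)"
  proof (rule norm_integral_U01_le)
    show "norm (exp (- (of_real (2 * pi * t) * \<beta>)) * h (\<theta> - of_real (2 * pi * t))) \<le> exp (- (2 * pi * t * ?x)) * H" for t
      using H[OF strip_shift(2)[OF \<theta>, of "2 * pi * t"]] unfolding norm_mult
      by (intro mult_mono) auto
  qed (use integral_exp_U01(2)[OF \<beta>] in simp)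
  also have "\<dots> = (1 - exp (- (2 * pi * ?x))) / (2 * pi * ?x) * H"
    using integral_exp_U01(1)[OF \<beta>] by simp
  also have "(1 - exp (- (2 * pi * ?x))) / (2 * pi * ?x) = \<bar>1 - exp (- (2 * pi * ?x))\<bar> / (2 * pi * \<bar>?x\<bar>)"
    using \<beta> by (cases "?x > 0") (auto simp: abs_if divide_simps mult_less_0_iff zero_less_mult_iff)
  finally have I: "norm ?I \<le> \<bar>1 - exp (- (2 * pi * ?x))\<bar> / (2 * pi * \<bar>?x\<bar>) * H" .
  have pos: "\<bar>1 - exp (- (2 * pi * ?x))\<bar> > 0" using \<beta> by auto
  then have D: "norm (1 - exp (- (2 * of_real pi * \<beta>))) > 0"
    using norm_one_minus_exp[of \<beta>] by linarith
  have "norm (2 * of_real pi / (1 - exp (- (2 * of_real pi * \<beta>))) * ?I)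
      = 2 * pi / norm (1 - exp (- (2 * of_real pi * \<beta>))) * norm ?I"
    by (simp add: norm_mult norm_divide)
  also have "\<dots> \<le> 2 * pi / \<bar>1 - exp (- (2 * pi * ?x))\<bar> * (\<bar>1 - exp (- (2 * pi * ?x))\<bar> / (2 * pi * \<bar>?x\<bar>) * H)"
    using I pos D norm_one_minus_exp[of \<beta>] by (intro mult_mono divide_left_mono) auto
  also have "\<dots> = H / \<bar>?x\<bar>" using pos by simp
  finally show ?thesis .
qed

text \<open>
  The kernel of \<open>(\<partial>\<^sub>\<theta> + \<beta>)\<^sup>-\<^sup>1\<close> on periodic functions is \<open>2 \<pi> exp (- 2 \<pi> t \<beta>) / (1 - exp (- 2 \<pi> \<beta>))\<close>.
  On data of mean zero a constant may be subtracted, which removes the pole at \<open>\<beta> = 0\<close>.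
\<close>

definition kern :: "complex \<Rightarrow> real \<Rightarrow> complex" where
  "kern \<beta> t = - (of_real (2 * pi * t) * E1 (- (of_real (2 * pi * t) * \<beta>)) / E1 (- (2 * of_real pi * \<beta>)))"

lemma kern_eq:
  assumes "\<beta> \<noteq> 0" "exp (- (2 * of_real pi * \<beta>)) \<noteq> 1" "t \<noteq> 0"
  shows "kern \<beta> t = 2 * of_real pi / (1 - exp (- (2 * of_real pi * \<beta>))) * (exp (- (of_real (2 * pi * t) * \<beta>)) - 1)"
proof -
  have *: "- (p * ((u - 1) / - (p * \<beta>)) / ((v - 1) / - (q * \<beta>))) = q / (1 - v) * (u - 1)"
    if "p \<noteq> 0" "q \<noteq> 0" "v \<noteq> 1" for p q u v :: complex
  proof -
    have "p * ((u - 1) / - (p * \<beta>)) = - ((u - 1) / \<beta>)" using that assms(1) by (simp add: field_simps)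
    moreover have "(v - 1) / - (q * \<beta>) = (1 - v) / (q * \<beta>)" by (simp add: minus_divide_left)
    ultimately show ?thesis using that assms(1) by simp
  qed
  have n: "- (of_real (2 * pi * t) * \<beta>) \<noteq> 0" "- (2 * of_real pi * \<beta>) \<noteq> 0" using assms by auto
  show ?thesis unfolding kern_def E1_def if_not_P[OF n(1)] if_not_P[OF n(2)]
    by (rule *) (use assms in auto)
qed

lemma continuous_on_kern: "continuous_on A (kern \<beta>)"
proof -
  have "continuous_on A (\<lambda>t. E1 (- (of_real (2 * pi * t) * \<beta>)))"
    by (rule continuous_on_compose2[OF holomorphic_on_imp_continuous_on[OF holomorphic_E1[of UNIV]]])
      (auto intro!: continuous_intros)
  then show ?thesis unfolding kern_def[abs_def] divide_inverse by (intro continuous_intros)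
qed

lemma kern_small_bound:
  assumes "norm (2 * of_real pi * \<beta>) \<le> 1/4" "0 \<le> t" "t \<le> 1"
  shows "norm (kern \<beta> t) \<le> 24"
proof -
  have "norm (of_real (2 * pi * t) * \<beta>) \<le> 1/4"
  proof -
    have "t * (2 * pi * norm \<beta>) \<le> 1 * (2 * pi * norm \<beta>)" using assms by (intro mult_right_mono) auto
    moreover have "2 * pi * norm \<beta> \<le> 1/4" using assms(1) by (simp add: norm_mult)
    moreover have "norm (of_real (2 * pi * t) * \<beta>) = t * (2 * pi * norm \<beta>)"
      using assms(2) by (simp add: norm_mult)
    ultimately show ?thesis by linarith
  qed
  then have "norm (E1 (- (of_real (2 * pi * t) * \<beta>)) - 1) \<le> 1/2" by (intro E1_near_1) simp
  then have 1: "norm (E1 (- (of_real (2 * pi * t) * \<beta>))) \<le> 3/2"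
    using norm_triangle_ineq2[of "E1 (- (of_real (2 * pi * t) * \<beta>))" 1] by simp
  have "norm (E1 (- (2 * of_real pi * \<beta>)) - 1) \<le> 1/2" using assms by (intro E1_near_1) simp
  then have 2: "1/2 \<le> norm (E1 (- (2 * of_real pi * \<beta>)))"
    using norm_triangle_ineq2[of 1 "E1 (- (2 * of_real pi * \<beta>))"] by (simp add: norm_minus_commute)
  have "norm (kern \<beta> t) = 2 * pi * t * norm (E1 (- (of_real (2 * pi * t) * \<beta>))) / norm (E1 (- (2 * of_real pi * \<beta>)))"
    using assms(2) by (simp add: kern_def norm_mult norm_divide)
  \<comment> \<open>Here \<pi> < 4 and t \<le> 1, the numerator \<open>E1\<close> is at most 3/2 and
    the denominator \<open>E1\<close> at least 1/2; the value is 24.\<close>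
  also have "\<dots> \<le> (2 * 4 * 1 * (3/2)) / (1/2)"
    using assms(2,3) pi_less_4 1 2 by (intro frac_le mult_mono) auto
  finally show ?thesis by simp
qed

text \<open>
  Either \<open>b w\<close> is small, where the regularized kernel is bounded, or it lies in a sector around the
  real axis, where \<open>\<bar>1 - exp (- 2 \<pi> b w)\<bar>\<close> is bounded below.
\<close>

locale borel_kernel = borel_domain +
  fixes b \<rho>0 C0 :: real
  assumes b_nz: "b \<noteq> 0" and rho0: "0 < \<rho>0"
    and dich: "\<And>w. w \<in> \<Omega> \<Longrightarrow> norm (2 * of_real pi * (of_real b * w)) \<le> 1/4 \<or>
      (\<rho>0 \<le> \<bar>Re (of_real b * w)\<bar> \<and> norm (of_real b * w) \<le> C0 * \<bar>Re (of_real b * w)\<bar>)"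
begin

lemma exp_ne_1:
  assumes "w \<in> \<Omega>" "w \<noteq> 0" shows "exp (- (2 * of_real pi * (of_real b * w))) \<noteq> 1"
proof
  let ?z = "- (2 * of_real pi * (of_real b * w))"
  assume e: "exp ?z = 1"
  have z: "?z \<noteq> 0" using assms b_nz by simp
  from dich[OF assms(1)] show False
  proof
    assume "norm (2 * of_real pi * (of_real b * w)) \<le> 1/4"
    then have "norm (E1 ?z - 1) \<le> 1/2" by (intro E1_near_1) simp
    then show False using z e by (simp add: E1_def)
  next
    assume *: "\<rho>0 \<le> \<bar>Re (of_real b * w)\<bar> \<and> norm (of_real b * w) \<le> C0 * \<bar>Re (of_real b * w)\<bar>"
    have "Re ?z = 0" using e by (metis exp_eq_1)
    then show False using * rho0 by auto
  qed
qed

lemma E1_nz: "w \<in> \<Omega> \<Longrightarrow> E1 (- (2 * of_real pi * (of_real b * w))) \<noteq> 0"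
  using exp_ne_1[of w] b_nz by (cases "w = 0") (auto simp: E1_def)

text \<open>The 24 is \<open>kern_small_bound\<close>, and 8 replaces 2 \<pi>. The exponential
  growth does no harm: this majorant serves integrability and holomorphy of \<open>K\<close>, while
  its norm comes from \<open>K_bounds\<close>.\<close>

definition kb :: "real \<Rightarrow> real" where
  "kb s = 24 + 8 * (exp (8 * (\<bar>b\<bar> * s)) + 1) / (1 - exp (- (2 * pi * \<rho>0)))"

lemma kb_mono: "0 \<le> s \<Longrightarrow> s \<le> t \<Longrightarrow> kb s \<le> kb t"
  unfolding kb_def using rho0 by (intro add_mono divide_right_mono mult_left_mono) (auto intro: mult_left_mono)

lemma kern_bound:
  assumes w: "w \<in> \<Omega>" and t: "0 < t" "t < 1"
  shows "norm (kern (of_real b * w) t) \<le> kb (norm w)"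
proof -
  let ?\<beta> = "of_real b * w"
  have pos: "1 - exp (- (2 * pi * \<rho>0)) > 0" using rho0 by simp
  have kb24: "kb s \<ge> 24" for s unfolding kb_def using pos by (simp add: add_pos_pos less_imp_le)
  from dich[OF w] show ?thesis
  proof
    assume "norm (2 * of_real pi * ?\<beta>) \<le> 1/4"
    from kern_small_bound[OF this, of t] t kb24 show ?thesis by (meson less_imp_le order_trans)
  next
    assume *: "\<rho>0 \<le> \<bar>Re ?\<beta>\<bar> \<and> norm ?\<beta> \<le> C0 * \<bar>Re ?\<beta>\<bar>"
    then have w0: "w \<noteq> 0" using rho0 by auto
    have d: "1 - exp (- (2 * pi * \<rho>0)) \<le> \<bar>1 - exp (- (2 * pi * Re ?\<beta>))\<bar>"
    proof (cases "Re ?\<beta> \<ge> 0")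
      case True
      then have "exp (- (2 * pi * Re ?\<beta>)) \<le> exp (- (2 * pi * \<rho>0))" using * by simp
      then show ?thesis by linarith
    next
      case False
      \<comment> \<open>exp s \<ge> 1 + s is used twice: 1 - exp(- 2 \<pi> \<rho>0) \<le> 2 \<pi>
        \<rho>0 \<le> exp(- 2 \<pi> Re \<beta>) - 1.\<close>
      then have "\<rho>0 \<le> - Re ?\<beta>" using * by linarith
      then have "2 * pi * \<rho>0 \<le> 2 * pi * (- Re ?\<beta>)" by (intro mult_left_mono) auto
      then have "1 + 2 * pi * \<rho>0 \<le> exp (- (2 * pi * Re ?\<beta>))"
        using exp_ge_add_one_self[of "- (2 * pi * Re ?\<beta>)"] by simp
      moreover have "1 - 2 * pi * \<rho>0 \<le> exp (- (2 * pi * \<rho>0))"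
        using exp_ge_add_one_self[of "- (2 * pi * \<rho>0)"] by simp
      ultimately show ?thesis by linarith
    qed
    have n: "norm (exp (- (of_real (2 * pi * t) * ?\<beta>)) - 1) \<le> exp (8 * (\<bar>b\<bar> * norm w)) + 1"
    proof -
      have "norm (exp (- (of_real (2 * pi * t) * ?\<beta>))) \<le> exp (norm (- (of_real (2 * pi * t) * ?\<beta>)))"
        by (rule norm_exp)
      also have "norm (- (of_real (2 * pi * t) * ?\<beta>)) = 2 * pi * t * (\<bar>b\<bar> * norm w)"
        using t by (simp add: norm_mult)
      also have "exp (2 * pi * t * (\<bar>b\<bar> * norm w)) \<le> exp (8 * (\<bar>b\<bar> * norm w))"
        using t pi_less_4 mult_mono[of "2 * pi" 8 t 1] by (intro iffD2[OF exp_le_cancel_iff] mult_right_mono) auto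
      finally show ?thesis
        using norm_triangle_ineq4[of "exp (- (of_real (2 * pi * t) * ?\<beta>))" 1] by (simp only: norm_one)
    qed
    have "norm (kern ?\<beta> t) = 2 * pi * norm (exp (- (of_real (2 * pi * t) * ?\<beta>)) - 1) / norm (1 - exp (- (2 * of_real pi * ?\<beta>)))"
      using kern_eq[OF _ exp_ne_1[OF w w0], of t] w0 b_nz t by (simp add: norm_mult norm_divide)
    also have "\<dots> \<le> 8 * (exp (8 * (\<bar>b\<bar> * norm w)) + 1) / (1 - exp (- (2 * pi * \<rho>0)))"
      using n d norm_one_minus_exp[of ?\<beta>] pos pi_less_4 by (intro frac_le mult_mono) auto
    also have "\<dots> \<le> kb (norm w)" by (simp add: kb_def)
    finally show ?thesis .
  qed
qed

definition nz :: "borel_fun \<Rightarrow> borel_fun" where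
  "nz f w \<theta> = f w \<theta> - mean_op f w \<theta>"

lemma bounded_op_nz: "bounded_op 2 nz"
  using bounded_op_sub[OF bounded_op_id bounded_op_mean_op] by (simp add: nz_def[abs_def])

definition K :: "borel_fun \<Rightarrow> borel_fun" where
  "K f w \<theta> = (\<integral>t. kern (of_real b * w) t * nz f w (\<theta> - of_real (2 * pi * t)) \<partial>U01)"

context
  fixes R f assumes f: "elem R f"
begin

lemma nz_elem: "elem (2 * R) (nz f)" by (rule bounded_op_elem[OF bounded_op_nz f])

lemma nz_mean:
  assumes w: "w \<in> \<Omega>" and \<theta>: "\<theta> \<in> strip 1"
  shows "(\<integral>t. nz f w (\<theta> - of_real (2 * pi * t)) \<partial>U01) = 0"
proof -
  note s = elem_separately_hol[OF nz_elem]
  have "(\<integral>t. nz f w (\<theta> - of_real (2 * pi * t)) \<partial>U01) = (\<integral>t. nz f w (- of_real (2 * pi * t)) \<partial>U01)"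
    using s w by (intro periodic_mean[OF _ _ \<theta>]) (auto simp: separately_hol_def)
  also have "\<dots> = (\<integral>t. f w (- of_real (2 * pi * t)) - mean_op f w 0 \<partial>U01)"
    by (simp add: nz_def mean_op_def)
  also have "\<dots> = mean_op f w 0 - mean_op f w 0"
    using mean_op_integrable(1)[OF f w] by (subst Bochner_Integration.integral_diff) (auto simp: mean_op_def)
  finally show ?thesis by simp
qed

lemma K_integrand_bound:
  assumes w: "w \<in> \<Omega>" and \<theta>: "\<theta> \<in> strip 1" and t: "0 < t" "t < 1"
  shows "norm (kern (of_real b * w) t * nz f w (\<theta> - of_real (2 * pi * t))) \<le> kb (norm w) * (2 * R * \<mu> (norm w))"
  unfolding norm_mult using kern_bound[OF w t] elemD[OF nz_elem w strip_shift(2)[OF \<theta>]]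
  by (intro mult_mono) (auto intro: order_trans[OF norm_ge_zero] simp del: of_real_mult)

lemma K_integrand_cont:
  assumes w: "w \<in> \<Omega>" and \<theta>: "\<theta> \<in> strip 1"
  shows "continuous_on A (\<lambda>t. nz f w (\<theta> - of_real (2 * pi * t)))"
    "continuous_on A (\<lambda>t. kern (of_real b * w) t * nz f w (\<theta> - of_real (2 * pi * t)))"
proof -
  show "continuous_on A (\<lambda>t. nz f w (\<theta> - of_real (2 * pi * t)))"
    by (rule continuous_on_compose2[OF holomorphic_on_imp_continuous_on[OF separately_holD(2)[OF elem_separately_hol[OF nz_elem] w]]])
      (auto intro!: continuous_intros strip_shift \<theta> simp del: of_real_mult)
  then show "continuous_on A (\<lambda>t. kern (of_real b * w) t * nz f w (\<theta> - of_real (2 * pi * t)))"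
    by (intro continuous_intros continuous_on_kern)
qed

lemma K_integrable:
  assumes w: "w \<in> \<Omega>" and \<theta>: "\<theta> \<in> strip 1"
  shows "integrable U01 (\<lambda>t. kern (of_real b * w) t * nz f w (\<theta> - of_real (2 * pi * t)))"
  by (rule integrable_U01[OF K_integrand_cont(2)[OF assms] K_integrand_bound[OF assms]])

lemma separately_hol_K: "separately_hol (K f)"
  unfolding K_def[abs_def]
proof (rule separately_hol_integral[where D="\<lambda>s. kb s * (2 * R * \<mu> s)"])
  note s = separately_holD[OF elem_separately_hol[OF nz_elem]]
  fix t :: real
  show "separately_hol (\<lambda>w \<theta>. kern (of_real b * w) t * nz f w (\<theta> - of_real (2 * pi * t)))"
  proof (rule separately_hol_mult; rule separately_holI)
    show "(\<lambda>w. kern (of_real b * w) t) holomorphic_on \<Omega>"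
      unfolding kern_def using E1_nz
      by (intro holomorphic_intros holomorphic_on_compose_gen[OF _ holomorphic_E1[of UNIV], unfolded o_def]) auto
    show "(\<lambda>w. nz f w (\<theta> - of_real (2 * pi * t))) holomorphic_on \<Omega>" if "\<theta> \<in> strip 1" for \<theta>
      by (rule s(1)[OF strip_shift(2)[OF that]])
    show "(\<lambda>\<theta>. nz f w (\<theta> - of_real (2 * pi * t))) holomorphic_on strip 1" if w: "w \<in> \<Omega>" for w
      by (rule holomorphic_on_compose_gen[OF _ s(2)[OF w], unfolded o_def])
        (auto intro!: holomorphic_intros strip_shift simp del: of_real_mult)
    show "nz f w (\<theta> + 2 * of_real pi - of_real (2 * pi * t)) = nz f w (\<theta> - of_real (2 * pi * t))"
      if "w \<in> \<Omega>" "\<theta> \<in> strip 1" for w \<theta>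
      using s(3)[OF that(1) strip_shift(2)[OF that(2)], of "2 * pi * t"] by (simp add: algebra_simps)
  qed auto
next
  fix s t :: real assume st: "0 \<le> s" "s \<le> t"
  have "kb s \<ge> 0" using kb_def rho0 by (simp add: add_nonneg_nonneg)
  moreover have "kb s \<le> kb t" by (rule kb_mono[OF st])
  ultimately show "kb s * (2 * R * \<mu> s) \<le> kb t * (2 * R * \<mu> t)"
    using mu_mono[OF st] elem_nonneg[OF f] mu_pos[of s] st by (intro mult_mono mult_nonneg_nonneg) auto
qed (use K_integrand_bound K_integrand_cont in auto)

text \<open>The constant that is subtracted in the regularized kernel integrates against
  \<open>nz f\<close>, which has mean zero, and so contributes nothing.\<close>

lemma K_eq:
  assumes w: "w \<in> \<Omega>" "w \<noteq> 0" and \<theta>: "\<theta> \<in> strip 1"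
  defines "\<beta> \<equiv> of_real b * w"
  shows "K f w \<theta> = 2 * of_real pi / (1 - exp (- (2 * of_real pi * \<beta>))) *
    (\<integral>t. exp (- (of_real (2 * pi * t) * \<beta>)) * nz f w (\<theta> - of_real (2 * pi * t)) \<partial>U01)"
proof -
  let ?A = "2 * of_real pi / (1 - exp (- (2 * of_real pi * \<beta>)))"
  let ?n = "\<lambda>t::real. nz f w (\<theta> - of_real (2 * pi * t))"
  have c: "continuous_on {0..1} (\<lambda>t. exp (- (of_real (2 * pi * t) * \<beta>)) * ?n t)"
    by (intro continuous_intros K_integrand_cont(1)[OF w(1) \<theta>])
  then have "bounded ((\<lambda>t. exp (- (of_real (2 * pi * t) * \<beta>)) * ?n t) ` {0..1})"
    by (intro compact_imp_bounded compact_continuous_image) auto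
  then obtain B where B: "\<And>t. t \<in> {0..1} \<Longrightarrow> norm (exp (- (of_real (2 * pi * t) * \<beta>)) * ?n t) \<le> B"
    unfolding bounded_iff by blast
  have i1: "integrable U01 (\<lambda>t. exp (- (of_real (2 * pi * t) * \<beta>)) * ?n t)"
    by (rule integrable_U01[where B=B], rule continuous_on_subset[OF c]) (use B in auto)
  have i2: "integrable U01 ?n"
    by (rule integrable_U01[OF K_integrand_cont(1)[OF w(1) \<theta>] elemD[OF nz_elem w(1) strip_shift(2)[OF \<theta>]]])
  have "kern \<beta> t * ?n t = ?A * (exp (- (of_real (2 * pi * t) * \<beta>)) * ?n t - ?n t)" if "t \<noteq> 0" for t
  proof -
    have "kern \<beta> t = ?A * (exp (- (of_real (2 * pi * t) * \<beta>)) - 1)"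
      using w b_nz that unfolding \<beta>_def by (intro kern_eq exp_ne_1) auto
    then show ?thesis by (simp only: left_diff_distrib right_diff_distrib mult.assoc mult_1_left)
  qed
  then have "K f w \<theta> = (\<integral>t. ?A * (exp (- (of_real (2 * pi * t) * \<beta>)) * ?n t - ?n t) \<partial>U01)"
    unfolding K_def \<beta>_def[symmetric]
    by (intro Bochner_Integration.integral_cong refl) auto
  also have "\<dots> = ?A * ((\<integral>t. exp (- (of_real (2 * pi * t) * \<beta>)) * ?n t \<partial>U01) - (\<integral>t. ?n t \<partial>U01))"
    using i1 i2 by simp
  finally show ?thesis using nz_mean[OF w(1) \<theta>] by simp
qed

lemma K_ode:
  assumes w: "w \<in> \<Omega>" "w \<noteq> 0" and \<theta>: "\<theta> \<in> strip 1"
  shows "(K f w has_field_derivative nz f w \<theta> - of_real b * w * K f w \<theta>) (at \<theta>)"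
proof -
  note s = separately_holD[OF elem_separately_hol[OF nz_elem]]
  have p: "periodic_on_strip 1 (nz f w)" using elem_separately_hol[OF nz_elem] w(1) by (simp add: separately_hol_def)
  show ?thesis
    unfolding K_eq[OF w \<theta>]
    by (rule has_field_derivative_transform_within_open[OF
          periodic_ode[OF s(2)[OF w(1)] p \<theta> exp_ne_1[OF w]] open_strip \<theta>]) (simp only: K_eq[OF w])
qed

text \<open>The second estimate is what the wedge is for: away from 0, \<open>norm \<beta>\<close>
  is comparable with \<bar>Re \<beta>\<bar> and cancels the 1 / \<bar>Re \<beta>\<bar> of
  \<open>periodic_ode_bound\<close>, so x^2 \<partial>x costs nothing. Near 0 the kernel is at most
  24 and \<open>norm \<beta>\<close> at most 1/24.\<close>

lemma K_bounds:
  assumes w: "w \<in> \<Omega>" and \<theta>: "\<theta> \<in> strip 1"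
  shows "norm (K f w \<theta>) \<le> (48 + 2 / \<rho>0) * R * \<mu> (norm w)"
    and "norm (of_real b * w * K f w \<theta>) \<le> (2 + 2 * \<bar>C0\<bar>) * R * \<mu> (norm w)"
proof -
  let ?\<beta> = "of_real b * w" and ?H = "2 * R * \<mu> (norm w)"
  have H: "norm (nz f w \<theta>) \<le> ?H" if "\<theta> \<in> strip 1" for \<theta> using elemD[OF nz_elem w that] .
  have H0: "0 \<le> R * \<mu> (norm w)" using elem_nonneg[OF f] mu_pos[of "norm w"] by simp
  have "norm (K f w \<theta>) \<le> (48 + 2 / \<rho>0) * R * \<mu> (norm w) \<and> norm (?\<beta> * K f w \<theta>) \<le> (2 + 2 * \<bar>C0\<bar>) * R * \<mu> (norm w)"
    using dich[OF w]
  proof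
    assume s: "norm (2 * of_real pi * ?\<beta>) \<le> 1/4"
    have "norm (K f w \<theta>) \<le> 24 * ?H"
      unfolding K_def
    proof (rule norm_integral_U01_le_const)
      fix t :: real assume "0 < t" "t < 1"
      then show "norm (kern ?\<beta> t * nz f w (\<theta> - of_real (2 * pi * t))) \<le> 24 * ?H"
        unfolding norm_mult using kern_small_bound[OF s, of t] H[OF strip_shift(2)[OF \<theta>]]
        by (intro mult_mono) (auto simp del: of_real_mult)
    qed
    then have 1: "norm (K f w \<theta>) \<le> 48 * (R * \<mu> (norm w))" by simp
    have "norm ?\<beta> \<le> 1/24"
    proof -
      have "6 * norm ?\<beta> \<le> 2 * pi * norm ?\<beta>" using pi_gt3 by (intro mult_right_mono) auto
      then show ?thesis using s by (simp add: norm_mult)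
    qed
    then have "norm ?\<beta> * norm (K f w \<theta>) \<le> 1/24 * (48 * (R * \<mu> (norm w)))"
      using 1 by (intro mult_mono) auto
    then have 2: "norm (?\<beta> * K f w \<theta>) \<le> 2 * (R * \<mu> (norm w))" by (simp add: norm_mult)
    have "0 \<le> 2 / \<rho>0 * (R * \<mu> (norm w))" "0 \<le> 2 * \<bar>C0\<bar> * (R * \<mu> (norm w))"
      by (rule mult_nonneg_nonneg[OF _ H0], use rho0 in simp)+
    then show ?thesis using 1 2 unfolding distrib_right mult.assoc by linarith
  next
    assume l: "\<rho>0 \<le> \<bar>Re ?\<beta>\<bar> \<and> norm ?\<beta> \<le> C0 * \<bar>Re ?\<beta>\<bar>"
    then have w0: "w \<noteq> 0" and re: "Re ?\<beta> \<noteq> 0" using rho0 by auto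
    have 1: "norm (K f w \<theta>) \<le> ?H / \<bar>Re ?\<beta>\<bar>"
      unfolding K_eq[OF w w0 \<theta>] by (rule periodic_ode_bound[OF H \<theta> re]) auto
    also have "\<dots> \<le> ?H / \<rho>0" 
      by (intro divide_left_mono mult_pos_pos) (use l rho0 H0 in linarith)+
    finally have 2: "norm (K f w \<theta>) \<le> 2 / \<rho>0 * (R * \<mu> (norm w))" by simp
    have "norm ?\<beta> * norm (K f w \<theta>) \<le> (\<bar>C0\<bar> * \<bar>Re ?\<beta>\<bar>) * (?H / \<bar>Re ?\<beta>\<bar>)"
    proof (rule mult_mono[OF _ 1])
      have "C0 * \<bar>Re ?\<beta>\<bar> \<le> \<bar>C0\<bar> * \<bar>Re ?\<beta>\<bar>" by (intro mult_right_mono) auto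
      then show "norm ?\<beta> \<le> \<bar>C0\<bar> * \<bar>Re ?\<beta>\<bar>" using l by linarith
    qed auto
    also have "\<dots> = 2 * \<bar>C0\<bar> * (R * \<mu> (norm w))" using re by simp
    finally have 3: "norm (?\<beta> * K f w \<theta>) \<le> 2 * \<bar>C0\<bar> * (R * \<mu> (norm w))" by (simp add: norm_mult)
    show ?thesis using 2 3 H0 unfolding distrib_right mult.assoc by linarith
  qed
  then show "norm (K f w \<theta>) \<le> (48 + 2 / \<rho>0) * R * \<mu> (norm w)"
    and "norm (of_real b * w * K f w \<theta>) \<le> (2 + 2 * \<bar>C0\<bar>) * R * \<mu> (norm w)" by auto
qed

end

lemma K_diff:
  assumes *: "elem R f" "elem S g" "w \<in> \<Omega>" "\<theta> \<in> strip 1"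
  shows "K (\<lambda>w \<theta>. f w \<theta> - g w \<theta>) w \<theta> = K f w \<theta> - K g w \<theta>"
proof -
  have "K (\<lambda>w \<theta>. f w \<theta> - g w \<theta>) w \<theta> = (\<integral>t. kern (of_real b * w) t * nz f w (\<theta> - of_real (2 * pi * t))
      - kern (of_real b * w) t * nz g w (\<theta> - of_real (2 * pi * t)) \<partial>U01)"
    unfolding K_def
    by (intro Bochner_Integration.integral_cong refl)
      (simp only: bounded_op_diff[OF bounded_op_nz *(1-3) strip_shift(2)[OF *(4)]] right_diff_distrib)
  also have "\<dots> = K f w \<theta> - K g w \<theta>"
    unfolding K_def
    by (rule Bochner_Integration.integral_diff[OF K_integrable[OF *(1,3,4)] K_integrable[OF *(2,3,4)]])
  finally show ?thesis .
qed

lemma bounded_op_K: "bounded_op (48 + 2 / \<rho>0) K"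
  by (rule bounded_opI[OF elemI[OF separately_hol_K K_bounds(1)] K_diff])

lemma bounded_op_bwK: "bounded_op (2 + 2 * \<bar>C0\<bar>) (\<lambda>f w \<theta>. of_real b * w * K f w \<theta>)"
proof (rule bounded_opI)
  show "elem ((2 + 2 * \<bar>C0\<bar>) * R) (\<lambda>w \<theta>. of_real b * w * K f w \<theta>)" if "elem R f" for R f
    by (rule elemI[OF separately_hol_mult[OF separately_hol_mult[OF separately_hol_const separately_hol_w] separately_hol_K[OF that]] K_bounds(2)[OF that]])
qed (simp only: K_diff right_diff_distrib)

end

section \<open>Lipschitz operators and their fixed points\<close>

context borel_domain
begin

text \<open>The distance of two functions is expressed by a ball that contains their difference, so
  no norm has to exist as a number. \<open>R0\<close> is the radius of the source, \<open>A\<close>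
  that of the image and \<open>L\<close> the Lipschitz constant.\<close>

definition lipschitz_op :: "real \<Rightarrow> real \<Rightarrow> real \<Rightarrow> (borel_fun \<Rightarrow> borel_fun) \<Rightarrow> bool" where
  "lipschitz_op R0 A L N \<longleftrightarrow> (\<forall>f. elem R0 f \<longrightarrow> elem A (N f)) \<and>
     (\<forall>f g d. elem R0 f \<longrightarrow> elem R0 g \<longrightarrow> elem d (\<lambda>w \<theta>. f w \<theta> - g w \<theta>) \<longrightarrow>
        elem (L * d) (\<lambda>w \<theta>. N f w \<theta> - N g w \<theta>))"

lemma lipschitz_opI:
  assumes "\<And>f. elem R0 f \<Longrightarrow> elem A (N f)"
    and "\<And>f g d. elem R0 f \<Longrightarrow> elem R0 g \<Longrightarrow> elem d (\<lambda>w \<theta>. f w \<theta> - g w \<theta>) \<Longrightarrow>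
      elem (L * d) (\<lambda>w \<theta>. N f w \<theta> - N g w \<theta>)"
  shows "lipschitz_op R0 A L N"
  using assms unfolding lipschitz_op_def by blast

lemma lipschitz_op_elem: "lipschitz_op R0 A L N \<Longrightarrow> elem R0 f \<Longrightarrow> elem A (N f)"
  and lipschitz_op_diff: "lipschitz_op R0 A L N \<Longrightarrow> elem R0 f \<Longrightarrow> elem R0 g \<Longrightarrow> elem d (\<lambda>w \<theta>. f w \<theta> - g w \<theta>) \<Longrightarrow>
      elem (L * d) (\<lambda>w \<theta>. N f w \<theta> - N g w \<theta>)"
  unfolding lipschitz_op_def by blast+

lemma lipschitz_op_const: "elem A f \<Longrightarrow> lipschitz_op R0 A 0 (\<lambda>_. f)"
  by (rule lipschitz_opI) (auto intro: elem_cong[OF elem_zero])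

lemma lipschitz_op_bounded_op:
  assumes P: "bounded_op C P" and N: "lipschitz_op R0 A L N" and C: "0 \<le> C"
  shows "lipschitz_op R0 (C * A) (C * L) (\<lambda>f. P (N f))"
proof (rule lipschitz_opI)
  show "elem (C * A) (P (N f))" if "elem R0 f" for f
    by (rule bounded_op_elem[OF P lipschitz_op_elem[OF N that]])
  fix f g d assume *: "elem R0 f" "elem R0 g" "elem d (\<lambda>w \<theta>. f w \<theta> - g w \<theta>)"
  have "elem (C * (L * d)) (P (\<lambda>w \<theta>. N f w \<theta> - N g w \<theta>))"
    by (rule bounded_op_elem[OF P lipschitz_op_diff[OF N *]])
  then show "elem (C * L * d) (\<lambda>w \<theta>. P (N f) w \<theta> - P (N g) w \<theta>)"
    unfolding mult.assoc
    by (rule elem_cong) (rule bounded_op_diff[OF P lipschitz_op_elem[OF N *(1)] lipschitz_op_elem[OF N *(2)]])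
qed

lemma lipschitz_op_id: "lipschitz_op R0 R0 1 (\<lambda>f. f)"
  by (rule lipschitz_opI) auto

lemma lipschitz_op_of_bounded_op: "bounded_op C P \<Longrightarrow> 0 \<le> C \<Longrightarrow> lipschitz_op R0 (C * R0) C P"
  using lipschitz_op_bounded_op[OF _ lipschitz_op_id] by simp

lemma lipschitz_op_mono:
  assumes N: "lipschitz_op R0 A L N" and "A \<le> A'" "L \<le> L'" shows "lipschitz_op R0 A' L' N"
proof (rule lipschitz_opI)
  show "elem A' (N f)" if "elem R0 f" for f
    by (rule elem_mono[OF lipschitz_op_elem[OF N that] assms(2)])
  fix f g d assume *: "elem R0 f" "elem R0 g" "elem d (\<lambda>w \<theta>. f w \<theta> - g w \<theta>)"
  show "elem (L' * d) (\<lambda>w \<theta>. N f w \<theta> - N g w \<theta>)"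
    by (rule elem_mono[OF lipschitz_op_diff[OF N *] mult_right_mono[OF assms(3) elem_nonneg[OF *(3)]]])
qed

lemma lipschitz_op_add:
  assumes M: "lipschitz_op R0 A L M" and N: "lipschitz_op R0 B L' N"
  shows "lipschitz_op R0 (A + B) (L + L') (\<lambda>f w \<theta>. M f w \<theta> + N f w \<theta>)"
proof (rule lipschitz_opI)
  show "elem (A + B) (\<lambda>w \<theta>. M f w \<theta> + N f w \<theta>)" if "elem R0 f" for f
    by (rule elem_add[OF lipschitz_op_elem[OF M that] lipschitz_op_elem[OF N that]])
  fix f g d assume *: "elem R0 f" "elem R0 g" "elem d (\<lambda>w \<theta>. f w \<theta> - g w \<theta>)"
  show "elem ((L + L') * d) (\<lambda>w \<theta>. M f w \<theta> + N f w \<theta> - (M g w \<theta> + N g w \<theta>))"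
    unfolding distrib_right
    by (rule elem_cong[OF elem_add[OF lipschitz_op_diff[OF M *] lipschitz_op_diff[OF N *]]]) simp
qed

lemma lipschitz_op_scale:
  assumes c: "coef C c" and N: "lipschitz_op R0 A L N" and C: "0 \<le> C"
  shows "lipschitz_op R0 (C * A) (C * L) (\<lambda>f w \<theta>. c \<theta> * N f w \<theta>)"
  by (rule lipschitz_op_bounded_op[OF _ N C], rule bounded_opI) (auto intro: elem_scale[OF c] simp: right_diff_distrib)

lemma lipschitz_op_cmult: "lipschitz_op R0 A L N \<Longrightarrow> lipschitz_op R0 (norm c * A) (norm c * L) (\<lambda>f w \<theta>. c * N f w \<theta>)"
  by (rule lipschitz_op_scale[OF coef_const]) auto

lemma lipschitz_op_sub:
  assumes M: "lipschitz_op R0 A L M" and N: "lipschitz_op R0 B L' N"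
  shows "lipschitz_op R0 (A + B) (L + L') (\<lambda>f w \<theta>. M f w \<theta> - N f w \<theta>)"
  using lipschitz_op_add[OF M lipschitz_op_cmult[OF N, of "-1"]] by simp

lemma lipschitz_op_conv:
  assumes M: "lipschitz_op R0 A L M" and N: "lipschitz_op R0 B L' N"
  shows "lipschitz_op R0 (A * B) (L * B + A * L') (\<lambda>f. conv (M f) (N f))"
proof (rule lipschitz_opI)
  show "elem (A * B) (conv (M f) (N f))" if "elem R0 f" for f
    by (rule elem_conv[OF lipschitz_op_elem[OF M that] lipschitz_op_elem[OF N that]])
  fix f g d assume *: "elem R0 f" "elem R0 g" "elem d (\<lambda>w \<theta>. f w \<theta> - g w \<theta>)"
  note Mf = lipschitz_op_elem[OF M *(1)] and Mg = lipschitz_op_elem[OF M *(2)] and Nf = lipschitz_op_elem[OF N *(1)] and Ng = lipschitz_op_elem[OF N *(2)]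
  have "elem (L * d * B + A * (L' * d)) (\<lambda>w \<theta>. conv (\<lambda>w \<theta>. M f w \<theta> - M g w \<theta>) (N f) w \<theta> + conv (M g) (\<lambda>w \<theta>. N f w \<theta> - N g w \<theta>) w \<theta>)"
    by (intro elem_add elem_conv lipschitz_op_diff[OF M *] lipschitz_op_diff[OF N *] Nf Mg)
  then show "elem ((L * B + A * L') * d) (\<lambda>w \<theta>. conv (M f) (N f) w \<theta> - conv (M g) (N g) w \<theta>)"
    by (simp only: distrib_right mult.assoc mult.commute[of d])
      (erule elem_cong, simp add: conv_diff_left[OF Mf Mg Nf] conv_diff_right[OF Nf Ng Mg])
qed

lemma lipschitz_op_suminf:
  assumes N: "\<And>n. lipschitz_op R0 (A n) (L n) (N n)" and A: "summable A" and L: "summable L"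
  shows "lipschitz_op R0 (\<Sum>n. A n) (\<Sum>n. L n) (\<lambda>f w \<theta>. \<Sum>n. N n f w \<theta>)"
proof (rule lipschitz_opI)
  show "elem (\<Sum>n. A n) (\<lambda>w \<theta>. \<Sum>n. N n f w \<theta>)" if "elem R0 f" for f
    by (rule elem_suminf(1)[OF lipschitz_op_elem[OF N that] A])
  fix f g d assume *: "elem R0 f" "elem R0 g" "elem d (\<lambda>w \<theta>. f w \<theta> - g w \<theta>)"
  note s = elem_suminf(2)[OF lipschitz_op_elem[OF N *(1)] A] elem_suminf(2)[OF lipschitz_op_elem[OF N *(2)] A]
  have "elem (\<Sum>n. L n * d) (\<lambda>w \<theta>. \<Sum>n. N n f w \<theta> - N n g w \<theta>)"
    by (rule elem_suminf(1)[OF lipschitz_op_diff[OF N *] summable_mult2[OF L]])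
  then show "elem ((\<Sum>n. L n) * d) (\<lambda>w \<theta>. (\<Sum>n. N n f w \<theta>) - (\<Sum>n. N n g w \<theta>))"
    unfolding suminf_mult2[OF L] by (rule elem_cong) (simp add: suminf_diff s)
qed

lemma elem_LIMSEQ_bound:
  assumes f: "\<And>n. elem R (f n)" and "(\<lambda>n. f n w \<theta>) \<longlonglongrightarrow> l" and "w \<in> \<Omega>" "\<theta> \<in> strip 1"
  shows "norm l \<le> R * \<mu> (norm w)"
  using elemD[OF f assms(3,4)] by (intro Lim_bounded[OF tendsto_norm[OF assms(2)], of 0]) auto

text \<open>Banach's iteration from 0, with the limit written as a telescoping series so that
  \<open>elem_suminf\<close> provides both convergence and holomorphy.\<close>

lemma lipschitz_op_fixed_point:
  assumes N: "lipschitz_op R0 R0 (1/2) N" and R0: "0 \<le> R0"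
  obtains f where "elem R0 f" "\<And>w \<theta>. w \<in> \<Omega> \<Longrightarrow> \<theta> \<in> strip 1 \<Longrightarrow> N f w \<theta> = f w \<theta>"
proof -
  define g where "g = (\<lambda>n. (N ^^ n) (\<lambda>w \<theta>. 0))"
  have g0: "g 0 = (\<lambda>w \<theta>. 0)" and gS: "g (Suc n) = N (g n)" for n by (auto simp: g_def)
  have g: "elem R0 (g n)" for n
    by (induction n) (auto simp: g0 gS intro: elem_mono[OF elem_zero R0] lipschitz_op_elem[OF N])
  have dg: "elem (2 * R0 * (1/2) ^ n) (\<lambda>w \<theta>. g (Suc n) w \<theta> - g n w \<theta>)" for n
  proof (induction n)
    case 0
    then show ?case using elem_diff[OF g[of 1] g[of 0]] by simp
  next
    case (Suc n)
    from lipschitz_op_diff[OF N g g this] show ?case by (simp add: gS field_simps)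
  qed
  have tail: "(\<lambda>k. 2 * R0 * (1/2) ^ (k + n)) sums (4 * R0 * (1/2) ^ n)" for n
  proof -
    have "(\<lambda>k. 2 * R0 * (1/2) ^ n * (1/2) ^ k) sums (2 * R0 * (1/2) ^ n * (1 / (1 - 1/2)))"
      by (intro sums_mult geometric_sums) auto
    then show ?thesis by (simp add: power_add algebra_simps)
  qed
  have s0: "summable (\<lambda>k. 2 * R0 * (1/2) ^ k)" using sums_summable[OF tail[of 0]] by simp
  define f where "f = (\<lambda>w \<theta>. \<Sum>n. g (Suc n) w \<theta> - g n w \<theta>)"
  have sm: "summable (\<lambda>n. g (Suc (n + k)) w \<theta> - g (n + k) w \<theta>)" if "w \<in> \<Omega>" "\<theta> \<in> strip 1" for w \<theta> k
    using elem_suminf(2)[OF dg s0 that]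
      summable_iff_shift[of "\<lambda>n. g (Suc n) w \<theta> - g n w \<theta>" k] by simp
  have lim: "(\<lambda>n. g n w \<theta>) \<longlonglongrightarrow> f w \<theta>" if "w \<in> \<Omega>" "\<theta> \<in> strip 1" for w \<theta>
  proof -
    have "(\<lambda>n. \<Sum>i<n. g (Suc i) w \<theta> - g i w \<theta>) \<longlonglongrightarrow> f w \<theta>"
      unfolding f_def using summable_LIMSEQ[OF sm[OF that, of 0]] by simp
    then show ?thesis using sum_lessThan_telescope[of "\<lambda>n. g n w \<theta>"] by (simp add: g0)
  qed
  have "separately_hol f"
    using elem_separately_hol[OF elem_suminf(1)[OF dg s0]] by (simp add: f_def)
  then have f: "elem R0 f"
    by (rule elemI) (rule elem_LIMSEQ_bound[OF g lim])
  \<comment> \<open>The tail of the series bounds the distance from the limit to the n-th iterate in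
    the weighted sense, which is the form in which the Lipschitz property of \<open>N\<close> can be
    applied.\<close>
  have fg: "elem (4 * R0 * (1/2) ^ n) (\<lambda>w \<theta>. f w \<theta> - g n w \<theta>)" for n
  proof -
    have "elem (\<Sum>k. 2 * R0 * (1/2) ^ (k + n)) (\<lambda>w \<theta>. \<Sum>k. g (Suc (k + n)) w \<theta> - g (k + n) w \<theta>)"
      by (rule elem_suminf(1)[OF dg sums_summable[OF tail]])
    then have "elem (4 * R0 * (1/2) ^ n) (\<lambda>w \<theta>. \<Sum>k. g (Suc (k + n)) w \<theta> - g (k + n) w \<theta>)"
      using sums_unique[OF tail] by simp
    then show ?thesis
    proof (rule elem_cong)
      fix w \<theta> assume *: "w \<in> \<Omega>" "\<theta> \<in> strip 1"
      have "(\<lambda>k. g (k + n) w \<theta>) \<longlonglongrightarrow> f w \<theta>" by (rule LIMSEQ_ignore_initial_segment[OF lim[OF *]])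
      from telescope_sums[OF this] show "(\<Sum>k. g (Suc (k + n)) w \<theta> - g (k + n) w \<theta>) = f w \<theta> - g n w \<theta>"
        using sums_unique by force
    qed
  qed
  have "N f w \<theta> = f w \<theta>" if *: "w \<in> \<Omega>" "\<theta> \<in> strip 1" for w \<theta>
  proof -
    have "(\<lambda>n. N f w \<theta> - g (Suc n) w \<theta>) \<longlonglongrightarrow> 0"
    proof (rule Lim_null_comparison)
      show "\<forall>\<^sub>F n in sequentially. norm (N f w \<theta> - g (Suc n) w \<theta>) \<le> (1/2 * (4 * R0) * \<mu> (norm w)) * (1/2) ^ n"
        using elemD[OF lipschitz_op_diff[OF N f g fg] *] by (intro always_eventually) (simp add: gS ac_simps)
      show "(\<lambda>n. (1/2 * (4 * R0) * \<mu> (norm w)) * (1/2) ^ n) \<longlonglongrightarrow> 0"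
        by (intro tendsto_mult_right_zero LIMSEQ_power_zero) auto
    qed
    from tendsto_diff[OF tendsto_const this, of "N f w \<theta>"]
    have "(\<lambda>n. g (Suc n) w \<theta>) \<longlonglongrightarrow> N f w \<theta>" by simp
    moreover have "(\<lambda>n. g (Suc n) w \<theta>) \<longlonglongrightarrow> f w \<theta>" by (rule LIMSEQ_Suc[OF lim[OF *]])
    ultimately show ?thesis by (rule LIMSEQ_unique)
  qed
  then show ?thesis using that f by blast
qed

text \<open>Borel transform of x^(n + 1) (\<phi>0 + u)^p. A constant has no Borel transform, so at
  least one power of x must be present; hence the shift, with \<open>1\<close> standing for
  x.\<close>

fun x_phi_monomial :: "complex \<Rightarrow> borel_fun \<Rightarrow> nat \<Rightarrow> nat \<Rightarrow> borel_fun" where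
  "x_phi_monomial \<phi>0 u n 0 = (J ^^ n) (\<lambda>w \<theta>. 1)"
| "x_phi_monomial \<phi>0 u n (Suc p) = (\<lambda>w \<theta>. \<phi>0 * x_phi_monomial \<phi>0 u n p w \<theta> + conv u (x_phi_monomial \<phi>0 u n p) w \<theta>)"

lemma elem_J_power: "elem (\<epsilon> ^ Suc n) ((J ^^ n) (\<lambda>w \<theta>. 1))"
  by (induction n) (auto simp: elem_one intro: elem_J)

text \<open>As the radius \<open>A\<close> of u is at most 1, each factor \<phi>0 + u costs at most
  \<open>norm \<phi>0 + 1\<close>. The additional 2 per factor absorbs the exponent p that
  differentiating a p-th power produces.\<close>

lemma lipschitz_op_x_phi_monomial:
  assumes U: "lipschitz_op R0 A L U" and A: "A \<le> 1" and L: "0 \<le> L"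
  shows "lipschitz_op R0 (\<epsilon> ^ Suc n * (2 * (norm \<phi>0 + 1)) ^ p) (L * \<epsilon> ^ Suc n * (2 * (norm \<phi>0 + 1)) ^ p) (\<lambda>f. x_phi_monomial \<phi>0 (U f) n p)"
proof (induction p)
  case 0
  show ?case using lipschitz_op_mono[OF lipschitz_op_const[OF elem_J_power]] L eps_pos by simp
next
  case (Suc p)
  let ?P = "norm \<phi>0 + 1" let ?X = "\<epsilon> ^ Suc n * (2 * ?P) ^ p"
  have X: "0 \<le> ?X" using eps_pos by simp
  show ?case unfolding x_phi_monomial.simps
  proof (rule lipschitz_op_mono[OF lipschitz_op_add[OF lipschitz_op_cmult[OF Suc] lipschitz_op_conv[OF U Suc]]])
    have "norm \<phi>0 * ?X + A * ?X \<le> norm \<phi>0 * ?X + 1 * ?X" using A X by (intro add_mono mult_right_mono) auto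
    also have "\<dots> \<le> ?P * ?X + ?P * ?X" using X by (intro add_mono mult_right_mono) auto
    also have "\<dots> = \<epsilon> ^ Suc n * (2 * ?P) ^ Suc p" by simp
    finally show "norm \<phi>0 * ?X + A * ?X \<le> \<epsilon> ^ Suc n * (2 * ?P) ^ Suc p" .
    have "norm \<phi>0 * (L * \<epsilon> ^ Suc n * (2 * ?P) ^ p) + (L * ?X + A * (L * \<epsilon> ^ Suc n * (2 * ?P) ^ p))
      = norm \<phi>0 * (L * ?X) + L * ?X + A * (L * ?X)" by (simp add: ac_simps)
    also have "\<dots> \<le> norm \<phi>0 * (L * ?X) + L * ?X + 1 * (L * ?X)" using A X L
      by (intro add_mono mult_right_mono) auto
    also have "\<dots> \<le> 2 * ?P * (L * ?X)" 
      using mult_nonneg_nonneg[OF norm_ge_zero[of \<phi>0] mult_nonneg_nonneg[OF L X]] by (simp add: algebra_simps)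
    also have "\<dots> = L * \<epsilon> ^ Suc n * (2 * ?P) ^ Suc p" by simp
    finally show "norm \<phi>0 * (L * \<epsilon> ^ Suc n * (2 * ?P) ^ p) + (L * ?X + A * (L * \<epsilon> ^ Suc n * (2 * ?P) ^ p))
      \<le> L * \<epsilon> ^ Suc n * (2 * ?P) ^ Suc p" .
  qed
qed

end

section \<open>Power series in three variables\<close>

text \<open>An enumeration of the exponents, which turns unordered sums into ordinary
  series.\<close>

definition triple :: "nat \<Rightarrow> nat \<times> nat \<times> nat" where
  "triple n = (case prod_decode n of (i, q) \<Rightarrow> (i, prod_decode q))"

lemma bij_triple: "bij triple"
proof -
  have "triple = map_prod id prod_decode \<circ> prod_decode" by (auto simp: triple_def fun_eq_iff split: prod.splits)
  then show ?thesis
    using bij_comp[OF bij_prod_decode] bij_betw_map_prod[OF bij_id bij_prod_decode] by (metis UNIV_Times_UNIV)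
qed

fun deg :: "nat \<times> nat \<times> nat \<Rightarrow> nat" where "deg (i, j, k) = i + j + k"

definition weight_sum :: "(nat \<times> nat \<times> nat \<Rightarrow> real) \<Rightarrow> real \<Rightarrow> real" where
  "weight_sum c r = (\<Sum>n. \<bar>c (triple n)\<bar> * r ^ deg (triple n))"

definition cubic :: "(nat \<times> nat \<times> nat \<Rightarrow> real) \<Rightarrow> real \<Rightarrow> bool" where
  "cubic c r \<longleftrightarrow> (\<forall>m. deg m < 3 \<longrightarrow> c m = 0) \<and> summable (\<lambda>n. \<bar>c (triple n)\<bar> * r ^ deg (triple n))"

text \<open>Both are bounded by exp 1 \<le> 3 on the strip. This 3, times the 2 of
  \<open>lipschitz_op_x_phi_monomial\<close>, is the 6 in the conditions on
  \<open>r\<close>.\<close>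

lemma norm_cos_sin_le:
  assumes "\<theta> \<in> strip 1" shows "norm (cos \<theta>) \<le> 3" "norm (sin \<theta>) \<le> 3"
proof -
  have e: "norm (exp (\<i> * \<theta>)) \<le> 3" "norm (exp (- (\<i> * \<theta>))) \<le> 3"
  proof -
    have "exp \<bar>Im \<theta>\<bar> \<le> exp 1" using assms by (simp add: strip_def)
    then have *: "exp \<bar>Im \<theta>\<bar> \<le> 3" using exp_le by linarith
    have "exp (- Im \<theta>) \<le> exp \<bar>Im \<theta>\<bar>" "exp (Im \<theta>) \<le> exp \<bar>Im \<theta>\<bar>" by auto
    then have "exp (- Im \<theta>) \<le> 3" "exp (Im \<theta>) \<le> 3" using * by linarith+
    then show "norm (exp (\<i> * \<theta>)) \<le> 3" "norm (exp (- (\<i> * \<theta>))) \<le> 3"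
      by simp_all
  qed
  have "norm (exp (\<i> * \<theta>) + exp (- (\<i> * \<theta>))) \<le> 6" "norm (exp (\<i> * \<theta>) - exp (- (\<i> * \<theta>))) \<le> 6"
    using e norm_triangle_ineq[of "exp (\<i> * \<theta>)" "exp (- (\<i> * \<theta>))"] norm_triangle_ineq4[of "exp (\<i> * \<theta>)" "exp (- (\<i> * \<theta>))"]
    by linarith+
  then show "norm (cos \<theta>) \<le> 3" "norm (sin \<theta>) \<le> 3"
    by (simp_all add: cos_exp_eq sin_exp_eq norm_divide norm_mult)
qed

lemma cos_add_2pi: "cos (\<theta> + 2 * complex_of_real pi) = cos \<theta>"
  and sin_add_2pi: "sin (\<theta> + 2 * complex_of_real pi) = sin \<theta>"
proof -
  have e: "2 * complex_of_real pi = of_real (2 * pi)" by simp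
  show "cos (\<theta> + 2 * complex_of_real pi) = cos \<theta>" "sin (\<theta> + 2 * complex_of_real pi) = sin \<theta>"
    unfolding e cos_add sin_add cos_of_real sin_of_real cos_two_pi sin_two_pi by simp_all
qed

text \<open>A monomial of degree n becomes x^(n - 2) after division by x^2 and so has norm
  \<epsilon>^(n - 2). As n \<ge> 3, one \<epsilon> can be kept; the others absorb the powers of
  \<open>A0\<close> through \<open>\<epsilon> * A0 \<le> r\<close>.\<close>

lemma degree_weight_le:
  fixes A0 r \<epsilon> :: real
  assumes "1 \<le> A0" "0 < \<epsilon>" "0 < r" "\<epsilon> * A0 \<le> r" "q \<le> n" "3 \<le> n"
  shows "A0 ^ q * \<epsilon> ^ (n - 2) \<le> \<epsilon> * (A0 / r) ^ 3 * r ^ n"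
proof -
  obtain m where m: "n = m + 3" using assms(6) le_Suc_ex by (metis add.commute)
  have "A0 ^ q * \<epsilon> ^ (n - 2) \<le> A0 ^ n * \<epsilon> ^ (n - 2)"
    using assms by (intro mult_right_mono power_increasing) auto
  also have "\<dots> = \<epsilon> * A0 ^ 3 * (\<epsilon> * A0) ^ m" by (simp add: m power_add power_mult_distrib power3_eq_cube)
  also have "\<dots> \<le> \<epsilon> * A0 ^ 3 * r ^ m" using assms by (intro mult_left_mono power_mono) auto
  also have "\<dots> = \<epsilon> * (A0 / r) ^ 3 * r ^ n" using assms by (simp add: m power_add power_divide)
  finally show ?thesis .
qed

context borel_domain
begin

lemma coef_mult: "coef C c \<Longrightarrow> coef D d \<Longrightarrow> coef (C * D) (\<lambda>\<theta>. c \<theta> * d \<theta>)"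
  by (auto simp: coef_def periodic_on_strip_def norm_mult
      intro!: holomorphic_intros mult_mono intro: order_trans[OF norm_ge_zero])

lemma coef_one: "coef 1 (\<lambda>_. 1)"
  using coef_const[of 1] by simp

lemma coef_power: "coef C c \<Longrightarrow> coef (C ^ n) (\<lambda>\<theta>. c \<theta> ^ n)"
  by (induction n) (auto intro: coef_mult coef_one)

lemma coef_cos: "coef 3 cos" and coef_sin: "coef 3 sin"
  using norm_cos_sin_le
  by (auto simp: coef_def periodic_on_strip_def cos_add_2pi sin_add_2pi intro!: holomorphic_intros)

text \<open>
  Borel transform of \<open>F (x, x \<phi> cos \<theta>, x \<phi> sin \<theta>) / x\<^sup>2\<close> with \<open>\<phi> = \<phi>0 + u\<close>.  The truncated subtraction
  is harmless because \<open>c\<close> vanishes in degrees below 3.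
\<close>

definition ser :: "(nat \<times> nat \<times> nat \<Rightarrow> real) \<Rightarrow> complex \<Rightarrow> borel_fun \<Rightarrow> borel_fun" where
  "ser c \<phi>0 u w \<theta> = (\<Sum>n. case triple n of (i, j, k) \<Rightarrow>
     (of_real (c (i, j, k)) * (cos \<theta> ^ j * sin \<theta> ^ k)) * x_phi_monomial \<phi>0 u (i + j + k - 3) (j + k) w \<theta>)"

text \<open>By \<open>degree_weight_le\<close> each term is majorized by the corresponding term of
  the convergent \<open>weight_sum\<close>, with a spare \<epsilon>. The second claim keeps the
  termwise majorant for the Laplace transform of the series.\<close>

lemma lipschitz_op_ser:
  assumes U: "lipschitz_op R0 A L U" and A: "A \<le> 1" and L: "0 \<le> L"
    and c: "cubic c r" and r: "0 < r" and eps: "\<epsilon> * (6 * (norm \<phi>0 + 1)) \<le> r"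
    and \<kappa>: "(6 * (norm \<phi>0 + 1) / r) ^ 3 * weight_sum c r \<le> \<kappa>"
  shows "lipschitz_op R0 (\<epsilon> * \<kappa>) (L * (\<epsilon> * \<kappa>)) (\<lambda>f. ser c \<phi>0 (U f))"
    and "elem R0 f \<Longrightarrow> \<exists>B. summable B \<and> (\<forall>n. elem (B n) (\<lambda>w \<theta>. case triple n of (i, j, k) \<Rightarrow>
     (of_real (c (i, j, k)) * (cos \<theta> ^ j * sin \<theta> ^ k)) * x_phi_monomial \<phi>0 (U f) (i + j + k - 3) (j + k) w \<theta>))"
proof -
  let ?A0 = "6 * (norm \<phi>0 + 1)"
  define B where "B = (\<lambda>n. \<epsilon> * (?A0 / r) ^ 3 * (\<bar>c (triple n)\<bar> * r ^ deg (triple n)))"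
  define T where "T = (\<lambda>n f w \<theta>. case triple n of (i, j, k) \<Rightarrow>
     (of_real (c (i, j, k)) * (cos \<theta> ^ j * sin \<theta> ^ k)) * x_phi_monomial \<phi>0 (U f) (i + j + k - 3) (j + k) w \<theta>)"
  have sB: "summable B" unfolding B_def using c by (intro summable_mult) (auto simp: cubic_def)
  have lT: "lipschitz_op R0 (B n) (L * B n) (T n)" for n
  proof (cases "triple n")
    case (fields i j k)
    let ?n = "i + j + k" and ?c = "\<bar>c (i, j, k)\<bar>"
    have Tn: "T n = (\<lambda>f w \<theta>. (of_real (c (i, j, k)) * (cos \<theta> ^ j * sin \<theta> ^ k)) * x_phi_monomial \<phi>0 (U f) (i + j + k - 3) (j + k) w \<theta>)"
      by (simp add: T_def fields)
    have "coef (norm (complex_of_real (c (i, j, k))) * (3 ^ j * 3 ^ k)) (\<lambda>\<theta>. of_real (c (i, j, k)) * (cos \<theta> ^ j * sin \<theta> ^ k))"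
      by (intro coef_mult coef_const coef_power coef_cos coef_sin)
    then have cf: "coef (?c * 3 ^ (j + k)) (\<lambda>\<theta>. of_real (c (i, j, k)) * (cos \<theta> ^ j * sin \<theta> ^ k))"
      by (simp add: power_add)
    note l = lipschitz_op_scale[OF cf lipschitz_op_x_phi_monomial[OF U A L, of "?n - 3" \<phi>0 "j + k"]]
    have le: "?c * 3 ^ (j + k) * (\<epsilon> ^ Suc (?n - 3) * (2 * (norm \<phi>0 + 1)) ^ (j + k)) \<le> B n"
    proof (cases "?n < 3")
      case True
      then have "c (i, j, k) = 0" using c unfolding cubic_def by (metis deg.simps)
      then show ?thesis by (simp add: B_def fields)
    next
      case False
      then have s: "Suc (?n - 3) = ?n - 2" by simp
      have "?A0 ^ (j + k) * \<epsilon> ^ (?n - 2) \<le> \<epsilon> * (?A0 / r) ^ 3 * r ^ ?n"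
        using False eps eps_pos r by (intro degree_weight_le) auto
      then have "?c * (?A0 ^ (j + k) * \<epsilon> ^ (?n - 2)) \<le> ?c * (\<epsilon> * (?A0 / r) ^ 3 * r ^ ?n)"
        by (rule mult_left_mono) simp
      moreover have "?A0 ^ (j + k) = 3 ^ (j + k) * (2 * (norm \<phi>0 + 1)) ^ (j + k)"
        by (subst power_mult_distrib[symmetric]) simp
      ultimately show ?thesis unfolding s by (simp add: B_def fields ac_simps)
    qed
    show ?thesis unfolding Tn
    proof (rule lipschitz_op_mono[OF l])
      show "?c * 3 ^ (j + k) * (L * \<epsilon> ^ Suc (?n - 3) * (2 * (norm \<phi>0 + 1)) ^ (j + k)) \<le> L * B n"
        using mult_left_mono[OF le L] by (simp add: ac_simps)
    qed (use le in auto)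
  qed
  have "lipschitz_op R0 (\<Sum>n. B n) (\<Sum>n. L * B n) (\<lambda>f w \<theta>. \<Sum>n. T n f w \<theta>)"
    by (rule lipschitz_op_suminf[OF lT sB summable_mult[OF sB]])
  moreover have "(\<lambda>f w \<theta>. \<Sum>n. T n f w \<theta>) = (\<lambda>f. ser c \<phi>0 (U f))"
    by (simp add: ser_def[abs_def] T_def)
  moreover have sumB: "(\<Sum>n. B n) \<le> \<epsilon> * \<kappa>"
  proof -
    have "(\<Sum>n. B n) = \<epsilon> * (?A0 / r) ^ 3 * weight_sum c r"
      unfolding B_def weight_sum_def using c by (intro suminf_mult) (auto simp: cubic_def)
    also have "\<dots> \<le> \<epsilon> * \<kappa>" using mult_left_mono[OF \<kappa>, of \<epsilon>] eps_pos by (simp add: mult.assoc)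
    finally show ?thesis .
  qed
  moreover have "(\<Sum>n. L * B n) \<le> L * (\<epsilon> * \<kappa>)"
    using mult_left_mono[OF sumB L] by (simp add: suminf_mult[OF sB])
  ultimately show "lipschitz_op R0 (\<epsilon> * \<kappa>) (L * (\<epsilon> * \<kappa>)) (\<lambda>f. ser c \<phi>0 (U f))"
    using lipschitz_op_mono by fastforce
  show "\<exists>B. summable B \<and> (\<forall>n. elem (B n) (\<lambda>w \<theta>. case triple n of (i, j, k) \<Rightarrow>
     (of_real (c (i, j, k)) * (cos \<theta> ^ j * sin \<theta> ^ k)) * x_phi_monomial \<phi>0 (U f) (i + j + k - 3) (j + k) w \<theta>))" if "elem R0 f"
    using sB lipschitz_op_elem[OF lT that] unfolding T_def by blast
qed

end

context borel_kernel
begin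

definition al :: real where "al = (3 * b + 2) / b"

section \<open>The contraction\<close>

text \<open>
  With \<open>f\<close> the Borel transform of \<open>s\<^sub>\<theta> + b x\<^sup>2 s\<^sub>x + (3 b + 2) x \<langle>s\<rangle>\<close>, the operators \<open>U_op\<close>, \<open>V_op\<close>, \<open>S_op\<close> and
  \<open>J \<circ> K\<close> give the Borel transforms of \<open>u = x s\<close>, \<open>x\<^sup>2 s\<^sub>x\<close>, \<open>s\<^sub>\<theta>\<close> and \<open>x (s - \<langle>s\<rangle>)\<close>.  The series \<open>s\<close> may have a
  constant term, so it has no Borel transform of its own.
\<close>

definition U_op :: "borel_fun \<Rightarrow> borel_fun" where
  "U_op f = (\<lambda>w \<theta>. of_real (1 / b) * euler_op al (mean_op f) w \<theta> + J (K f) w \<theta>)"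

definition V_op :: "borel_fun \<Rightarrow> borel_fun" where
  "V_op f = (\<lambda>w \<theta>. of_real (1 / b) * (mean_op f w \<theta> - of_real al * euler_op al (mean_op f) w \<theta>) + of_real (1 / b) * (of_real b * w * K f w \<theta>))"

definition S_op :: "borel_fun \<Rightarrow> borel_fun" where
  "S_op f = (\<lambda>w \<theta>. nz f w \<theta> - of_real b * w * K f w \<theta>)"

text \<open>The Euler terms cancel because b al = 3 b + 2, and the terms with b w K cancel between
  \<partial>\<theta> and b x^2 \<partial>x; mean and oscillating part of \<open>f\<close>
  remain.\<close>

lemma linear_relation:
  "S_op f w \<theta> + of_real b * V_op f w \<theta> + of_real (3 * b + 2) * (U_op f w \<theta> - J (K f) w \<theta>) = f w \<theta>"
proof -
  have 1: "complex_of_real (3 * b + 2) = of_real b * of_real al" using b_nz by (simp add: al_def flip: of_real_mult)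
  have 2: "of_real b * (of_real (1 / b) * x) = x" for x :: complex using b_nz by simp
  have "of_real b * V_op f w \<theta> = mean_op f w \<theta> - of_real al * euler_op al (mean_op f) w \<theta> + of_real b * w * K f w \<theta>"
    unfolding V_op_def distrib_left 2 ..
  moreover have "of_real (3 * b + 2) * (U_op f w \<theta> - J (K f) w \<theta>) = of_real al * (of_real b * (of_real (1 / b) * euler_op al (mean_op f) w \<theta>))"
    unfolding 1 U_op_def by simp
  ultimately show ?thesis unfolding 2 by (simp add: S_op_def nz_def)
qed

text \<open>The Euler part depends on the mean only and is constant in \<theta>, so u_\<theta> = x
  s_\<theta> comes from \<open>J (K f)\<close> alone.\<close>

lemma U_op_deriv_theta:
  assumes f: "elem R f" and w: "w \<in> \<Omega>" "\<theta> \<in> strip 1"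
  shows "(U_op f w has_field_derivative J (S_op f) w \<theta>) (at \<theta>)"
proof -
  have "(J (K f) w has_field_derivative J (S_op f) w \<theta>) (at \<theta>)"
    by (rule J_deriv_theta[OF bounded_op_elem[OF bounded_op_K f] w]) (simp add: S_op_def K_ode[OF f _ _ w(2)])
  moreover have "((\<lambda>\<theta>. of_real (1 / b) * euler_op al (mean_op f) w \<theta>) has_field_derivative 0) (at \<theta>)"
    by (simp add: euler_op_def mean_op_def)
  ultimately show ?thesis unfolding U_op_def using DERIV_add by fastforce
qed

lemma norm_1_b: "norm (complex_of_real (1 / b)) = 1 / \<bar>b\<bar>"
  by (simp add: norm_divide)

lemma bounded_op_wK: "bounded_op ((2 + 2 * \<bar>C0\<bar>) / \<bar>b\<bar>) (\<lambda>f w \<theta>. of_real (1 / b) * (of_real b * w * K f w \<theta>))"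
  using bounded_op_scale[OF bounded_op_bwK, of "of_real (1 / b)"] unfolding norm_1_b by (simp only: times_divide_eq_left mult_1_left)

context
  assumes alpha: "1 < al"
begin

lemma bounded_op_euler_op_mean_op: "bounded_op 1 (\<lambda>f. euler_op al (mean_op f))"
  using bounded_op_comp[OF bounded_op_mean_op bounded_op_euler_op[OF alpha]] by simp

lemma bounded_op_J_K: "bounded_op (\<epsilon> * (48 + 2 / \<rho>0)) (\<lambda>f. J (K f))"
  by (rule bounded_op_comp[OF bounded_op_K bounded_op_J])

lemma bounded_op_U_op: "bounded_op (1 / \<bar>b\<bar> + \<epsilon> * (48 + 2 / \<rho>0)) U_op"
  using bounded_op_add[OF bounded_op_scale[OF bounded_op_euler_op_mean_op, of "of_real (1 / b)"] bounded_op_J_K]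
  unfolding norm_1_b U_op_def[abs_def] mult_1_right .

lemma bounded_op_V_op: "bounded_op ((1 + al) / \<bar>b\<bar> + (2 + 2 * \<bar>C0\<bar>) / \<bar>b\<bar>) V_op"
  using bounded_op_add[OF bounded_op_scale[OF bounded_op_sub[OF bounded_op_mean_op bounded_op_scale[OF bounded_op_euler_op_mean_op, of "of_real al"]], of "of_real (1 / b)"] bounded_op_wK]
  unfolding norm_1_b V_op_def[abs_def] mult_1_right using alpha by simp

lemma bounded_op_S_op: "bounded_op (4 + 2 * \<bar>C0\<bar>) S_op"
  using bounded_op_sub[OF bounded_op_nz bounded_op_bwK] by (simp add: S_op_def[abs_def])

text \<open>Borel form of x^2 u_x = x (x^2 s_x + u), which later supplies the x-derivative of the
  graph.\<close>

lemma w_U_op_eq: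
  assumes f: "elem R f" and w: "w \<in> \<Omega>" "\<theta> \<in> strip 1"
  shows "w * U_op f w \<theta> = J (\<lambda>w \<theta>. V_op f w \<theta> + U_op f w \<theta>) w \<theta>"
proof (rule w_mult_eq_J[OF bounded_op_elem[OF bounded_op_U_op f] elem_add[OF bounded_op_elem[OF bounded_op_V_op f] bounded_op_elem[OF bounded_op_U_op f]] w])
  fix z assume z: "z \<in> \<Omega>"
  obtain D where D: "((\<lambda>w. euler_op al (mean_op f) w \<theta>) has_field_derivative D) (at z)"
    "z * D = mean_op f z \<theta> - of_real al * euler_op al (mean_op f) z \<theta>"
    using euler_op_ode[OF alpha bounded_op_elem[OF bounded_op_mean_op f] z w(2)] by blast
  have "((\<lambda>w. J (K f) w \<theta>) has_field_derivative K f z \<theta>) (at z)"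
    by (rule J_has_field_derivative[OF separately_hol_K[OF f] w(2) z])
  from DERIV_add[OF DERIV_cmult[OF D(1), of "of_real (1 / b)"] this]
  have "((\<lambda>w. U_op f w \<theta>) has_field_derivative of_real (1 / b) * D + K f z \<theta>) (at z)"
    by (simp add: U_op_def)
  moreover have "z * (of_real (1 / b) * D + K f z \<theta>) = V_op f z \<theta>"
  proof -
    have "z * (of_real (1 / b) * D) = of_real (1 / b) * (z * D)" by simp
    then show ?thesis using b_nz unfolding V_op_def D(2) distrib_left by simp
  qed
  ultimately show "\<exists>D. ((\<lambda>w. U_op f w \<theta>) has_field_derivative D) (at z) \<and> z * D + U_op f z \<theta> = V_op f z \<theta> + U_op f z \<theta>"
    by auto
qed

end

end

text \<open>Lipschitz constants of the terms \<open>quad\<close>, \<open>high\<close>, \<open>lead\<close> below and of the full nonlinear part beyond \<open>lead\<close>.\<close>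

definition cq :: "real \<Rightarrow> real \<Rightarrow> complex \<Rightarrow> real" where
  "cq \<Lambda> a \<phi>0 = norm (2 * of_real a * \<phi>0) * \<Lambda> + norm (of_real a :: complex) * (2 * \<Lambda> * \<Lambda>)"

definition ch1 :: "real \<Rightarrow> real \<Rightarrow> real \<Rightarrow> complex \<Rightarrow> real" where
  "ch1 \<Lambda> a b \<phi>0 = 2 * cq \<Lambda> a \<phi>0 * (\<Lambda> + \<Lambda>) + norm (3 * of_real a * \<phi>0) * (2 * \<Lambda> * \<Lambda>)
     + norm (of_real a :: complex) * (2 * (2 * \<Lambda> * \<Lambda>) * \<Lambda>) + 2 * \<Lambda> * (\<Lambda> + \<Lambda>) + 2 * \<Lambda> * \<Lambda> + norm (of_real (3 * b + 2) :: complex) * \<Lambda>"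

definition cl1 :: "real \<Rightarrow> complex \<Rightarrow> real" where
  "cl1 \<Lambda> \<phi>0 = 3 * \<Lambda> + 3 * \<Lambda> + norm \<phi>0 * \<Lambda>"

definition ch2 :: "real \<Rightarrow> real \<Rightarrow> real \<Rightarrow> complex \<Rightarrow> real" where
  "ch2 \<Lambda> a b \<phi>0 = ch1 \<Lambda> a b \<phi>0 + norm (1 / \<phi>0) *
     (2 * \<Lambda> * (\<Lambda> + (ch1 \<Lambda> a b \<phi>0 + cl1 \<Lambda> \<phi>0)) + 2 * (3 * \<Lambda> + 3 * \<Lambda>) * \<Lambda>)"

text \<open>\<open>C\<close> bounds the linear operators, \<open>\<epsilon> * \<kappa>\<close> the
  three series, \<open>\<rho> * \<epsilon>\<close> is the radius of the ball and
  \<open>\<Lambda>\<close> a common first-order constant. All but \<epsilon> are fixed in advance,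
  and \<epsilon> alone has to be small. \<open>C_rho\<close> keeps u in the unit ball, as the
  estimate for powers of \<phi>0 + u demands; the 1 in \<open>rho\<close> is room for the
  second-order remainder.\<close>

locale nonlinear = borel_kernel +
  fixes a r \<kappa> C \<rho> \<Lambda> :: real and \<phi>0 :: complex and cF cG cH :: "nat \<times> nat \<times> nat \<Rightarrow> real"
  assumes alpha: "1 < al" and eps_le: "\<epsilon> \<le> 1"
    and phi0: "\<phi>0 \<noteq> 0"
    and C1: "1 / \<bar>b\<bar> + (48 + 2 / \<rho>0) \<le> C"
    and C2: "(1 + al) / \<bar>b\<bar> + (2 + 2 * \<bar>C0\<bar>) / \<bar>b\<bar> \<le> C"
    and C3: "4 + 2 * \<bar>C0\<bar> \<le> C"
    and r: "0 < r" and cub: "cubic cF r" "cubic cG r" "cubic cH r"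
    and eps_r: "\<epsilon> * (6 * (norm \<phi>0 + 1)) \<le> r"
    and kap: "(6 * (norm \<phi>0 + 1) / r) ^ 3 * weight_sum cF r \<le> \<kappa>"
      "(6 * (norm \<phi>0 + 1) / r) ^ 3 * weight_sum cG r \<le> \<kappa>"
      "(6 * (norm \<phi>0 + 1) / r) ^ 3 * weight_sum cH r \<le> \<kappa>"
    and rho: "(norm \<phi>0 + 6) * \<kappa> + 1 \<le> \<rho>" 
    and C_rho: "C * (\<rho> * \<epsilon>) \<le> 1"
    and Lam: "C * \<rho> \<le> \<Lambda>" "C \<le> \<Lambda>" "\<kappa> \<le> \<Lambda>" "C * \<kappa> \<le> \<Lambda>" "\<rho> \<le> \<Lambda>" "1 \<le> \<Lambda>"
    and small: "ch2 \<Lambda> a b \<phi>0 * \<epsilon> \<le> 1"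
      "((norm \<phi>0 + 6) * (C * \<kappa>) + ch2 \<Lambda> a b \<phi>0) * \<epsilon> \<le> 1/2"
begin

text \<open>
  Operators on the ball of radius \<open>\<rho> \<epsilon>\<close> with values and Lipschitz constant of order \<open>\<epsilon>\<close> and \<open>1\<close>, respectively
  \<open>\<epsilon>\<^sup>2\<close> and \<open>\<epsilon>\<close>: the second class gains the factor needed for a contraction.
\<close>

definition first_order :: "real \<Rightarrow> (borel_fun \<Rightarrow> borel_fun) \<Rightarrow> bool" where
  "first_order l N \<longleftrightarrow> lipschitz_op (\<rho> * \<epsilon>) (l * \<epsilon>) l N"

definition second_order :: "real \<Rightarrow> (borel_fun \<Rightarrow> borel_fun) \<Rightarrow> bool" where
  "second_order l N \<longleftrightarrow> lipschitz_op (\<rho> * \<epsilon>) (l * \<epsilon> * \<epsilon>) (l * \<epsilon>) N"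

lemma kap0: "0 \<le> \<kappa>"
proof -
  have "0 \<le> weight_sum cF r" unfolding weight_sum_def
    using cub(1) r by (intro suminf_nonneg) (auto simp: cubic_def)
  then have "0 \<le> (6 * (norm \<phi>0 + 1) / r) ^ 3 * weight_sum cF r" using r by simp
  then show ?thesis using kap(1) by linarith
qed

lemma rho_pos: "1 \<le> \<rho>"
proof -
  have "0 \<le> (norm \<phi>0 + 6) * \<kappa>" using kap0 by simp
  then show ?thesis using rho by linarith
qed

lemma C_ge: "4 \<le> C" using C3 by linarith

lemma ball0: "elem (\<rho> * \<epsilon>) (\<lambda>w \<theta>. 0)"
  by (rule elem_mono[OF elem_zero]) (use rho_pos eps_pos in simp)

lemma first_order_nonneg: "first_order l N \<Longrightarrow> 0 \<le> l"
  unfolding first_order_def using elem_nonneg[OF lipschitz_op_elem[OF _ ball0]] eps_pos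
  by (metis less_le_not_le mult_neg_pos linorder_not_le)

lemma second_order_nonneg: "second_order l N \<Longrightarrow> 0 \<le> l"
  unfolding second_order_def using elem_nonneg[OF lipschitz_op_elem[OF _ ball0]] eps_pos
  by (metis less_le_not_le mult_neg_pos linorder_not_le mult.assoc mult_pos_pos)

lemma second_order_first_order: "second_order l N \<Longrightarrow> first_order l N"
  unfolding first_order_def using second_order_nonneg[of l N] eps_le eps_pos unfolding second_order_def
  by (auto intro!: mult_left_le elim!: lipschitz_op_mono)

lemma first_order_add: "first_order l M \<Longrightarrow> first_order l' N \<Longrightarrow> first_order (l + l') (\<lambda>f w \<theta>. M f w \<theta> + N f w \<theta>)"
  unfolding first_order_def distrib_right by (rule lipschitz_op_add)

lemma first_order_sub: "first_order l M \<Longrightarrow> first_order l' N \<Longrightarrow> first_order (l + l') (\<lambda>f w \<theta>. M f w \<theta> - N f w \<theta>)"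
  unfolding first_order_def distrib_right by (rule lipschitz_op_sub)

lemma first_order_cmult: "first_order l N \<Longrightarrow> first_order (norm c * l) (\<lambda>f w \<theta>. c * N f w \<theta>)"
  unfolding first_order_def mult.assoc by (rule lipschitz_op_cmult)

lemma second_order_add: "second_order l M \<Longrightarrow> second_order l' N \<Longrightarrow> second_order (l + l') (\<lambda>f w \<theta>. M f w \<theta> + N f w \<theta>)"
  unfolding second_order_def distrib_right by (rule lipschitz_op_add)

lemma second_order_sub: "second_order l M \<Longrightarrow> second_order l' N \<Longrightarrow> second_order (l + l') (\<lambda>f w \<theta>. M f w \<theta> - N f w \<theta>)"
  unfolding second_order_def distrib_right by (rule lipschitz_op_sub)

lemma second_order_cmult: "second_order l N \<Longrightarrow> second_order (norm c * l) (\<lambda>f w \<theta>. c * N f w \<theta>)"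
  unfolding second_order_def mult.assoc by (rule lipschitz_op_cmult)

text \<open>Each factor brings one \<epsilon> to the values. In the Lipschitz constant the product
  rule gives l l' \<epsilon> twice, hence the 2.\<close>

lemma second_order_conv:
  assumes M: "first_order l M" and N: "first_order l' N" shows "second_order (2 * l * l') (\<lambda>f. conv (M f) (N f))"
  unfolding second_order_def
proof (rule lipschitz_op_mono[OF lipschitz_op_conv[OF M[unfolded first_order_def] N[unfolded first_order_def]]])
  have "0 \<le> l * l' * \<epsilon> * \<epsilon>" using first_order_nonneg[OF M] first_order_nonneg[OF N] eps_pos by simp
  then show "l * \<epsilon> * (l' * \<epsilon>) \<le> 2 * l * l' * \<epsilon> * \<epsilon>" by (simp add: ac_simps)
qed (simp add: algebra_simps)

lemma first_order_J:
  assumes N: "first_order l N" shows "first_order l (\<lambda>f. J (N f))"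
  unfolding first_order_def
proof (rule lipschitz_op_mono[OF lipschitz_op_bounded_op[OF bounded_op_J N[unfolded first_order_def]]])
  have l: "0 \<le> l" by (rule first_order_nonneg[OF N])
  show "0 \<le> \<epsilon>" "\<epsilon> * (l * \<epsilon>) \<le> l * \<epsilon>" "\<epsilon> * l \<le> l"
    using l eps_pos eps_le by (auto intro!: mult_left_le_one_le mult_left_le)
qed

lemma bounded_op_C: "bounded_op C U_op" "bounded_op C V_op" "bounded_op C S_op"
proof -
  have "\<epsilon> * (48 + 2 / \<rho>0) \<le> 48 + 2 / \<rho>0" using eps_pos eps_le rho0 by (intro mult_left_le_one_le) auto
  then show "bounded_op C U_op" using C1 by (intro bounded_op_mono[OF bounded_op_U_op[OF alpha]]) linarith
  show "bounded_op C V_op" "bounded_op C S_op"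
    by (rule bounded_op_mono[OF bounded_op_V_op[OF alpha] C2], rule bounded_op_mono[OF bounded_op_S_op[OF alpha] C3])
qed

lemma first_order_bounded_op: "bounded_op C P \<Longrightarrow> first_order \<Lambda> P"
  unfolding first_order_def
proof (erule lipschitz_op_mono[OF lipschitz_op_of_bounded_op])
  have "C * \<rho> * \<epsilon> \<le> \<Lambda> * \<epsilon>" using Lam(1) eps_pos by (intro mult_right_mono) auto
  then show "C * (\<rho> * \<epsilon>) \<le> \<Lambda> * \<epsilon>" by (simp only: mult.assoc)
qed (use C_ge Lam(2) in auto)

lemma first_order_id: "first_order \<Lambda> (\<lambda>f. f)"
  unfolding first_order_def by (rule lipschitz_op_mono[OF lipschitz_op_id]) (use Lam(5,6) eps_pos in auto)

text \<open>\<open>J\<close> supplies the second \<epsilon>. This is why the oscillating part of (3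
  b + 2) x s can be treated as a perturbation.\<close>

lemma second_order_JK: "second_order \<Lambda> (\<lambda>f. J (K f))"
  unfolding second_order_def
proof (rule lipschitz_op_mono[OF lipschitz_op_of_bounded_op[OF bounded_op_J_K[OF alpha]]])
  have k: "0 \<le> 48 + 2 / \<rho>0" "48 + 2 / \<rho>0 \<le> C" using rho0 C1 by (auto intro: order_trans[rotated])
  have kC: "(48 + 2 / \<rho>0) * \<rho> \<le> C * \<rho>" using k rho_pos by (intro mult_right_mono) auto
  show "0 \<le> \<epsilon> * (48 + 2 / \<rho>0)" using k eps_pos by simp
  have "((48 + 2 / \<rho>0) * \<rho>) * (\<epsilon> * \<epsilon>) \<le> \<Lambda> * (\<epsilon> * \<epsilon>)"
    using kC Lam(1) eps_pos by (intro mult_right_mono) auto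
  then show "\<epsilon> * (48 + 2 / \<rho>0) * (\<rho> * \<epsilon>) \<le> \<Lambda> * \<epsilon> * \<epsilon>" by (simp add: ac_simps)
  have "(48 + 2 / \<rho>0) * \<epsilon> \<le> \<Lambda> * \<epsilon>" using k Lam(2) eps_pos by (intro mult_right_mono) auto
  then show "\<epsilon> * (48 + 2 / \<rho>0) \<le> \<Lambda> * \<epsilon>" by (simp add: mult.commute)
qed

lemma U_lipschitz_op: "lipschitz_op (\<rho> * \<epsilon>) (C * (\<rho> * \<epsilon>)) C U_op"
  using C_ge by (intro lipschitz_op_of_bounded_op bounded_op_C) auto

lemma lipschitz_op_sers:
  "lipschitz_op (\<rho> * \<epsilon>) (\<epsilon> * \<kappa>) (C * (\<epsilon> * \<kappa>)) (\<lambda>f. ser cF \<phi>0 (U_op f))"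
  "lipschitz_op (\<rho> * \<epsilon>) (\<epsilon> * \<kappa>) (C * (\<epsilon> * \<kappa>)) (\<lambda>f. ser cG \<phi>0 (U_op f))"
  "lipschitz_op (\<rho> * \<epsilon>) (\<epsilon> * \<kappa>) (C * (\<epsilon> * \<kappa>)) (\<lambda>f. ser cH \<phi>0 (U_op f))"
  using lipschitz_op_ser(1)[OF U_lipschitz_op C_rho _ _ r eps_r] cub kap C_ge by auto

lemma first_order_of_ser: "lipschitz_op (\<rho> * \<epsilon>) (\<epsilon> * \<kappa>) (C * (\<epsilon> * \<kappa>)) N \<Longrightarrow> first_order \<Lambda> N"
  unfolding first_order_def
proof (erule lipschitz_op_mono)
  show "\<epsilon> * \<kappa> \<le> \<Lambda> * \<epsilon>" using Lam(3) eps_pos by (simp add: mult.commute)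
  have "\<epsilon> * (C * \<kappa>) \<le> C * \<kappa>" using eps_pos eps_le C_ge kap0 by (intro mult_left_le_one_le) auto
  then show "C * (\<epsilon> * \<kappa>) \<le> \<Lambda>" using Lam(4) by (simp add: ac_simps)
qed

text \<open>
  \<open>lead\<close> has values of order \<open>\<epsilon>\<close> only, which determines the radius \<open>\<rho> \<epsilon>\<close>.  The Laplace transform of
  \<open>defect f\<close> is the defect of the tangency condition, divided by \<open>x\<^sup>2\<close>, if one replaces \<open>\<theta>'\<close> by \<open>1\<close>; \<open>twist\<close>
  accounts for \<open>\<theta>' - 1 = (x / \<phi>) (\<dots>)\<close>.  Multiplying by \<open>\<phi> = \<phi>0 + u\<close> avoids the inverse of \<open>\<phi>\<close>, so that the equation
  to solve is \<open>\<phi> defect + x twist s\<^sub>\<theta> = 0\<close>.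
\<close>

definition lead :: "borel_fun \<Rightarrow> borel_fun" where
  "lead f = (\<lambda>w \<theta>. cos \<theta> * ser cG \<phi>0 (U_op f) w \<theta> + sin \<theta> * ser cH \<phi>0 (U_op f) w \<theta> - \<phi>0 * ser cF \<phi>0 (U_op f) w \<theta>)"

definition quad :: "borel_fun \<Rightarrow> borel_fun" where
  "quad f = (\<lambda>w \<theta>. 2 * of_real a * \<phi>0 * U_op f w \<theta> + of_real a * conv (U_op f) (U_op f) w \<theta>)"

text \<open>From expanding (\<phi> + v + u) (- 1 - a \<phi>^2 + F) with \<phi> = \<phi>0 + u:
  \<open>quad\<close> is a \<phi>^2 - a \<phi>0^2, and \<phi> times it contributes 3 a \<phi>0 u^2 +
  a u^3, its linear part having gone into 3 b + 2. The last term is the oscillating part of (3 b +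
  2) x s, moved over from the linear side.\<close>

definition high :: "borel_fun \<Rightarrow> borel_fun" where
  "high f = (\<lambda>w \<theta>. conv (quad f) (\<lambda>w \<theta>. V_op f w \<theta> + U_op f w \<theta>) w \<theta>
     + 3 * of_real a * \<phi>0 * conv (U_op f) (U_op f) w \<theta>
     + of_real a * conv (conv (U_op f) (U_op f)) (U_op f) w \<theta>
     - conv (ser cF \<phi>0 (U_op f)) (\<lambda>w \<theta>. V_op f w \<theta> + U_op f w \<theta>) w \<theta>
     - conv (U_op f) (ser cF \<phi>0 (U_op f)) w \<theta>
     - of_real (3 * b + 2) * J (K f) w \<theta>)"

definition defect :: "borel_fun \<Rightarrow> borel_fun" where
  "defect f = (\<lambda>w \<theta>. f w \<theta> - (high f w \<theta> + lead f w \<theta>))"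

definition twist :: "borel_fun \<Rightarrow> borel_fun" where
  "twist f = (\<lambda>w \<theta>. cos \<theta> * ser cH \<phi>0 (U_op f) w \<theta> - sin \<theta> * ser cG \<phi>0 (U_op f) w \<theta>)"

text \<open>The equation solved for the \<open>f\<close> in
  \<open>defect f = f - (high f + lead f)\<close>; only the constant \<phi>0 is inverted.\<close>

definition N_op :: "borel_fun \<Rightarrow> borel_fun" where
  "N_op f = (\<lambda>w \<theta>. lead f w \<theta> + (high f w \<theta>
     - 1 / \<phi>0 * (conv (U_op f) (defect f) w \<theta> + conv (J (twist f)) (S_op f) w \<theta>)))"

lemma first_order_cos: "first_order l N \<Longrightarrow> first_order (3 * l) (\<lambda>f w \<theta>. cos \<theta> * N f w \<theta>)"
  and first_order_sin: "first_order l N \<Longrightarrow> first_order (3 * l) (\<lambda>f w \<theta>. sin \<theta> * N f w \<theta>)"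
  unfolding first_order_def mult.assoc by (auto intro!: lipschitz_op_scale coef_cos coef_sin)

lemmas basics = first_order_bounded_op[OF bounded_op_C(1)] first_order_bounded_op[OF bounded_op_C(2)] first_order_bounded_op[OF bounded_op_C(3)]
  first_order_of_ser[OF lipschitz_op_sers(1)] first_order_of_ser[OF lipschitz_op_sers(2)] first_order_of_ser[OF lipschitz_op_sers(3)]

lemma first_order_lead: "first_order (cl1 \<Lambda> \<phi>0) lead"
  unfolding lead_def[abs_def] cl1_def
  by (intro first_order_sub first_order_add first_order_cos first_order_sin first_order_cmult basics)

lemma first_order_quad: "first_order (cq \<Lambda> a \<phi>0) quad"
  unfolding quad_def[abs_def] cq_def
  by (intro first_order_add first_order_cmult second_order_first_order[OF second_order_conv] basics)

lemma second_order_high: "second_order (ch1 \<Lambda> a b \<phi>0) high"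
  unfolding high_def[abs_def] ch1_def
  by (intro second_order_sub second_order_add second_order_cmult second_order_conv first_order_quad first_order_add basics second_order_JK second_order_first_order[OF second_order_conv])

lemma first_order_defect: "first_order (\<Lambda> + (ch1 \<Lambda> a b \<phi>0 + cl1 \<Lambda> \<phi>0)) defect"
  unfolding defect_def[abs_def]
  by (intro first_order_sub first_order_add first_order_id second_order_first_order[OF second_order_high] first_order_lead)

lemma first_order_twist: "first_order (3 * \<Lambda> + 3 * \<Lambda>) twist"
  unfolding twist_def[abs_def]
  by (intro first_order_sub first_order_cos first_order_sin basics)

lemma lipschitz_op_lead: "lipschitz_op (\<rho> * \<epsilon>) ((norm \<phi>0 + 6) * \<kappa> * \<epsilon>) ((norm \<phi>0 + 6) * (C * \<kappa>) * \<epsilon>) lead"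
proof -
  have "lipschitz_op (\<rho> * \<epsilon>) (3 * (\<epsilon> * \<kappa>) + 3 * (\<epsilon> * \<kappa>) + norm \<phi>0 * (\<epsilon> * \<kappa>))
      (3 * (C * (\<epsilon> * \<kappa>)) + 3 * (C * (\<epsilon> * \<kappa>)) + norm \<phi>0 * (C * (\<epsilon> * \<kappa>))) lead"
    unfolding lead_def[abs_def]
    by (intro lipschitz_op_sub lipschitz_op_add lipschitz_op_cmult lipschitz_op_scale[OF coef_cos] lipschitz_op_scale[OF coef_sin] lipschitz_op_sers) auto
  then show ?thesis by (rule lipschitz_op_mono) (simp_all add: algebra_simps)
qed

text \<open>\<open>lead\<close> has values of first order, but its Lipschitz constant carries an
  \<epsilon> already, because the series start in degree 3 and are divided by x^2 only. Everything
  else is of second order.\<close>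

lemma lipschitz_op_N_op: "lipschitz_op (\<rho> * \<epsilon>) (\<rho> * \<epsilon>) (1/2) N_op"
proof -
  have h: "second_order (ch2 \<Lambda> a b \<phi>0) (\<lambda>f w \<theta>. high f w \<theta>
     - 1 / \<phi>0 * (conv (U_op f) (defect f) w \<theta> + conv (J (twist f)) (S_op f) w \<theta>))"
    unfolding ch2_def
    by (intro second_order_sub second_order_add second_order_cmult second_order_conv second_order_high first_order_defect basics first_order_J first_order_twist)
  show ?thesis unfolding N_op_def[abs_def]
  proof (rule lipschitz_op_mono[OF lipschitz_op_add[OF lipschitz_op_lead h[unfolded second_order_def]]])
    have "(norm \<phi>0 + 6) * \<kappa> * \<epsilon> + ch2 \<Lambda> a b \<phi>0 * \<epsilon> * \<epsilon> \<le> ((norm \<phi>0 + 6) * \<kappa> + 1) * \<epsilon>"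
      using mult_right_mono[OF small(1), of \<epsilon>] eps_pos by (simp add: distrib_right)
    also have "\<dots> \<le> \<rho> * \<epsilon>" using rho eps_pos by (intro mult_right_mono) auto
    finally show "(norm \<phi>0 + 6) * \<kappa> * \<epsilon> + ch2 \<Lambda> a b \<phi>0 * \<epsilon> * \<epsilon> \<le> \<rho> * \<epsilon>" .
    show "(norm \<phi>0 + 6) * (C * \<kappa>) * \<epsilon> + ch2 \<Lambda> a b \<phi>0 * \<epsilon> \<le> 1/2"
      using small(2) by (simp add: distrib_right)
  qed
qed

lemma solution_exists:
  obtains f where "elem (\<rho> * \<epsilon>) f"
    "\<And>w \<theta>. w \<in> \<Omega> \<Longrightarrow> \<theta> \<in> strip 1 \<Longrightarrow>
      \<phi>0 * defect f w \<theta> + conv (U_op f) (defect f) w \<theta> + conv (J (twist f)) (S_op f) w \<theta> = 0"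
proof -
  have "0 \<le> \<rho> * \<epsilon>" using rho_pos eps_pos by simp
  then obtain f where f: "elem (\<rho> * \<epsilon>) f" "\<And>w \<theta>. w \<in> \<Omega> \<Longrightarrow> \<theta> \<in> strip 1 \<Longrightarrow> N_op f w \<theta> = f w \<theta>"
    using lipschitz_op_fixed_point[OF lipschitz_op_N_op] by blast
  have "\<phi>0 * defect f w \<theta> + conv (U_op f) (defect f) w \<theta> + conv (J (twist f)) (S_op f) w \<theta> = 0"
    if *: "w \<in> \<Omega>" "\<theta> \<in> strip 1" for w \<theta>
  proof -
    have "defect f w \<theta> = - (1 / \<phi>0 * (conv (U_op f) (defect f) w \<theta> + conv (J (twist f)) (S_op f) w \<theta>))"
      (is "_ = - ?q")
    proof -
      have "lead f w \<theta> + (high f w \<theta> - ?q) = f w \<theta>" using f(2)[OF *] by (simp only: N_op_def)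
      moreover have "defect f w \<theta> = f w \<theta> - (high f w \<theta> + lead f w \<theta>)" by (simp only: defect_def)
      ultimately show ?thesis by (simp add: algebra_simps)
    qed
    then have "\<phi>0 * defect f w \<theta> = - (conv (U_op f) (defect f) w \<theta> + conv (J (twist f)) (S_op f) w \<theta>)"
      using phi0 by simp
    then show ?thesis by simp
  qed
  then show ?thesis using that f(1) by blast
qed

end

section \<open>The Laplace transform\<close>

lemma set_integrable_exp_ray:
  fixes c :: real assumes c: "0 < c"
  shows "set_integrable lborel {0<..} (\<lambda>t. exp (- (c * t)))"
    and "(LBINT t:{0<..}. exp (- (c * t))) = 1 / c"
proof -
  have e: "einterval 0 \<infinity> = {0<..}" by (auto simp: einterval_def)
  have A: "(((\<lambda>t. - exp (- (c * t)) / c) \<circ> real_of_ereal) \<longlongrightarrow> - 1 / c) (at_right 0)"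
  proof -
    have "((\<lambda>t. - exp (- (c * t)) / c) \<longlongrightarrow> - exp (- (c * 0)) / c) (at_right 0)"
      using c by (intro tendsto_intros) auto
    then show ?thesis unfolding zero_ereal_def ereal_tendsto_simps by simp
  qed
  have B: "(((\<lambda>t. - exp (- (c * t)) / c) \<circ> real_of_ereal) \<longlongrightarrow> 0) (at_left \<infinity>)"
  proof -
    have "((\<lambda>t. - exp (- (c * t)) / c) \<longlongrightarrow> 0) at_top"
    proof -
      have "filterlim (\<lambda>t. c * t) at_top at_top"
        by (rule filterlim_tendsto_pos_mult_at_top[OF tendsto_const c filterlim_ident])
      then have "((\<lambda>t. exp (- (c * t))) \<longlongrightarrow> 0) at_top"
        by (intro filterlim_compose[OF exp_at_bot]) (simp add: filterlim_uminus_at_bot)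
      then have "((\<lambda>t. - exp (- (c * t)) / c) \<longlongrightarrow> - 0 / c) at_top"
        using c by (intro tendsto_intros) auto
      then show ?thesis by simp
    qed
    then show ?thesis unfolding ereal_tendsto_simps .
  qed
  note FTC = interval_integral_FTC_nonneg[where F="\<lambda>t. - exp (- (c * t)) / c" and f="\<lambda>t. exp (- (c * t))" and a=0 and b=\<infinity>, OF _ _ _ _ A B]
  have D: "((\<lambda>t. - exp (- (c * t)) / c) has_real_derivative exp (- (c * t))) (at t)" for t
    using c by (auto intro!: derivative_eq_intros)
  show "set_integrable lborel {0<..} (\<lambda>t. exp (- (c * t)))"
    unfolding e[symmetric] by (rule FTC(1)) (rule D | simp)+
  have "(LBINT t=0..\<infinity>. exp (- (c * t))) = 0 - - 1 / c"
    by (rule FTC(2)) (rule D | simp)+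
  then show "(LBINT t:{0<..}. exp (- (c * t))) = 1 / c"
    by (simp add: interval_lebesgue_integral_def e)
qed

lemma convolution_integral:
  fixes F G :: "real \<Rightarrow> complex"
  assumes F: "integrable lborel F" and G: "integrable lborel G"
  shows "(\<integral>t. (\<integral>s. F s * G (t - s) \<partial>lborel) \<partial>lborel) = (\<integral>s. F s \<partial>lborel) * (\<integral>t. G t \<partial>lborel)"
proof -
  have [measurable]: "F \<in> borel_measurable borel" "G \<in> borel_measurable borel"
    using F G by auto
  have shift: "(\<integral>t. f (t - s) \<partial>lborel) = (\<integral>t. f t \<partial>lborel)" for f :: "real \<Rightarrow> 'a::{banach, second_countable_topology}" and s
    using lborel_integral_real_affine[of 1 f "-s"] by simp
  have G': "integrable lborel (\<lambda>t. G (t - s))" for s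
    using lborel_integrable_real_affine[OF G, of 1 "-s"] by simp
  have "integrable (lborel \<Otimes>\<^sub>M lborel) (\<lambda>(s, t). F s * G (t - s))"
  proof (rule lborel_pair.Fubini_integrable)
    show "(\<lambda>(s, t). F s * G (t - s)) \<in> borel_measurable (lborel \<Otimes>\<^sub>M lborel)" by measurable
    have "integrable lborel (\<lambda>s. norm (F s) * (\<integral>t. norm (G t) \<partial>lborel))"
      using F by (intro integrable_mult_left integrable_norm)
    then show "integrable lborel (\<lambda>s. \<integral>t. norm (case (s, t) of (s, t) \<Rightarrow> F s * G (t - s)) \<partial>lborel)"
      using shift[of "\<lambda>t. norm (G t)"] by (simp add: norm_mult)
    show "AE s in lborel. integrable lborel (\<lambda>t. case (s, t) of (s, t) \<Rightarrow> F s * G (t - s))"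
      using G' by simp
  qed
  from lborel_pair.Fubini_integral[OF this]
  show ?thesis by (simp add: shift)
qed

text \<open>\<open>cis \<psi>\<close> combines the two end directions with the nonnegative
  coefficients sin(\<psi>2 - \<psi>) / sin(\<psi>2 - \<psi>1) and sin(\<psi> - \<psi>1) /
  sin(\<psi>2 - \<psi>1), whose sum is at least 1. So decay on two rays implies decay on the arc
  between them.\<close>

lemma Re_cis_between:
  assumes "\<psi>1 \<le> \<psi>" "\<psi> \<le> \<psi>2" "\<psi>2 - \<psi>1 < pi" "0 \<le> m" "m \<le> Re (cis \<psi>1 * z)" "m \<le> Re (cis \<psi>2 * z)"
  shows "m \<le> Re (cis \<psi> * z)"
proof (cases "\<psi>1 = \<psi>2")
  case True
  then show ?thesis using assms by simp
next
  case False
  let ?A = "\<psi>2 - \<psi>" and ?B = "\<psi> - \<psi>1"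
  have s: "sin ?A \<ge> 0" "sin ?B \<ge> 0" "sin (\<psi>2 - \<psi>1) > 0"
    using assms False by (auto intro!: sin_ge_zero sin_gt_zero)
  have sum: "sin (\<psi>2 - \<psi>1) \<le> sin ?A + sin ?B"
  proof -
    have "sin (\<psi>2 - \<psi>1) = sin ?A * cos ?B + cos ?A * sin ?B" by (simp flip: sin_add)
    also have "\<dots> \<le> sin ?A * 1 + 1 * sin ?B" using s by (intro add_mono mult_mono mult_left_mono mult_right_mono) auto
    finally show ?thesis by simp
  qed
  have c: "sin (\<psi>2 - \<psi>1) * cos \<psi> = sin ?A * cos \<psi>1 + sin ?B * cos \<psi>2"
    "sin (\<psi>2 - \<psi>1) * sin \<psi> = sin ?A * sin \<psi>1 + sin ?B * sin \<psi>2"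
    by (simp_all add: sin_diff algebra_simps)
  have "sin (\<psi>2 - \<psi>1) * Re (cis \<psi> * z) = sin ?A * Re (cis \<psi>1 * z) + sin ?B * Re (cis \<psi>2 * z)"
  proof -
    have "sin (\<psi>2 - \<psi>1) * Re (cis \<psi> * z) = (sin (\<psi>2 - \<psi>1) * cos \<psi>) * Re z - (sin (\<psi>2 - \<psi>1) * sin \<psi>) * Im z"
      by (simp add: algebra_simps)
    then show ?thesis unfolding c by (simp add: algebra_simps)
  qed
  also have "\<dots> \<ge> sin ?A * m + sin ?B * m" using s assms by (intro add_mono mult_left_mono) auto
  also have "sin ?A * m + sin ?B * m \<ge> sin (\<psi>2 - \<psi>1) * m"
    using mult_right_mono[OF sum \<open>0 \<le> m\<close>] by (simp add: distrib_right)
  finally have "sin (\<psi>2 - \<psi>1) * m \<le> sin (\<psi>2 - \<psi>1) * Re (cis \<psi> * z)" by simp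
  then show ?thesis using s(3) by simp
qed

locale borel_laplace = borel_domain +
  fixes \<eta> M\<mu> :: real
  assumes eta: "0 < \<eta>" and mu_exp: "\<And>t. 0 \<le> t \<Longrightarrow> \<mu> t \<le> M\<mu> * exp (\<eta> * t)"
begin

definition direction :: "real \<Rightarrow> bool" where
  "direction \<psi> \<longleftrightarrow> (\<forall>t>0. of_real t * cis \<psi> \<in> \<Omega>)"

definition laplace :: "real \<Rightarrow> borel_fun \<Rightarrow> borel_fun" where
  "laplace \<psi> f x \<theta> = laplace_ray \<psi> (\<lambda>w. f w \<theta>) x"

text \<open>With the indicator included, the Laplace integral runs over the whole real line, where
  \<open>convolution_integral\<close> applies.\<close>

definition laplace_integrand :: "real \<Rightarrow> borel_fun \<Rightarrow> complex \<Rightarrow> complex \<Rightarrow> real \<Rightarrow> complex" where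
  "laplace_integrand \<psi> f x \<theta> t = indicator {0<..} t *\<^sub>R (cis \<psi> * f (of_real t * cis \<psi>) \<theta> * exp (- (of_real t * cis \<psi> / x)))"

lemma laplace_eq: "laplace \<psi> f x \<theta> = (\<integral>t. laplace_integrand \<psi> f x \<theta> t \<partial>lborel)"
  by (simp add: laplace_def laplace_ray_def set_lebesgue_integral_def laplace_integrand_def)

lemma Mmu: "0 \<le> M\<mu>"
  using mu_exp[of 0] mu_pos[of 0] by simp

lemma laplace_integrand_measurable:
  assumes f: "separately_hol f" and \<psi>: "direction \<psi>" and \<theta>: "\<theta> \<in> strip 1"
  shows "laplace_integrand \<psi> f x \<theta> \<in> borel_measurable lborel"
proof -
  have "continuous_on {0<..} (\<lambda>t. f (of_real t * cis \<psi>) \<theta>)"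
    by (rule continuous_on_compose2[OF holomorphic_on_imp_continuous_on[OF separately_holD(1)[OF f \<theta>]]])
      (use \<psi> in \<open>auto intro!: continuous_intros simp: direction_def\<close>)
  then have "continuous_on {0<..} (\<lambda>t. cis \<psi> * f (of_real t * cis \<psi>) \<theta> * exp (- (of_real t * cis \<psi> / x)))"
    unfolding divide_inverse by (intro continuous_intros)
  from borel_measurable_continuous_on_indicator[OF _ this] show ?thesis 
    by (simp add: laplace_integrand_def[abs_def])
qed

lemma laplace_integrand_bound:
  assumes f: "elem R f" and \<psi>: "direction \<psi>" and \<theta>: "\<theta> \<in> strip 1" and m: "m \<le> Re (cis \<psi> / x)"
  shows "norm (laplace_integrand \<psi> f x \<theta> t) \<le> R * M\<mu> * (indicator {0<..} t *\<^sub>R exp (- ((m - \<eta>) * t)))"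
proof (cases "0 < t")
  case True
  have "norm (f (of_real t * cis \<psi>) \<theta>) \<le> R * \<mu> t"
    using elemD[OF f _ \<theta>, of "of_real t * cis \<psi>"] \<psi> True by (simp add: direction_def norm_mult)
  also have "\<dots> \<le> R * (M\<mu> * exp (\<eta> * t))" using True by (intro mult_left_mono mu_exp elem_nonneg[OF f]) auto
  finally have 1: "norm (f (of_real t * cis \<psi>) \<theta>) \<le> R * M\<mu> * exp (\<eta> * t)" by simp
  have "m * t \<le> Re (cis \<psi> / x) * t" using m True by simp
  moreover have "Re (of_real t * cis \<psi> / x) = t * Re (cis \<psi> / x)"
  proof -
    have "of_real t * cis \<psi> / x = t *\<^sub>R (cis \<psi> / x)" by (simp add: scaleR_conv_of_real)
    then show ?thesis by (simp only: scaleR_complex.sel)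
  qed
  ultimately have "norm (exp (- (of_real t * cis \<psi> / x))) \<le> exp (- (m * t))"
    by (simp add: mult.commute)
  then have "norm (f (of_real t * cis \<psi>) \<theta>) * norm (exp (- (of_real t * cis \<psi> / x))) \<le> R * M\<mu> * exp (\<eta> * t) * exp (- (m * t))"
    using 1 elem_nonneg[OF f] Mmu by (intro mult_mono) auto
  then show ?thesis using True by (simp add: laplace_integrand_def norm_mult algebra_simps flip: exp_add)
qed (simp add: laplace_integrand_def)

lemma dom_integrable:
  assumes "\<eta> < m" shows "integrable lborel (\<lambda>t. indicator {0<..} t *\<^sub>R exp (- ((m - \<eta>) * t)) :: real)"
    and "(\<integral>t. indicator {0<..} t *\<^sub>R exp (- ((m - \<eta>) * t)) \<partial>lborel) = 1 / (m - \<eta>)"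
  using set_integrable_exp_ray[of "m - \<eta>"] assms
  by (simp_all add: set_integrable_def set_lebesgue_integral_def)

lemma laplace_integrand_integrable:
  assumes f: "elem R f" and \<psi>: "direction \<psi>" and \<theta>: "\<theta> \<in> strip 1" and m: "\<eta> < Re (cis \<psi> / x)"
  shows "integrable lborel (laplace_integrand \<psi> f x \<theta>)"
proof (rule Bochner_Integration.integrable_bound)
  show "integrable lborel (\<lambda>t. R * M\<mu> * (indicator {0<..} t *\<^sub>R exp (- ((Re (cis \<psi> / x) - \<eta>) * t))))"
    using dom_integrable(1)[OF m] by simp
  show "AE t in lborel. norm (laplace_integrand \<psi> f x \<theta> t) \<le> norm (R * M\<mu> * (indicator {0<..} t *\<^sub>R exp (- ((Re (cis \<psi> / x) - \<eta>) * t))))"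
    using laplace_integrand_bound[OF f \<psi> \<theta> order_refl, of x] by (intro AE_I2) (auto intro: order_trans[OF _ abs_ge_self])
qed (rule laplace_integrand_measurable[OF elem_separately_hol[OF f] \<psi> \<theta>])

lemma laplace_bound:
  assumes f: "elem R f" and \<psi>: "direction \<psi>" and \<theta>: "\<theta> \<in> strip 1" and m: "\<eta> < m" "m \<le> Re (cis \<psi> / x)"
  shows "norm (laplace \<psi> f x \<theta>) \<le> R * M\<mu> / (m - \<eta>)"
proof -
  have "norm (laplace \<psi> f x \<theta>) \<le> (\<integral>t. norm (laplace_integrand \<psi> f x \<theta> t) \<partial>lborel)" unfolding laplace_eq by simp
  also have "\<dots> \<le> (\<integral>t. R * M\<mu> * (indicator {0<..} t *\<^sub>R exp (- ((m - \<eta>) * t))) \<partial>lborel)"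
    using laplace_integrand_integrable[OF f \<psi> \<theta>, of x] m laplace_integrand_bound[OF f \<psi> \<theta> m(2)] dom_integrable(1)[OF m(1)]
    by (intro integral_mono) auto
  also have "\<dots> = R * M\<mu> / (m - \<eta>)" using dom_integrable[OF m(1)] by simp
  finally show ?thesis .
qed

lemma laplace_cong:
  assumes "direction \<psi>" "\<And>w. w \<in> \<Omega> \<Longrightarrow> f w \<theta> = g w \<theta>" shows "laplace \<psi> f x \<theta> = laplace \<psi> g x \<theta>"
proof -
  have "laplace_integrand \<psi> f x \<theta> = laplace_integrand \<psi> g x \<theta>"
    using assms by (auto simp: laplace_integrand_def direction_def fun_eq_iff indicator_def)
  then show ?thesis by (simp add: laplace_eq)
qed

lemma laplace_scale: "laplace \<psi> (\<lambda>w \<theta>. c \<theta> * f w \<theta>) x \<theta> = c \<theta> * laplace \<psi> f x \<theta>"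
proof -
  have "laplace_integrand \<psi> (\<lambda>w \<theta>. c \<theta> * f w \<theta>) x \<theta> = (\<lambda>t. c \<theta> * laplace_integrand \<psi> f x \<theta> t)"
    by (auto simp: laplace_integrand_def fun_eq_iff)
  then show ?thesis by (simp add: laplace_eq)
qed

context
  fixes \<psi> :: real and x \<theta> :: complex
  assumes \<psi>: "direction \<psi>" and \<theta>: "\<theta> \<in> strip 1" and conv_x: "\<eta> < Re (cis \<psi> / x)"
begin

lemma x_nz: "x \<noteq> 0" using conv_x eta by auto

lemma laplace_add:
  assumes f: "elem R f" and g: "elem S g"
  shows "laplace \<psi> (\<lambda>w \<theta>. f w \<theta> + g w \<theta>) x \<theta> = laplace \<psi> f x \<theta> + laplace \<psi> g x \<theta>"
proof -
  have "laplace_integrand \<psi> (\<lambda>w \<theta>. f w \<theta> + g w \<theta>) x \<theta> = (\<lambda>t. laplace_integrand \<psi> f x \<theta> t + laplace_integrand \<psi> g x \<theta> t)"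
    by (auto simp: laplace_integrand_def fun_eq_iff algebra_simps)
  then show ?thesis 
    using laplace_integrand_integrable[OF f \<psi> \<theta> conv_x] laplace_integrand_integrable[OF g \<psi> \<theta> conv_x] by (simp add: laplace_eq)
qed

lemma laplace_diff:
  assumes f: "elem R f" and g: "elem S g"
  shows "laplace \<psi> (\<lambda>w \<theta>. f w \<theta> - g w \<theta>) x \<theta> = laplace \<psi> f x \<theta> - laplace \<psi> g x \<theta>"
proof -
  have "laplace_integrand \<psi> (\<lambda>w \<theta>. f w \<theta> - g w \<theta>) x \<theta> = (\<lambda>t. laplace_integrand \<psi> f x \<theta> t - laplace_integrand \<psi> g x \<theta> t)"
    by (auto simp: laplace_integrand_def fun_eq_iff algebra_simps)
  then show ?thesis 
    using laplace_integrand_integrable[OF f \<psi> \<theta> conv_x] laplace_integrand_integrable[OF g \<psi> \<theta> conv_x] by (simp add: laplace_eq)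
qed

text \<open>The integrand of \<open>conv f g\<close> is the convolution on the line of the
  integrands of \<open>f\<close> and \<open>g\<close>, since the exponential is multiplicative; the
  claim is then \<open>convolution_integral\<close>.\<close>

lemma laplace_conv:
  assumes f: "elem R f" and g: "elem S g"
  shows "laplace \<psi> (conv f g) x \<theta> = laplace \<psi> f x \<theta> * laplace \<psi> g x \<theta>"
proof -
  let ?F = "laplace_integrand \<psi> f x \<theta>" and ?G = "laplace_integrand \<psi> g x \<theta>" and ?c = "cis \<psi>"
  have "(\<integral>s. ?F s * ?G (t - s) \<partial>lborel) = laplace_integrand \<psi> (conv f g) x \<theta> t" for t
  proof (cases "0 < t")
    case False
    then have "(\<lambda>s. ?F s * ?G (t - s)) = (\<lambda>s. 0)" by (auto simp: laplace_integrand_def indicator_def)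
    moreover have "laplace_integrand \<psi> (conv f g) x \<theta> t = 0" using False by (simp add: laplace_integrand_def)
    ultimately show ?thesis by (simp only: Bochner_Integration.integral_zero)
  next
    case t: True
    let ?e = "exp (- (of_real t * ?c / x))"
    \<comment> \<open>Substituting s = t \<tau> produces the normalized integral in
      \<open>conv\<close>; the indicators restrict \<tau> to the open unit interval.\<close>
    have "(\<integral>s. ?F s * ?G (t - s) \<partial>lborel) = t *\<^sub>R (\<integral>\<tau>. ?F (t * \<tau>) * ?G (t - t * \<tau>) \<partial>lborel)"
      using lborel_integral_real_affine[of t "\<lambda>s. ?F s * ?G (t - s)" 0] t by simp
    also have "(\<lambda>\<tau>. ?F (t * \<tau>) * ?G (t - t * \<tau>)) = (\<lambda>\<tau>. indicator {0<..<1} \<tau> *\<^sub>R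
        (?c * ?c * ?e * (f (of_real \<tau> * (of_real t * ?c)) \<theta> * g (of_real (1 - \<tau>) * (of_real t * ?c)) \<theta>)))"
    proof
      fix \<tau> :: real
      show "?F (t * \<tau>) * ?G (t - t * \<tau>) = indicator {0<..<1} \<tau> *\<^sub>R
        (?c * ?c * ?e * (f (of_real \<tau> * (of_real t * ?c)) \<theta> * g (of_real (1 - \<tau>) * (of_real t * ?c)) \<theta>))"
      proof (cases "0 < \<tau> \<and> \<tau> < 1")
        case True
        then have i: "0 < t * \<tau>" "0 < t - t * \<tau>" using t by auto
        have e: "exp (- (of_real (t * \<tau>) * ?c / x)) * exp (- (of_real (t - t * \<tau>) * ?c / x)) = ?e"
          by (simp add: of_real_diff algebra_simps diff_divide_distrib flip: exp_add)
        have a: "of_real (t * \<tau>) * ?c = of_real \<tau> * (of_real t * ?c)"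
          "of_real (t - t * \<tau>) * ?c = of_real (1 - \<tau>) * (of_real t * ?c)"
          by (simp_all add: of_real_diff algebra_simps)
        have "?F (t * \<tau>) * ?G (t - t * \<tau>) = ?c * ?c * (exp (- (of_real (t * \<tau>) * ?c / x)) * exp (- (of_real (t - t * \<tau>) * ?c / x)))
          * (f (of_real (t * \<tau>) * ?c) \<theta> * g (of_real (t - t * \<tau>) * ?c) \<theta>)"
          using i by (simp only: laplace_integrand_def indicator_def greaterThan_iff if_True of_bool_eq scaleR_one ac_simps)
        then show ?thesis using True unfolding e unfolding a by simp
      next
        case False
        then have "\<not> 0 < t * \<tau> \<or> \<not> 0 < t - t * \<tau>"
          using t mult_left_mono[of 1 \<tau> t] mult_nonneg_nonpos[of t \<tau>] by linarith
        then show ?thesis using False by (auto simp: laplace_integrand_def indicator_def)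
      qed
    qed
    also have "(\<integral>\<tau>. indicator {0<..<1} \<tau> *\<^sub>R
        (?c * ?c * ?e * (f (of_real \<tau> * (of_real t * ?c)) \<theta> * g (of_real (1 - \<tau>) * (of_real t * ?c)) \<theta>)) \<partial>lborel)
      = (\<integral>\<tau>. ?c * ?c * ?e * (f (of_real \<tau> * (of_real t * ?c)) \<theta> * g (of_real (1 - \<tau>) * (of_real t * ?c)) \<theta>) \<partial>U01)"
      unfolding U01_def by (rule integral_restrict_space[symmetric]) simp
    also have "\<dots> = ?c * ?c * ?e * (\<integral>\<tau>. f (of_real \<tau> * (of_real t * ?c)) \<theta> * g (of_real (1 - \<tau>) * (of_real t * ?c)) \<theta> \<partial>U01)"
      by (rule integral_mult_right_zero)
    finally show ?thesis using t by (simp add: laplace_integrand_def conv_def scaleR_conv_of_real)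
  qed
  then have "laplace \<psi> (conv f g) x \<theta> = (\<integral>t. (\<integral>s. ?F s * ?G (t - s) \<partial>lborel) \<partial>lborel)"
    by (simp add: laplace_eq)
  also have "\<dots> = laplace \<psi> f x \<theta> * laplace \<psi> g x \<theta>"
    unfolding laplace_eq
    by (rule convolution_integral[OF laplace_integrand_integrable[OF f \<psi> \<theta> conv_x] laplace_integrand_integrable[OF g \<psi> \<theta> conv_x]])
  finally show ?thesis .
qed

text \<open>Truncated integrals are increments of a primitive of the integrand. This form makes it
  possible to evaluate the transform of \<open>1\<close> and to compare different rays.\<close>

lemma laplace_limit:
  assumes f: "elem R f" and P: "\<And>w. w \<in> \<Omega> \<Longrightarrow> (P has_field_derivative f w \<theta> * exp (- (w / x))) (at w)"
  shows "(\<lambda>n. P (of_real (real n) * cis \<psi>) - P 0) \<longlonglongrightarrow> laplace \<psi> f x \<theta>"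
proof -
  let ?h = "laplace_integrand \<psi> f x \<theta>"
  have ray: "of_real t * cis \<psi> \<in> \<Omega>" if "0 \<le> t" for t
    using \<psi> zero_\<Omega> that by (cases "t = 0") (auto simp: direction_def)
  have eq: "(\<integral>t. indicator {0<..<real n} t *\<^sub>R ?h t \<partial>lborel) = P (of_real (real n) * cis \<psi>) - P 0" for n
  proof -
    have si: "set_integrable lborel {0<..<real n} ?h"
      unfolding set_integrable_def
      by (rule integrable_mult_indicator[OF _ laplace_integrand_integrable[OF f \<psi> \<theta> conv_x]]) simp
    have "(\<integral>t. indicator {0<..<real n} t *\<^sub>R ?h t \<partial>lborel) = (LBINT t:{0<..<real n}. ?h t)"
      by (simp add: set_lebesgue_integral_def)
    also have "\<dots> = integral {0<..<real n} ?h" by (rule set_borel_integral_eq_integral(2)[OF si])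
    also have "\<dots> = integral {0..real n} ?h" by (simp add: integral_open_interval_real)
    also have "\<dots> = P (of_real (real n) * cis \<psi>) - P (of_real 0 * cis \<psi>)"
    proof (rule integral_unique, rule fundamental_theorem_of_calculus_interior)
      have v: "((\<lambda>t. of_real t * cis \<psi>) has_vector_derivative cis \<psi>) (at t)" for t
        by (auto intro!: derivative_eq_intros simp: has_vector_derivative_def scaleR_conv_of_real)
      have d: "((\<lambda>t. P (of_real t * cis \<psi>)) has_vector_derivative
          cis \<psi> * (f (of_real t * cis \<psi>) \<theta> * exp (- (of_real t * cis \<psi> / x)))) (at t)" if "0 \<le> t" for t
        using field_vector_diff_chain_at[OF v P[OF ray[OF that]]] by (simp add: o_def)
      then show "((\<lambda>t. P (of_real t * cis \<psi>)) has_vector_derivative ?h t) (at t)" if "t \<in> {0<..<real n}" for t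
        using that d[of t] by (simp add: laplace_integrand_def mult.assoc)
      show "continuous_on {0..real n} (\<lambda>t. P (of_real t * cis \<psi>))"
        by (auto intro!: continuous_at_imp_continuous_on has_vector_derivative_continuous[OF d])
    qed simp
    finally show ?thesis by simp
  qed
  have "(\<lambda>n. \<integral>t. indicator {0<..<real n} t *\<^sub>R ?h t \<partial>lborel) \<longlonglongrightarrow> (\<integral>t. ?h t \<partial>lborel)"
  proof (rule integral_dominated_convergence[where w="\<lambda>t. norm (?h t)"])
    show "integrable lborel (\<lambda>t. norm (?h t))"
      using laplace_integrand_integrable[OF f \<psi> \<theta> conv_x] by simp
    have [measurable]: "?h \<in> borel_measurable lborel" by (rule laplace_integrand_measurable[OF elem_separately_hol[OF f] \<psi> \<theta>])
    show "?h \<in> borel_measurable lborel" by measurable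
    show "(\<lambda>t. indicator {0<..<real n} t *\<^sub>R ?h t) \<in> borel_measurable lborel" for n by measurable
    show "AE t in lborel. (\<lambda>n. indicator {0<..<real n} t *\<^sub>R ?h t) \<longlonglongrightarrow> ?h t"
    proof (rule AE_I2)
      fix t :: real
      obtain N where N: "t < real N" using reals_Archimedean2 by blast
      have "indicator {0<..<real n} t *\<^sub>R ?h t = ?h t" if "n \<ge> N" for n
        using that N by (auto simp: laplace_integrand_def indicator_def)
      then show "(\<lambda>n. indicator {0<..<real n} t *\<^sub>R ?h t) \<longlonglongrightarrow> ?h t"
        by (intro tendsto_eventually eventually_sequentiallyI) auto
    qed
  qed (auto simp: indicator_def)
  then show ?thesis unfolding eq laplace_eq .
qed

lemma laplace_one: "laplace \<psi> (\<lambda>w \<theta>. 1) x \<theta> = x"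
proof -
  have "(\<lambda>n. - x * exp (- (of_real (real n) * cis \<psi> / x)) - - x * exp (- (0 / x))) \<longlonglongrightarrow> laplace \<psi> (\<lambda>w \<theta>. 1) x \<theta>"
    using x_nz
    by (intro laplace_limit[OF elem_one, of "\<lambda>w. - x * exp (- (w / x))"]) (auto intro!: derivative_eq_intros)
  moreover have "(\<lambda>n. - x * exp (- (of_real (real n) * cis \<psi> / x)) - - x * exp (- (0 / x))) \<longlonglongrightarrow> - x * 0 - - x * exp (- (0 / x))"
  proof (intro tendsto_intros)
    have "(\<lambda>n. exp (- (of_real (real n) * cis \<psi> / x))) = (\<lambda>n. exp (- (cis \<psi> / x)) ^ n)"
      by (simp add: fun_eq_iff flip: exp_of_nat_mult)
    moreover have "norm (exp (- (cis \<psi> / x))) < 1" using conv_x eta by simp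
    ultimately show "(\<lambda>n. exp (- (of_real (real n) * cis \<psi> / x))) \<longlonglongrightarrow> 0"
      by (simp add: LIMSEQ_power_zero)
  qed
  ultimately show ?thesis using LIMSEQ_unique by fastforce
qed

lemma laplace_J: "elem R f \<Longrightarrow> laplace \<psi> (J f) x \<theta> = x * laplace \<psi> f x \<theta>"
  unfolding J_def by (simp add: laplace_conv[OF elem_one] laplace_one)

lemma laplace_sum:
  assumes "\<And>n::nat. elem (B n) (f n)"
  shows "laplace \<psi> (\<lambda>w \<theta>. \<Sum>n<N. f n w \<theta>) x \<theta> = (\<Sum>n<N. laplace \<psi> (f n) x \<theta>) \<and> elem (\<Sum>n<N. B n) (\<lambda>w \<theta>. \<Sum>n<N. f n w \<theta>)"
proof (induction N)
  case 0
  show ?case using elem_zero by (simp add: laplace_eq laplace_integrand_def)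
next
  case (Suc N)
  then show ?case using assms laplace_add[OF conjunct2[OF Suc] assms] elem_add by simp
qed

text \<open>The tail of the series is an element of radius \<Sum> B (n + N), so
  \<open>laplace_bound\<close> makes its transform tend to 0.\<close>

lemma laplace_suminf:
  assumes f: "\<And>n. elem (B n) (f n)" and B: "summable B"
  shows "(\<lambda>n. laplace \<psi> (f n) x \<theta>) sums laplace \<psi> (\<lambda>w \<theta>. \<Sum>n. f n w \<theta>) x \<theta>"
proof -
  let ?L = "laplace \<psi> (\<lambda>w \<theta>. \<Sum>n. f n w \<theta>) x \<theta>" and ?c = "M\<mu> / (Re (cis \<psi> / x) - \<eta>)"
  have "norm (?L - (\<Sum>n<N. laplace \<psi> (f n) x \<theta>)) \<le> (\<Sum>n. B (n + N)) * ?c" for N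
  proof -
    note t = elem_suminf(1)[where f="\<lambda>n. f (n + N)" and R="\<lambda>n. B (n + N)", OF f summable_ignore_initial_segment[OF B]]
    note s = laplace_sum[where N=N, OF f]
    have "?L - (\<Sum>n<N. laplace \<psi> (f n) x \<theta>) = laplace \<psi> (\<lambda>w \<theta>. (\<Sum>n. f n w \<theta>) - (\<Sum>n<N. f n w \<theta>)) x \<theta>"
      using laplace_diff[OF elem_suminf(1)[OF f B] conjunct2[OF s]] s by simp
    also have "\<dots> = laplace \<psi> (\<lambda>w \<theta>. \<Sum>n. f (n + N) w \<theta>) x \<theta>"
      by (rule laplace_cong[OF \<psi>]) (simp add: suminf_minus_initial_segment[OF elem_suminf(2)[OF f B _ \<theta>]])
    finally show ?thesis using laplace_bound[OF t \<psi> \<theta> conv_x order_refl] by simp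
  qed
  moreover have "(\<lambda>N. (\<Sum>n. B (n + N)) * ?c) \<longlonglongrightarrow> 0"
    using suminf_exist_split2[OF B] by (rule tendsto_mult_left_zero) 
  ultimately have "(\<lambda>N. ?L - (\<Sum>n<N. laplace \<psi> (f n) x \<theta>)) \<longlonglongrightarrow> 0"
    by (rule Lim_null_comparison[OF always_eventually[OF allI]])
  from tendsto_diff[OF tendsto_const[of ?L] this] show ?thesis by (simp add: sums_def)
qed

end

end

section \<open>Taylor coefficients and derivatives\<close>

lemma integral_U01_has_integral:
  fixes k :: "real \<Rightarrow> complex"
  assumes c: "continuous_on {0..1} k" and h: "(k has_integral I) {0..1}"
  shows "(\<integral>t. k t \<partial>U01) = I"
proof -
  obtain B where B: "\<And>t. t \<in> {0..1} \<Longrightarrow> norm (k t) \<le> B"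
    using compact_imp_bounded[OF compact_continuous_image[OF c compact_Icc]] unfolding bounded_iff by blast
  have "integrable U01 k"
    by (rule integrable_U01[where B=B], rule continuous_on_subset[OF c]) (use B in auto)
  then have si: "set_integrable lborel {0<..<1} k"
    by (simp add: U01_def set_integrable_def integrable_restrict_space)
  have "(\<integral>t. k t \<partial>U01) = (LBINT t:{0<..<1}. k t)"
    by (simp add: U01_def set_lebesgue_integral_def integral_restrict_space)
  also have "\<dots> = integral {0<..<1} k" by (rule set_borel_integral_eq_integral(2)[OF si])
  also have "\<dots> = integral {0..1} k" by (simp add: integral_open_interval_real)
  finally show ?thesis using h by (simp add: integral_unique)
qed

context borel_domain
begin

definition taylor :: "borel_fun \<Rightarrow> nat \<Rightarrow> complex \<Rightarrow> complex" where
  "taylor f n \<theta> = (deriv ^^ n) (\<lambda>w. f w \<theta>) 0"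

context
  fixes f :: "borel_fun" and R r :: real
  assumes f: "elem R f" and r: "0 < r" and sub: "cball 0 r \<subseteq> \<Omega>"
begin

lemma elem_cball: "w \<in> cball 0 r \<Longrightarrow> \<theta> \<in> strip 1 \<Longrightarrow> norm (f w \<theta>) \<le> R * \<mu> r"
  using elemD[OF f, of w \<theta>] sub mult_left_mono[OF mu_mono elem_nonneg[OF f], of "norm w" r] by force

lemma hol_ball: "\<theta> \<in> strip 1 \<Longrightarrow> (\<lambda>w. f w \<theta>) holomorphic_on ball 0 r"
  and cont_cball: "\<theta> \<in> strip 1 \<Longrightarrow> continuous_on (cball 0 r) (\<lambda>w. f w \<theta>)"
  using separately_holD(1)[OF elem_separately_hol[OF f]] sub ball_subset_cball
  by (meson holomorphic_on_subset holomorphic_on_imp_continuous_on continuous_on_subset order_trans)+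

lemma taylor_bound: "\<theta> \<in> strip 1 \<Longrightarrow> norm (taylor f n \<theta>) \<le> fact n * (R * \<mu> r) / r ^ n"
  unfolding taylor_def
  by (rule Cauchy_inequality[OF hol_ball cont_cball r]) (rule elem_cball | simp)+

lemma taylor_sums: "\<theta> \<in> strip 1 \<Longrightarrow> w \<in> ball 0 r \<Longrightarrow> (\<lambda>n. taylor f n \<theta> / fact n * w ^ n) sums f w \<theta>"
  unfolding taylor_def using holomorphic_power_series[OF hol_ball, of \<theta> w] by simp

text \<open>Cauchy's formula as an average over a circle. For each point of the circle the integrand
  is holomorphic and periodic in \<theta>, and the coefficient inherits both.\<close>

lemma taylor_integral:
  assumes \<theta>: "\<theta> \<in> strip 1"
  defines "\<gamma> \<equiv> \<lambda>t. of_real r * exp (2 * of_real pi * \<i> * of_real t)"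
  shows "taylor f n \<theta> = fact n * (\<integral>t. f (\<gamma> t) \<theta> / \<gamma> t ^ n \<partial>U01)"
proof -
  have nz: "\<gamma> t \<noteq> 0" for t using r by (simp add: \<gamma>_def)
  have g: "circlepath 0 r = \<gamma>" by (simp add: circlepath \<gamma>_def)
  have in_c: "\<gamma> t \<in> cball 0 r" for t using r by (simp add: \<gamma>_def norm_mult)
  have cg: "continuous_on A \<gamma>" for A unfolding \<gamma>_def by (intro continuous_intros)
  have c: "continuous_on {0..1} (\<lambda>t. f (\<gamma> t) \<theta> / \<gamma> t ^ n)"
    using nz in_c by (intro continuous_intros cg continuous_on_compose2[OF cont_cball[OF \<theta>]]) auto
  let ?I = "2 * of_real pi * \<i> / fact n * taylor f n \<theta>"
  have "((\<lambda>u. f u \<theta> / (u - 0) ^ Suc n) has_contour_integral ?I) (circlepath 0 r)"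
    unfolding taylor_def using Cauchy_has_contour_integral_higher_derivative_circlepath[OF cont_cball[OF \<theta>] hol_ball[OF \<theta>], of 0 n] r
    by simp
  then have "((\<lambda>t. f (\<gamma> t) \<theta> / \<gamma> t ^ Suc n * vector_derivative (circlepath 0 r) (at t within {0..1})) has_integral ?I) {0..1}"
    unfolding has_contour_integral_def g by simp
  then have "((\<lambda>t. 2 * of_real pi * \<i> * (f (\<gamma> t) \<theta> / \<gamma> t ^ n)) has_integral ?I) {0..1}"
  proof (rule has_integral_eq[rotated])
    fix t :: real assume "t \<in> {0..1}"
    then have "vector_derivative (circlepath 0 r) (at t within {0..1}) = 2 * of_real pi * \<i> * \<gamma> t"
      using vector_derivative_circlepath01[of t 0 r] by (simp add: \<gamma>_def)
    then show "f (\<gamma> t) \<theta> / \<gamma> t ^ Suc n * vector_derivative (circlepath 0 r) (at t within {0..1}) = 2 * of_real pi * \<i> * (f (\<gamma> t) \<theta> / \<gamma> t ^ n)"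
      using nz[of t] by (simp add: field_simps)
  qed
  then have "(\<integral>t. 2 * of_real pi * \<i> * (f (\<gamma> t) \<theta> / \<gamma> t ^ n) \<partial>U01) = ?I"
    by (rule integral_U01_has_integral[rotated]) (intro continuous_intros c)
  then have "2 * of_real pi * \<i> * (\<integral>t. f (\<gamma> t) \<theta> / \<gamma> t ^ n \<partial>U01) = ?I"
    unfolding integral_mult_right_zero .
  then show ?thesis by (simp add: field_simps)
qed

lemma taylor_holomorphic: "taylor f n holomorphic_on strip 1"
proof -
  define \<gamma> where "\<gamma> = (\<lambda>t::real. of_real r * exp (2 * of_real pi * \<i> * of_real t))"
  have nz: "\<gamma> t \<noteq> 0" for t using r by (simp add: \<gamma>_def)
  have n\<gamma>: "norm (\<gamma> t) = r" for t using r by (simp add: \<gamma>_def norm_mult)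
  have in_c: "\<gamma> t \<in> cball 0 r" for t using n\<gamma> by simp
  have cg: "continuous_on A \<gamma>" for A unfolding \<gamma>_def by (intro continuous_intros)
  have "(\<lambda>\<theta>. \<integral>t. f (\<gamma> t) \<theta> / \<gamma> t ^ n \<partial>U01) holomorphic_on strip 1"
  proof (rule holomorphic_on_integral_U01(1)[OF open_strip])
    show "(\<lambda>\<theta>. f (\<gamma> t) \<theta> / \<gamma> t ^ n) holomorphic_on strip 1" for t
      using nz by (intro holomorphic_intros separately_holD(2)[OF elem_separately_hol[OF f] subsetD[OF sub in_c]]) auto
    show "continuous_on {0<..<1} (\<lambda>t. f (\<gamma> t) z / \<gamma> t ^ n)" if "z \<in> strip 1" for z
      using nz in_c by (intro continuous_intros cg continuous_on_compose2[OF cont_cball[OF that]]) auto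
    show "\<exists>d>0. \<exists>M. \<forall>t z. 0 < t \<and> t < 1 \<and> z \<in> strip 1 \<inter> ball z0 d \<longrightarrow> norm (f (\<gamma> t) z / \<gamma> t ^ n) \<le> M" for z0
    proof (rule exI[of _ 1], rule conjI[OF zero_less_one], rule exI[of _ "R * \<mu> r / r ^ n"], intro allI impI)
      fix t :: real and z assume "0 < t \<and> t < 1 \<and> z \<in> strip 1 \<inter> ball z0 1"
      then show "norm (f (\<gamma> t) z / \<gamma> t ^ n) \<le> R * \<mu> r / r ^ n"
        using elem_cball[OF in_c, of z t] r by (simp add: norm_divide norm_power n\<gamma> divide_right_mono)
    qed
  qed
  then have "(\<lambda>\<theta>. fact n * (\<integral>t. f (\<gamma> t) \<theta> / \<gamma> t ^ n \<partial>U01)) holomorphic_on strip 1"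
    by (intro holomorphic_intros)
  then show ?thesis
    by (rule holomorphic_transform) (simp add: taylor_integral \<gamma>_def)
qed

lemma taylor_periodic: "\<theta> \<in> strip 1 \<Longrightarrow> taylor f n (\<theta> + 2 * of_real pi) = taylor f n \<theta>"
proof -
  assume \<theta>: "\<theta> \<in> strip 1"
  have "f (of_real r * exp (2 * of_real pi * \<i> * of_real t)) (\<theta> + 2 * of_real pi) = f (of_real r * exp (2 * of_real pi * \<i> * of_real t)) \<theta>" for t
    using r sub by (intro separately_holD(3)[OF elem_separately_hol[OF f] _ \<theta>]) (auto simp: norm_mult subset_iff)
  then show ?thesis
    by (simp add: taylor_integral[OF \<theta>] taylor_integral[OF strip_add_2pi[OF \<theta>]])
qed

end

end

context borel_laplace
begin

lemma near_x:
  assumes "\<eta> < Re (cis \<psi> / x0)"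
  obtains d m where "0 < d" "\<eta> < m" "\<And>x. x \<in> ball x0 d \<Longrightarrow> m \<le> Re (cis \<psi> / x)"
proof -
  have x0: "x0 \<noteq> 0" using assms eta by auto
  define m where "m = (\<eta> + Re (cis \<psi> / x0)) / 2"
  have m: "\<eta> < m" "m < Re (cis \<psi> / x0)" using assms by (auto simp: m_def)
  have "((\<lambda>x. Re (cis \<psi> / x)) \<longlongrightarrow> Re (cis \<psi> / x0)) (nhds x0)"
    using x0 by (intro tendsto_intros filterlim_ident)
  then have "\<forall>\<^sub>F x in nhds x0. m < Re (cis \<psi> / x)"
    using m(2) by (rule order_tendstoD)
  then obtain d where "d > 0" "\<And>x. dist x x0 < d \<Longrightarrow> m < Re (cis \<psi> / x)"
    unfolding eventually_nhds_metric by blast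
  then show ?thesis using that[of d m] m(1) by (force simp: dist_commute)
qed

lemma laplace_dx:
  assumes f: "elem R f" and g: "\<And>w. w \<in> \<Omega> \<Longrightarrow> g w \<theta> = w * f w \<theta>"
    and \<psi>: "direction \<psi>" and \<theta>: "\<theta> \<in> strip 1" and x0: "\<eta> < Re (cis \<psi> / x0)"
  shows "((\<lambda>x. laplace \<psi> f x \<theta>) has_field_derivative laplace \<psi> g x0 \<theta> / x0\<^sup>2) (at x0)"
proof -
  obtain d m where d: "0 < d" "\<eta> < m" "\<And>x. x \<in> ball x0 d \<Longrightarrow> m \<le> Re (cis \<psi> / x)"
    using near_x[OF x0] by blast
  have nz: "x \<noteq> 0" if "x \<in> ball x0 d" for x using d(3)[OF that] d(2) eta by auto
  have hol: "(\<lambda>x. laplace_integrand \<psi> f x \<theta> t) holomorphic_on ball x0 d" for t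
    unfolding laplace_integrand_def scaleR_conv_of_real using nz by (intro holomorphic_intros) auto
  have meas: "(\<lambda>t. laplace_integrand \<psi> f x \<theta> t) \<in> borel_measurable lborel" for x
    by (rule laplace_integrand_measurable[OF elem_separately_hol[OF f] \<psi> \<theta>])
  have dv: "deriv (\<lambda>x. laplace_integrand \<psi> f x \<theta> t) x0 = laplace_integrand \<psi> g x0 \<theta> t / x0\<^sup>2" for t
  proof (cases "0 < t")
    case True
    have "((\<lambda>x. cis \<psi> * f (of_real t * cis \<psi>) \<theta> * exp (- (of_real t * cis \<psi> / x))) has_field_derivative
      cis \<psi> * f (of_real t * cis \<psi>) \<theta> * (exp (- (of_real t * cis \<psi> / x0)) * (of_real t * cis \<psi> / x0\<^sup>2))) (at x0)"
      using nz[of x0] d(1) by (auto intro!: derivative_eq_intros simp: power2_eq_square)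
    then have "deriv (\<lambda>x. cis \<psi> * f (of_real t * cis \<psi>) \<theta> * exp (- (of_real t * cis \<psi> / x))) x0 =
      cis \<psi> * f (of_real t * cis \<psi>) \<theta> * (exp (- (of_real t * cis \<psi> / x0)) * (of_real t * cis \<psi> / x0\<^sup>2))"
      by (rule DERIV_imp_deriv)
    then show ?thesis using True \<psi> g[of "of_real t * cis \<psi>"] by (simp add: laplace_integrand_def direction_def)
  qed (simp add: laplace_integrand_def)
  have "((\<lambda>x. \<integral>t. laplace_integrand \<psi> f x \<theta> t \<partial>lborel) has_field_derivative (\<integral>t. deriv (\<lambda>x. laplace_integrand \<psi> f x \<theta> t) x0 \<partial>lborel)) (at x0)"
    by (rule has_field_derivative_lebesgue_integral(2)[where h="\<lambda>t x. laplace_integrand \<psi> f x \<theta> t", OF d(1) hol meas laplace_integrand_bound[OF f \<psi> \<theta> d(3)]])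
      (use dom_integrable(1)[OF d(2)] in auto)
  then show ?thesis by (simp add: dv laplace_eq)
qed

lemma laplace_dtheta:
  assumes f: "elem R f" and g: "\<And>w. w \<in> \<Omega> \<Longrightarrow> (f w has_field_derivative g w \<theta>) (at \<theta>)"
    and \<psi>: "direction \<psi>" and \<theta>: "\<theta> \<in> strip 1" and x: "\<eta> < Re (cis \<psi> / x)"
  shows "((\<lambda>\<theta>. laplace \<psi> f x \<theta>) has_field_derivative laplace \<psi> g x \<theta>) (at \<theta>)"
proof -
  obtain d where d: "d > 0" "ball \<theta> d \<subseteq> strip 1"
    using open_strip[of 1] \<theta> open_contains_ball by blast
  have hol: "(\<lambda>\<theta>. laplace_integrand \<psi> f x \<theta> t) holomorphic_on ball \<theta> d" for t
  proof (cases "0 < t")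
    case True
    have "f (of_real t * cis \<psi>) holomorphic_on ball \<theta> d"
      using separately_holD(2)[OF elem_separately_hol[OF f], of "of_real t * cis \<psi>"] True \<psi> d(2) holomorphic_on_subset by (auto simp: direction_def)
    then show ?thesis unfolding laplace_integrand_def scaleR_conv_of_real by (intro holomorphic_intros)
  qed (simp add: laplace_integrand_def)
  have meas: "(\<lambda>t. laplace_integrand \<psi> f x z t) \<in> borel_measurable lborel" if "z \<in> ball \<theta> d" for z
    using that d(2) by (intro laplace_integrand_measurable[OF elem_separately_hol[OF f] \<psi>]) auto
  have dv: "deriv (\<lambda>\<theta>. laplace_integrand \<psi> f x \<theta> t) \<theta> = laplace_integrand \<psi> g x \<theta> t" for t
  proof (cases "0 < t")
    case True
    have "((\<lambda>\<theta>. cis \<psi> * f (of_real t * cis \<psi>) \<theta> * exp (- (of_real t * cis \<psi> / x))) has_field_derivative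
      cis \<psi> * g (of_real t * cis \<psi>) \<theta> * exp (- (of_real t * cis \<psi> / x))) (at \<theta>)"
      using g[of "of_real t * cis \<psi>"] True \<psi>
      by (intro DERIV_cmult DERIV_cmult_right) (auto simp: direction_def)
    from DERIV_imp_deriv[OF this] show ?thesis using True by (simp add: laplace_integrand_def)
  qed (simp add: laplace_integrand_def)
  have "((\<lambda>\<theta>. \<integral>t. laplace_integrand \<psi> f x \<theta> t \<partial>lborel) has_field_derivative (\<integral>t. deriv (\<lambda>\<theta>. laplace_integrand \<psi> f x \<theta> t) \<theta> \<partial>lborel)) (at \<theta>)"
    by (rule has_field_derivative_lebesgue_integral(2)[where h="\<lambda>t \<theta>. laplace_integrand \<psi> f x \<theta> t", OF d(1) hol meas laplace_integrand_bound[OF f \<psi> _ order_refl]])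
      (use dom_integrable(1)[OF x] d(2) in auto)
  then show ?thesis by (simp add: dv laplace_eq)
qed

text \<open>On a small bidisc \<open>laplace_bound\<close> is uniform, so
  \<open>has_derivative_separately_holomorphic\<close> joins the two partial derivatives.\<close>

lemma laplace_has_derivative:
  assumes f: "elem R f" and g: "\<And>w \<theta>. w \<in> \<Omega> \<Longrightarrow> \<theta> \<in> strip 1 \<Longrightarrow> g w \<theta> = w * f w \<theta>"
    and h: "\<And>w \<theta>. w \<in> \<Omega> \<Longrightarrow> \<theta> \<in> strip 1 \<Longrightarrow> (f w has_field_derivative h w \<theta>) (at \<theta>)"
    and \<psi>: "direction \<psi>" and \<theta>: "\<theta> \<in> strip 1" and x0: "\<eta> < Re (cis \<psi> / x0)"
  shows "((\<lambda>(x, \<theta>). laplace \<psi> f x \<theta>) has_derivative (\<lambda>(u, v). laplace \<psi> g x0 \<theta> / x0\<^sup>2 * u + laplace \<psi> h x0 \<theta> * v)) (at (x0, \<theta>))"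
proof -
  obtain d1 m where d1: "0 < d1" "\<eta> < m" "\<And>x. x \<in> ball x0 d1 \<Longrightarrow> m \<le> Re (cis \<psi> / x)"
    using near_x[OF x0] by blast
  obtain d2 where d2: "d2 > 0" "ball \<theta> d2 \<subseteq> strip 1"
    using open_strip[of 1] \<theta> open_contains_ball by blast
  define d where "d = min d1 d2"
  have X: "m \<le> Re (cis \<psi> / x)" "\<eta> < Re (cis \<psi> / x)" if "x \<in> ball x0 d" for x
    using d1(2) d1(3)[of x] that by (auto simp: d_def)
  have T: "z \<in> strip 1" if "z \<in> ball \<theta> d" for z using that d2 by (auto simp: d_def)
  show ?thesis
  proof (rule has_derivative_separately_holomorphic[where d=d and M="R * M\<mu> / (m - \<eta>)"])
    show "0 < d" using d1 d2 by (simp add: d_def)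
    show "(\<lambda>x. (\<lambda>(x, \<theta>). laplace \<psi> f x \<theta>) (x, y)) holomorphic_on ball x0 d" if "y \<in> ball \<theta> d" for y
      unfolding prod.case holomorphic_on_open[OF open_ball]
      using laplace_dx[where \<theta>=y and g=g, OF f g[OF _ T[OF that]] \<psi> T[OF that] X(2)] by blast
    show "(\<lambda>y. (\<lambda>(x, \<theta>). laplace \<psi> f x \<theta>) (x, y)) holomorphic_on ball \<theta> d" if "x \<in> ball x0 d" for x
      unfolding prod.case holomorphic_on_open[OF open_ball]
    proof
      fix z assume z: "z \<in> ball \<theta> d"
      show "\<exists>D. ((\<lambda>y. laplace \<psi> f x y) has_field_derivative D) (at z)"
        using laplace_dtheta[where g=h and \<theta>=z, OF f h[OF _ T[OF z]] \<psi> T[OF z] X(2)[OF that]] by blast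
    qed
    show "norm ((\<lambda>(x, \<theta>). laplace \<psi> f x \<theta>) (x, y)) \<le> R * M\<mu> / (m - \<eta>)" if "x \<in> ball x0 d" "y \<in> ball \<theta> d" for x y
      using laplace_bound[OF f \<psi> T[OF that(2)] d1(2) X(1)[OF that(1)]] by simp
    show "((\<lambda>x. (\<lambda>(x, \<theta>). laplace \<psi> f x \<theta>) (x, \<theta>)) has_field_derivative laplace \<psi> g x0 \<theta> / x0\<^sup>2) (at x0)"
      using laplace_dx[where \<theta>=\<theta> and g=g, OF f g \<psi> \<theta> x0] \<theta> by simp
    show "((\<lambda>y. (\<lambda>(x, \<theta>). laplace \<psi> f x \<theta>) (x0, y)) has_field_derivative laplace \<psi> h x0 \<theta>) (at \<theta>)"
      using laplace_dtheta[where \<theta>=\<theta> and g=h, OF f h \<psi> \<theta> x0] \<theta> by simp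
  qed
qed

text \<open>The integrals up to radius T on the two rays differ by an integral over an arc. By
  \<open>Re_cis_between\<close> the integrand decays like exp(- (m - \<eta>) T) on the whole arc,
  whose length is only linear in T.\<close>

lemma laplace_ray_independent_le:
  assumes f: "elem R f" and dir: "\<And>\<psi>. \<psi>1 \<le> \<psi> \<Longrightarrow> \<psi> \<le> \<psi>2 \<Longrightarrow> direction \<psi>" and le: "\<psi>1 \<le> \<psi>2" "\<psi>2 - \<psi>1 < pi"
    and \<theta>: "\<theta> \<in> strip 1" and x1: "\<eta> < Re (cis \<psi>1 / x)" and x2: "\<eta> < Re (cis \<psi>2 / x)"
  shows "laplace \<psi>1 f x \<theta> = laplace \<psi>2 f x \<theta>"
proof -
  let ?h = "\<lambda>w. f w \<theta> * exp (- (w / x))"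
  have xnz: "x \<noteq> 0" using x1 eta by auto
  have d1: "direction \<psi>1" and d2: "direction \<psi>2" using dir le by auto
  have "separately_hol (\<lambda>w \<theta>. f w \<theta> * exp (- (w / x)))"
    using xnz by (intro separately_hol_mult[OF elem_separately_hol[OF f]] separately_holI) (auto intro!: holomorphic_intros)
  then obtain P where P: "\<And>w. w \<in> \<Omega> \<Longrightarrow> (P has_field_derivative ?h w) (at w)"
    using separately_hol_primitive[OF _ \<theta>] by blast
  define m where "m = min (Re (cis \<psi>1 / x)) (Re (cis \<psi>2 / x))"
  have m: "\<eta> < m" using x1 x2 by (simp add: m_def)
  have mle: "m \<le> Re (cis \<psi> / x)" if "\<psi>1 \<le> \<psi>" "\<psi> \<le> \<psi>2" for \<psi>
    using Re_cis_between[OF that le(2), of m "1 / x"] m eta by (simp add: m_def)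
  have arc: "norm (P (of_real T * cis \<psi>2) - P (of_real T * cis \<psi>1)) \<le> (\<psi>2 - \<psi>1) * (R * M\<mu>) * (T * exp (- ((m - \<eta>) * T)))"
    if T: "0 < T" for T
  proof -
    let ?\<psi> = "\<lambda>t. \<psi>1 + t * (\<psi>2 - \<psi>1)"
    let ?D = "\<lambda>t. of_real (\<psi>2 - \<psi>1) * (\<i> * (of_real T * cis (?\<psi> t))) * ?h (of_real T * cis (?\<psi> t))"
    have rng: "\<psi>1 \<le> ?\<psi> t" "?\<psi> t \<le> \<psi>2" if "0 \<le> t" "t \<le> 1" for t
      using that le(1) mult_right_mono[of t 1 "\<psi>2 - \<psi>1"] by auto
    have inO: "of_real T * cis (?\<psi> t) \<in> \<Omega>" if "0 \<le> t" "t \<le> 1" for t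
      using dir[OF rng[OF that]] T by (auto simp: direction_def)
    have bd: "norm (?D t) \<le> (\<psi>2 - \<psi>1) * (R * M\<mu>) * (T * exp (- ((m - \<eta>) * T)))" if t: "0 \<le> t" "t \<le> 1" for t
    proof -
      have "norm (laplace_integrand (?\<psi> t) f x \<theta> T) \<le> R * M\<mu> * (indicator {0<..} T *\<^sub>R exp (- ((m - \<eta>) * T)))"
        by (rule laplace_integrand_bound[OF f dir \<theta> mle]) (use rng[OF t] in auto)
      then have "norm (?h (of_real T * cis (?\<psi> t))) \<le> R * M\<mu> * exp (- ((m - \<eta>) * T))"
        using T by (simp add: laplace_integrand_def norm_mult)
      then have "(\<psi>2 - \<psi>1) * T * norm (?h (of_real T * cis (?\<psi> t))) \<le> (\<psi>2 - \<psi>1) * T * (R * M\<mu> * exp (- ((m - \<eta>) * T)))"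
        using T le by (intro mult_left_mono) auto
      moreover have "norm (?D t) = (\<psi>2 - \<psi>1) * T * norm (?h (of_real T * cis (?\<psi> t)))"
        using T le by (simp add: norm_mult)
      ultimately show ?thesis by (simp add: ac_simps)
    qed
    have cc: "continuous_on {0..1} (\<lambda>t. of_real T * cis (?\<psi> t))" by (intro continuous_intros)
    have ch: "continuous_on \<Omega> ?h"
      using xnz by (intro continuous_intros holomorphic_on_imp_continuous_on[OF separately_holD(1)[OF elem_separately_hol[OF f] \<theta>]]) auto
    have "(\<lambda>t. of_real T * cis (?\<psi> t)) ` {0..1} \<subseteq> \<Omega>" 
      by (rule image_subsetI, rule inO) simp_all
    from continuous_on_compose2[OF ch cc this] have cD: "continuous_on {0..1} ?D"
      by (intro continuous_on_mult[OF continuous_on_mult[OF continuous_on_const continuous_on_mult[OF continuous_on_const cc]]])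
    have vd: "((\<lambda>t. P (of_real T * cis (?\<psi> t))) has_vector_derivative ?D t) (at t)" if t: "0 \<le> t" "t \<le> 1" for t
    proof -
      have "((\<lambda>t. \<i> * of_real (?\<psi> t)) has_vector_derivative \<i> * of_real (\<psi>2 - \<psi>1)) (at t)"
        by (auto intro!: derivative_eq_intros has_vector_derivative_mult_right has_vector_derivative_of_real
            simp flip: has_real_derivative_iff_has_vector_derivative)
      from has_vector_derivative_mult_right[OF field_vector_diff_chain_at[OF this DERIV_exp], of "of_real T"]
      have "((\<lambda>t. of_real T * exp (\<i> * of_real (?\<psi> t))) has_vector_derivative of_real (\<psi>2 - \<psi>1) * (\<i> * (of_real T * exp (\<i> * of_real (?\<psi> t))))) (at t)"
        by (simp only: o_def ac_simps)
      then have "((\<lambda>t. of_real T * cis (?\<psi> t)) has_vector_derivative of_real (\<psi>2 - \<psi>1) * (\<i> * (of_real T * cis (?\<psi> t)))) (at t)"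
        by (simp only: cis_conv_exp)
      from field_vector_diff_chain_at[OF this P[OF inO[OF t]]] show ?thesis by (simp add: o_def)
    qed
    have "(\<integral>t. ?D t \<partial>U01) = P (of_real T * cis (?\<psi> 1)) - P (of_real T * cis (?\<psi> 0))"
    proof (rule integral_U01_FTC)
      show "continuous_on {0..1} (\<lambda>t. P (of_real T * cis (?\<psi> t)))"
        by (auto intro!: continuous_at_imp_continuous_on has_vector_derivative_continuous[OF vd])
      show "integrable U01 ?D"
        by (rule integrable_U01[OF continuous_on_subset[OF cD] bd]) auto
    qed (use vd in auto)
    moreover have "norm (\<integral>t. ?D t \<partial>U01) \<le> (\<psi>2 - \<psi>1) * (R * M\<mu>) * (T * exp (- ((m - \<eta>) * T)))"
      by (rule norm_integral_U01_le_const[OF bd]) auto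
    ultimately show ?thesis by simp
  qed
  have "(\<lambda>n. P (of_real (real n) * cis \<psi>2) - P (of_real (real n) * cis \<psi>1)) \<longlonglongrightarrow> 0"
  proof (rule Lim_null_comparison)
    show "\<forall>\<^sub>F n in sequentially. norm (P (of_real (real n) * cis \<psi>2) - P (of_real (real n) * cis \<psi>1))
        \<le> (\<psi>2 - \<psi>1) * (R * M\<mu>) * (real n * exp (- (m - \<eta>)) ^ n)"
      using eventually_gt_at_top[of 0]
    proof eventually_elim
      case (elim n)
      have "exp (- (m - \<eta>)) ^ n = exp (- ((m - \<eta>) * real n))" by (simp add: algebra_simps flip: exp_of_nat_mult)
      then show ?case using arc[of "real n"] elim by simp
    qed
    have "(\<lambda>n. real n * exp (- (m - \<eta>)) ^ n) \<longlonglongrightarrow> 0"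
      using m by (intro powser_times_n_limit_0) auto
    then show "(\<lambda>n. (\<psi>2 - \<psi>1) * (R * M\<mu>) * (real n * exp (- (m - \<eta>)) ^ n)) \<longlonglongrightarrow> 0"
      by (rule tendsto_mult_right_zero)
  qed
  moreover have "(\<lambda>n. (P (of_real (real n) * cis \<psi>2) - P 0) - (P (of_real (real n) * cis \<psi>1) - P 0)) \<longlonglongrightarrow> laplace \<psi>2 f x \<theta> - laplace \<psi>1 f x \<theta>"
    by (intro tendsto_diff laplace_limit[OF d1 \<theta> x1 f P] laplace_limit[OF d2 \<theta> x2 f P])
  ultimately have "laplace \<psi>2 f x \<theta> - laplace \<psi>1 f x \<theta> = 0"
    using LIMSEQ_unique by fastforce
  then show ?thesis by simp
qed

lemma laplace_ray_independent:
  assumes f: "elem R f" and dir: "\<And>\<psi>. \<bar>\<psi> - \<phi>\<bar> < \<kappa> \<Longrightarrow> direction \<psi>" and \<kappa>: "\<kappa> \<le> pi / 2"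
    and \<theta>: "\<theta> \<in> strip 1" and x1: "\<bar>\<psi>1 - \<phi>\<bar> < \<kappa>" "\<eta> < Re (cis \<psi>1 / x)" and x2: "\<bar>\<psi>2 - \<phi>\<bar> < \<kappa>" "\<eta> < Re (cis \<psi>2 / x)"
  shows "laplace \<psi>1 f x \<theta> = laplace \<psi>2 f x \<theta>"
proof (cases "\<psi>1 \<le> \<psi>2")
  case True
  then show ?thesis
    by (intro laplace_ray_independent_le[OF f dir _ _ \<theta> x1(2) x2(2)]) (use x1(1) x2(1) \<kappa> in auto)
next
  case False
  then have "laplace \<psi>2 f x \<theta> = laplace \<psi>1 f x \<theta>"
    by (intro laplace_ray_independent_le[OF f dir _ _ \<theta> x2(2) x1(2)]) (use x1(1) x2(1) \<kappa> in auto)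
  then show ?thesis by simp
qed

end

section \<open>Expansions at the origin\<close>

text \<open>Let t tend to 0, divide by t, and repeat.\<close>

lemma quadratic_zero_of_cubic_bound:
  fixes p0 p1 p2 C \<delta> :: real
  assumes \<delta>: "0 < \<delta>" and bd: "\<And>t. 0 < t \<Longrightarrow> t < \<delta> \<Longrightarrow> \<bar>p0 + p1 * t + p2 * t\<^sup>2\<bar> \<le> C * t ^ 3"
  shows "p0 = 0" "p1 = 0" "p2 = 0"
proof -
  have ev: "\<forall>\<^sub>F t in at_right 0. 0 < t \<and> t < \<delta>"
    using \<delta> by (auto simp: eventually_at_right_field)
  have null: "l = 0" if "(f \<longlongrightarrow> l) (at_right 0)" "\<And>t. 0 < t \<Longrightarrow> t < \<delta> \<Longrightarrow> \<bar>f t\<bar> \<le> g t" "(g \<longlongrightarrow> 0) (at_right 0)"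
    for f g :: "real \<Rightarrow> real" and l
  proof (rule tendsto_unique[OF _ that(1)])
    show "(f \<longlongrightarrow> 0) (at_right 0)"
      by (rule Lim_null_comparison[OF eventually_mono[OF ev] that(3)]) (use that(2) in auto)
  qed simp
  have "((\<lambda>t. p0 + p1 * t + p2 * t\<^sup>2) \<longlongrightarrow> p0 + p1 * 0 + p2 * 0\<^sup>2) (at_right 0)"
    by (intro tendsto_intros)
  moreover have "((\<lambda>t. C * t ^ 3) \<longlongrightarrow> C * 0 ^ 3) (at_right 0)" by (intro tendsto_intros)
  ultimately show p0: "p0 = 0" using null[OF _ bd] by simp
  have bd1: "\<bar>p1 + p2 * t\<bar> \<le> C * t\<^sup>2" if "0 < t" "t < \<delta>" for t
  proof -
    have "(p1 + p2 * t) * t = p0 + p1 * t + p2 * t\<^sup>2" using p0 by (simp add: power2_eq_square distrib_right)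
    then have "\<bar>(p1 + p2 * t) * t\<bar> \<le> C * t ^ 3" using bd[OF that] by simp
    then have "\<bar>p1 + p2 * t\<bar> * t \<le> (C * t\<^sup>2) * t"
      using that by (simp add: abs_mult power2_eq_square power3_eq_cube)
    then show ?thesis using that by simp
  qed
  have "((\<lambda>t. p1 + p2 * t) \<longlongrightarrow> p1 + p2 * 0) (at_right 0)"
    by (intro tendsto_intros)
  moreover have "((\<lambda>t. C * t\<^sup>2) \<longlongrightarrow> C * 0\<^sup>2) (at_right 0)" by (intro tendsto_intros)
  ultimately show p1: "p1 = 0" using null[OF _ bd1] by simp
  have bd2: "\<bar>p2\<bar> \<le> C * t" if "0 < t" "t < \<delta>" for t
    using bd1[OF that] that p1 by (simp add: abs_mult power2_eq_square)
  have "((\<lambda>t. C * t) \<longlongrightarrow> C * 0) (at_right 0)" by (intro tendsto_intros)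
  then show "p2 = 0" using null[OF tendsto_const bd2] by simp
qed

lemma low_degree_set:
  "{m. deg m < 3} = {(0,0,0), (1,0,0), (0,1,0), (0,0,1), (2,0,0), (0,2,0), (0,0,2), (1,1,0), (1,0,1), (0,1,1)}"
proof (intro set_eqI iffI)
  fix m assume "m \<in> {m. deg m < 3}"
  then obtain i j k where m: "m = (i, j, k)" "i + j + k < 3" by (cases m) auto
  have e: "(n = 0 \<or> n = 1 \<or> n = 2)" if "n < 3" for n :: nat using that by linarith
  have "i < 3" "j < 3" "k < 3" using m(2) by linarith+
  then have "(i = 0 \<or> i = 1 \<or> i = 2) \<and> (j = 0 \<or> j = 1 \<or> j = 2) \<and> (k = 0 \<or> k = 1 \<or> k = 2)"
    using e by blast
  then show "m \<in> {(0,0,0), (1,0,0), (0,1,0), (0,0,1), (2,0,0), (0,2,0), (0,0,2), (1,1,0), (1,0,1), (0,1,1)}"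
    using m(2) unfolding m(1) by (elim conjE disjE) simp_all
qed (elim insertE emptyE; simp)

text \<open>For real families summability on a set is absolute; at the corner (r, r, r) it gives a
  majorant for the whole polydisc.\<close>

lemma expansion_abs_summable:
  assumes "has_expansion F c"
  obtains r where "0 < r" "(\<lambda>m. \<bar>c m\<bar> * r ^ deg m) summable_on UNIV"
    "\<And>x y z. \<bar>x\<bar> \<le> r \<Longrightarrow> \<bar>y\<bar> \<le> r \<Longrightarrow> \<bar>z\<bar> \<le> r \<Longrightarrow> ((\<lambda>m. c m * monomial3 (x, y, z) m) has_sum F (x, y, z)) UNIV"
proof -
  obtain s where s: "0 < s" "\<And>x y z. \<bar>x\<bar> < s \<Longrightarrow> \<bar>y\<bar> < s \<Longrightarrow> \<bar>z\<bar> < s \<Longrightarrow> ((\<lambda>m. c m * monomial3 (x, y, z) m) has_sum F (x, y, z)) UNIV"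
    using assms unfolding has_expansion_def real_scaleR_def by blast
  define r where "r = s / 2"
  have r: "0 < r" "r < s" using s(1) by (auto simp: r_def)
  have "(\<lambda>m. c m * monomial3 (r, r, r) m) summable_on UNIV"
    using s(2)[of r r r] r by (auto simp: summable_on_def)
  then have "(\<lambda>m. norm (c m * monomial3 (r, r, r) m)) summable_on UNIV"
    by (rule summable_on_iff_abs_summable_on_real[THEN iffD1])
  moreover have "norm (c m * monomial3 (r, r, r) m) = \<bar>c m\<bar> * r ^ deg m" for m
    using r by (cases m) (simp add: monomial3_def abs_mult power_add)
  ultimately show ?thesis using that[of r] r s(2) by simp
qed

lemma norm_monomial3_le:
  fixes x y z :: "'a::real_normed_field"
  assumes "norm x \<le> r" "norm y \<le> r" "norm z \<le> r"
  shows "norm (monomial3 (x, y, z) m) \<le> r ^ deg m"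
proof -
  obtain i j k where m: "m = (i, j, k)" by (cases m)
  have "0 \<le> r" using assms(1) norm_ge_zero order_trans by blast
  then have "norm x ^ i * norm y ^ j * norm z ^ k \<le> r ^ i * r ^ j * r ^ k"
    using assms by (intro mult_mono power_mono) auto
  then show ?thesis by (simp add: m monomial3_def norm_mult norm_power power_add)
qed

text \<open>Along the line t (x, y, z) the part of degree below 3 is a quadratic polynomial in t
  bounded by a multiple of t^3, hence zero for every direction; suitable directions then isolate the
  coefficients.\<close>

lemma low_coefficients_vanish:
  assumes exp: "has_expansion F c" and O: "F \<in> O[nhds 0](\<lambda>p. norm p ^ 3)" and m: "deg m < 3"
  shows "c m = 0"
proof -
  obtain r where r: "0 < r" "(\<lambda>m. \<bar>c m\<bar> * r ^ deg m) summable_on UNIV"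
    and hs: "\<And>x y z. \<bar>x\<bar> \<le> r \<Longrightarrow> \<bar>y\<bar> \<le> r \<Longrightarrow> \<bar>z\<bar> \<le> r \<Longrightarrow> ((\<lambda>m. c m * monomial3 (x, y, z) m) has_sum F (x, y, z)) UNIV"
    using expansion_abs_summable[OF exp] by blast
  obtain C where C: "\<forall>\<^sub>F p in nhds 0. norm (F p) \<le> C * norm (norm p ^ 3)" "C > 0"
    using landau_o.bigE[OF O] by blast
  then obtain \<delta> where \<delta>: "\<delta> > 0" "\<And>p. dist p 0 < \<delta> \<Longrightarrow> norm (F p) \<le> C * norm (norm p ^ 3)"
    unfolding eventually_nhds_metric by blast
  let ?A = "{m. deg m < 3}"
  define S where "S = (\<Sum>\<^sub>\<infinity>m\<in>UNIV - ?A. \<bar>c m\<bar> * r ^ deg m)"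
  \<comment> \<open>The points t (x, y, z) used here have norm at most 3 t, so t < \<delta> / 4
    keeps them within \<delta>.\<close>
  define \<delta>' where "\<delta>' = min r (\<delta> / 4)"
  have finA: "finite ?A" unfolding low_degree_set by simp
  have key: "\<bar>(\<Sum>m\<in>?A. c m * monomial3 (t * x, t * y, t * z) m)\<bar> \<le> (27 * C + S / r ^ 3) * t ^ 3"
    if v: "\<bar>x\<bar> \<le> 1" "\<bar>y\<bar> \<le> 1" "\<bar>z\<bar> \<le> 1" and t: "0 < t" "t < \<delta>'" for x y z t :: real
  proof -
    let ?T = "\<lambda>m. c m * monomial3 (t * x, t * y, t * z) m"
    have tv: "\<bar>t * x\<bar> \<le> t" "\<bar>t * y\<bar> \<le> t" "\<bar>t * z\<bar> \<le> t"
      using v t by (auto simp: abs_mult mult_left_le)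
    have tr: "t \<le> r" using t by (simp add: \<delta>'_def)
    have "norm (t * x, t * y, t * z) \<le> norm (t * x) + norm (t * y, t * z)" by (rule norm_Pair_le)
    also have "\<dots> \<le> norm (t * x) + (norm (t * y) + norm (t * z))" by (intro add_left_mono norm_Pair_le)
    finally have n3: "norm (t * x, t * y, t * z) \<le> 3 * t" using tv by simp
    then have "dist (t * x, t * y, t * z) 0 < \<delta>" using t by (simp add: \<delta>'_def)
    then have "\<bar>F (t * x, t * y, t * z)\<bar> \<le> C * norm (t * x, t * y, t * z) ^ 3"
      using \<delta>(2) by fastforce
    also have "\<dots> \<le> C * (3 * t) ^ 3" using n3 C(2) by (intro mult_left_mono power_mono) auto
    finally have 1: "\<bar>F (t * x, t * y, t * z)\<bar> \<le> 27 * C * t ^ 3" by (simp add: power_mult_distrib)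
    have h: "(?T has_sum F (t * x, t * y, t * z)) UNIV" using tv tr by (intro hs) auto
    then have h': "(?T has_sum (F (t * x, t * y, t * z) - (\<Sum>m\<in>?A. ?T m))) (UNIV - ?A)"
      by (rule has_sum_Diff) (use finA in auto)
    have sB: "(\<lambda>m. \<bar>c m\<bar> * r ^ deg m) summable_on UNIV - ?A"
      by (rule summable_on_subset_banach[OF r(2)]) auto
    then have g: "((\<lambda>m. (t / r) ^ 3 * (\<bar>c m\<bar> * r ^ deg m)) has_sum ((t / r) ^ 3 * S)) (UNIV - ?A)"
      unfolding S_def by (intro has_sum_cmult_right) simp
    have le: "norm (?T m) \<le> (t / r) ^ 3 * (\<bar>c m\<bar> * r ^ deg m)" if "m \<in> UNIV - ?A" for m
    proof -
      obtain n where n: "deg m = n + 3" using \<open>m \<in> UNIV - ?A\<close> le_Suc_ex[of 3 "deg m"] by (auto simp: add.commute)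
      have "t ^ deg m \<le> t ^ 3 * r ^ n" using t(1) tr by (simp add: n power_add power_mono mult_right_mono)
      also have "\<dots> = (t / r) ^ 3 * r ^ deg m" using r(1) by (simp add: n power_add power_divide)
      finally have a: "norm (monomial3 (t * x, t * y, t * z) m) \<le> (t / r) ^ 3 * r ^ deg m"
        using norm_monomial3_le[of "t * x" t "t * y" "t * z" m] tv by simp
      have "\<bar>c m\<bar> * norm (monomial3 (t * x, t * y, t * z) m) \<le> \<bar>c m\<bar> * ((t / r) ^ 3 * r ^ deg m)"
        by (rule mult_left_mono[OF a]) simp
      then show ?thesis by (simp add: abs_mult mult.left_commute)
    qed
    have "norm (F (t * x, t * y, t * z) - (\<Sum>m\<in>?A. ?T m)) \<le> (t / r) ^ 3 * S"
      by (rule norm_infsum_le[OF h' g le])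
    moreover have "(t / r) ^ 3 * S = S / r ^ 3 * t ^ 3" by (simp add: power_divide)
    ultimately have "\<bar>F (t * x, t * y, t * z) - (\<Sum>m\<in>?A. ?T m)\<bar> \<le> S / r ^ 3 * t ^ 3" by simp
    with 1 show ?thesis unfolding distrib_right by linarith
  qed
  have \<delta>': "\<delta>' > 0" using r \<delta> by (simp add: \<delta>'_def)
  have P: "c (0,0,0) = 0 \<and> c (1,0,0) * x + c (0,1,0) * y + c (0,0,1) * z = 0 \<and>
     c (2,0,0) * x\<^sup>2 + c (0,2,0) * y\<^sup>2 + c (0,0,2) * z\<^sup>2 + c (1,1,0) * x * y + c (1,0,1) * x * z + c (0,1,1) * y * z = 0"
    if v: "\<bar>x\<bar> \<le> 1" "\<bar>y\<bar> \<le> 1" "\<bar>z\<bar> \<le> 1" for x y z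
  proof -
    have eq: "(\<Sum>m\<in>?A. c m * monomial3 (t * x, t * y, t * z) m)
      = c (0,0,0) + (c (1,0,0) * x + c (0,1,0) * y + c (0,0,1) * z) * t +
      (c (2,0,0) * x\<^sup>2 + c (0,2,0) * y\<^sup>2 + c (0,0,2) * z\<^sup>2 + c (1,1,0) * x * y + c (1,0,1) * x * z + c (0,1,1) * y * z) * t\<^sup>2" for t
    proof -
      have "(\<Sum>m\<in>?A. c m * monomial3 (t * x, t * y, t * z) m)
        = c (0,0,0) + (c (1,0,0) * (t * x) + (c (0,1,0) * (t * y) + (c (0,0,1) * (t * z) +
          (c (2,0,0) * (t * x)\<^sup>2 + (c (0,2,0) * (t * y)\<^sup>2 + (c (0,0,2) * (t * z)\<^sup>2 +
          (c (1,1,0) * ((t * x) * (t * y)) + (c (1,0,1) * ((t * x) * (t * z)) + c (0,1,1) * ((t * y) * (t * z))))))))))"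
        unfolding low_degree_set by (simp add: monomial3_def)
      then show ?thesis by (simp add: power_mult_distrib distrib_left distrib_right ac_simps power2_eq_square)
    qed
    note q = quadratic_zero_of_cubic_bound[OF \<delta>' key[OF v, unfolded eq]]
    show ?thesis using q by (intro conjI)
  qed
  \<comment> \<open>The unit vectors isolate the pure coefficients; sums of two unit vectors then
    isolate the mixed ones.\<close>
  have 1: "c (0,0,0) = 0" "c (1,0,0) = 0" "c (0,1,0) = 0" "c (0,0,1) = 0" "c (2,0,0) = 0" "c (0,2,0) = 0" "c (0,0,2) = 0"
    using P[of 1 0 0] P[of 0 1 0] P[of 0 0 1] by auto
  then have 2: "c (1,1,0) = 0" "c (1,0,1) = 0" "c (0,1,1) = 0"
    using P[of 1 1 0] P[of 1 0 1] P[of 0 1 1] by auto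
  have "m \<in> ?A" using m by simp
  then show ?thesis unfolding low_degree_set using 1 2 by auto
qed

text \<open>\<open>taylor_coeffs\<close> is an expansion by the property of the choice operator; its
  absolute summability at (r, r, r) controls the complex polydisc of radius r.\<close>

lemma complexify_facts:
  assumes F: "real_analytic_at_0 F" and O: "F \<in> O[nhds 0](\<lambda>p. norm p ^ 3)"
  obtains r where "0 < r" "cubic (taylor_coeffs F) r"
    "\<And>x y z. norm x < r \<Longrightarrow> norm y < r \<Longrightarrow> norm z < r \<Longrightarrow> (x, y, z) \<in> convergence_domain F"
    "\<And>x y z. norm x < r \<Longrightarrow> norm y < r \<Longrightarrow> norm z < r \<Longrightarrow>
      (\<lambda>n. case triple n of (i, j, k) \<Rightarrow> of_real (taylor_coeffs F (i, j, k)) * (x ^ i * y ^ j * z ^ k)) sums complexify F (x, y, z)"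
proof -
  let ?c = "taylor_coeffs F"
  have exp: "has_expansion F ?c"
    using F unfolding real_analytic_at_0_def taylor_coeffs_def by (rule someI_ex)
  obtain r where r: "0 < r" "(\<lambda>m. \<bar>?c m\<bar> * r ^ deg m) summable_on UNIV"
    by (rule expansion_abs_summable[OF exp], rule that)
  have cub: "cubic ?c r"
    unfolding cubic_def
  proof (intro conjI allI impI)
    show "?c m = 0" if "deg m < 3" for m by (rule low_coefficients_vanish[OF exp O that])
    have "(\<lambda>n. \<bar>?c (triple n)\<bar> * r ^ deg (triple n)) summable_on UNIV"
      using r(2) summable_on_reindex_bij_betw[OF bij_triple, of "\<lambda>m. \<bar>?c m\<bar> * r ^ deg m"] by simp
    then show "summable (\<lambda>n. \<bar>?c (triple n)\<bar> * r ^ deg (triple n))"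
      by (rule summable_on_imp_summable)
  qed
  have smb: "(\<lambda>m. ?c m *\<^sub>R monomial3 (x, y, z) m) summable_on UNIV" if "norm x < r" "norm y < r" "norm z < r" for x y z :: complex
  proof (rule Infinite_Sum.abs_summable_summable[OF Infinite_Sum.abs_summable_on_comparison_test[where g="\<lambda>m. complex_of_real (\<bar>?c m\<bar> * r ^ deg m)"]])
    show "(\<lambda>m. norm (complex_of_real (\<bar>?c m\<bar> * r ^ deg m))) summable_on UNIV"
      using r by (simp add: norm_mult norm_power)
    show "norm (?c m *\<^sub>R monomial3 (x, y, z) m) \<le> norm (complex_of_real (\<bar>?c m\<bar> * r ^ deg m))" for m
      using norm_monomial3_le[of x r y z m] that r(1) by (simp add: mult_left_mono norm_mult norm_power)
  qed
  show ?thesis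
  proof (rule that[OF r(1) cub])
    fix x y z :: complex assume n: "norm x < r" "norm y < r" "norm z < r"
    \<comment> \<open>The domain of convergence is defined as an interior, so a whole open polydisc
      is exhibited.\<close>
    have "ball (0::complex) r \<times> ball (0::complex) r \<times> ball (0::complex) r \<subseteq> {p. (\<lambda>m. ?c m *\<^sub>R monomial3 p m) summable_on (UNIV :: (nat \<times> nat \<times> nat) set)}"
      using smb by auto
    then have "ball 0 r \<times> ball 0 r \<times> ball 0 r \<subseteq> convergence_domain F"
      unfolding convergence_domain_def by (rule interior_maximal) (intro open_Times open_ball)
    then show "(x, y, z) \<in> convergence_domain F" using n by auto
    have "((\<lambda>m. ?c m *\<^sub>R monomial3 (x, y, z) m) has_sum complexify F (x, y, z)) UNIV"
      unfolding complexify_def using smb[OF n] by simp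
    then have "((\<lambda>n. ?c (triple n) *\<^sub>R monomial3 (x, y, z) (triple n)) has_sum complexify F (x, y, z)) UNIV"
      using has_sum_reindex_bij_betw[OF bij_triple, of "\<lambda>m. ?c m *\<^sub>R monomial3 (x, y, z) m"] by simp
    then have "(\<lambda>n. ?c (triple n) *\<^sub>R monomial3 (x, y, z) (triple n)) sums complexify F (x, y, z)"
      by (rule has_sum_imp_sums)
    moreover have "(\<lambda>n. ?c (triple n) *\<^sub>R monomial3 (x, y, z) (triple n)) = (\<lambda>n. case triple n of (i, j, k) \<Rightarrow> of_real (?c (i, j, k)) * (x ^ i * y ^ j * z ^ k))"
      by (auto simp: monomial3_def scaleR_conv_of_real fun_eq_iff split: prod.splits)
    ultimately show "(\<lambda>n. case triple n of (i, j, k) \<Rightarrow> of_real (?c (i, j, k)) * (x ^ i * y ^ j * z ^ k)) sums complexify F (x, y, z)"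
      by simp
  qed
qed

section \<open>The weight and the wedge\<close>

text \<open>
  The denominator makes \<open>\<mu> * \<mu> \<le> \<mu>\<close> hold: \<open>1 / ((1 + p\<^sup>2) (1 + q\<^sup>2))\<close> is at most \<open>2 / (1 + (p + q)\<^sup>2)\<close> times
  the sum of the two factors, whose integral is bounded, whereas \<open>exp * exp = t exp t\<close> loses a factor.
\<close>

definition weight :: "real \<Rightarrow> real \<Rightarrow> real" where
  "weight \<eta> t = \<eta> / (4 * pi) * (exp (\<eta> * t) / (1 + (\<eta> * t)\<^sup>2))"

lemma one_plus_square_pos: "0 < 1 + (x::real)\<^sup>2"
  by (simp add: add_pos_nonneg)

text \<open>The numerator of the derivative is exp x (1 - x)^2. It has a double zero at 1, so a
  larger coefficient of x^2 would destroy the monotonicity.\<close>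

lemma exp_over_square_mono:
  fixes x y :: real
  assumes "x \<le> y" shows "exp x / (1 + x\<^sup>2) \<le> exp y / (1 + y\<^sup>2)"
proof (rule DERIV_nonneg_imp_nondecreasing[OF assms])
  fix x :: real
  have "((\<lambda>x. exp x / (1 + x\<^sup>2)) has_real_derivative (exp x * (1 + x\<^sup>2) - exp x * (2 * x)) / ((1 + x\<^sup>2) * (1 + x\<^sup>2))) (at x)"
    using one_plus_square_pos[of x] by (auto intro!: derivative_eq_intros)
  moreover have "exp x * (1 + x\<^sup>2) - exp x * (2 * x) = exp x * (1 - x)\<^sup>2"
    by (simp add: power2_eq_square algebra_simps)
  then have "0 \<le> (exp x * (1 + x\<^sup>2) - exp x * (2 * x)) / ((1 + x\<^sup>2) * (1 + x\<^sup>2))"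
    using one_plus_square_pos[of x] by simp
  ultimately show "\<exists>y. ((\<lambda>x. exp x / (1 + x\<^sup>2)) has_real_derivative y) (at x) \<and> 0 \<le> y" by blast
qed

lemma inverse_square_product_le:
  fixes p q :: real
  shows "1 / ((1 + p\<^sup>2) * (1 + q\<^sup>2)) \<le> 2 / (1 + (p + q)\<^sup>2) * (1 / (1 + p\<^sup>2) + 1 / (1 + q\<^sup>2))"
proof -
  note pos = one_plus_square_pos[of p] one_plus_square_pos[of q] one_plus_square_pos[of "p + q"]
  have "1 + (p + q)\<^sup>2 \<le> 2 * ((1 + q\<^sup>2) + (1 + p\<^sup>2))"
    using zero_le_power2[of "p - q"] zero_le_power2[of p] zero_le_power2[of q] by (simp add: power2_eq_square algebra_simps)
  then have "(1 + (p + q)\<^sup>2) / ((1 + (p + q)\<^sup>2) * ((1 + p\<^sup>2) * (1 + q\<^sup>2))) \<le> 2 * ((1 + q\<^sup>2) + (1 + p\<^sup>2)) / ((1 + (p + q)\<^sup>2) * ((1 + p\<^sup>2) * (1 + q\<^sup>2)))"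
    using pos by (intro divide_right_mono) auto
  moreover have "1 / (1 + p\<^sup>2) + 1 / (1 + q\<^sup>2) = ((1 + q\<^sup>2) + (1 + p\<^sup>2)) / ((1 + p\<^sup>2) * (1 + q\<^sup>2))"
    using pos by (simp add: add_frac_eq less_imp_neq[symmetric])
  ultimately show ?thesis using pos by simp
qed

text \<open>Once exp(\<eta> t) is factored out, the remaining integrals are arctangents with total
  at most \<pi>; the factor 1 / (4 \<pi>) in \<open>weight\<close> turns the result into half of
  \<open>weight \<eta> t\<close>.\<close>

lemma weight_conv:
  assumes \<eta>: "0 < \<eta>" and t: "0 \<le> t"
  shows "t * (\<integral>\<tau>. weight \<eta> (\<tau> * t) * weight \<eta> ((1 - \<tau>) * t) \<partial>U01) \<le> weight \<eta> t"
proof -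
  let ?x = "\<eta> * t" let ?c = "\<eta> / (4 * pi)"
  let ?g = "\<lambda>\<tau>. 1 / (1 + (\<tau> * ?x)\<^sup>2) + 1 / (1 + ((1 - \<tau>) * ?x)\<^sup>2)"
  let ?A = "?c * ?c * exp ?x * (2 / (1 + ?x\<^sup>2))"
  have A: "0 \<le> ?A" using \<eta> one_plus_square_pos[of ?x] by simp
  have g1: "\<bar>1 / (1 + y\<^sup>2)\<bar> \<le> (1::real)" for y using one_plus_square_pos[of y] by (simp add: divide_le_eq)
  have gi: "integrable U01 ?g"
  proof (rule integrable_U01[where B=2])
    show "continuous_on {0<..<1} ?g"
      using one_plus_square_pos by (intro continuous_intros) (auto simp: less_imp_neq[symmetric])
    show "norm (?g \<tau>) \<le> 2" for \<tau>
      using g1[of "\<tau> * ?x"] g1[of "(1 - \<tau>) * ?x"] abs_triangle_ineq[of "1 / (1 + (\<tau> * ?x)\<^sup>2)" "1 / (1 + ((1 - \<tau>) * ?x)\<^sup>2)"]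
      by simp
  qed
  have le: "norm (weight \<eta> (\<tau> * t) * weight \<eta> ((1 - \<tau>) * t)) \<le> ?A * ?g \<tau>" for \<tau>
  proof -
    let ?p = "\<tau> * ?x" and ?q = "(1 - \<tau>) * ?x"
    have pq: "?p + ?q = ?x" by (simp add: algebra_simps)
    have w: "weight \<eta> (s * t) = ?c * (exp (s * ?x) / (1 + (s * ?x)\<^sup>2))" for s
      by (simp only: weight_def mult.left_commute[of \<eta>])
    have m: "(k * (u / v)) * (k * (y / z)) = k * k * (u * y) * (1 / (v * z))" for k u v y z :: real
      by simp
    have "exp ?p * exp ?q = exp ?x" unfolding exp_add[symmetric] pq ..
    then have "weight \<eta> (\<tau> * t) * weight \<eta> ((1 - \<tau>) * t) = ?c * ?c * exp ?x * (1 / ((1 + ?p\<^sup>2) * (1 + ?q\<^sup>2)))"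
      unfolding w m by simp
    also have "\<dots> \<le> ?c * ?c * exp ?x * (2 / (1 + (?p + ?q)\<^sup>2) * ?g \<tau>)"
      using inverse_square_product_le[of ?p ?q] \<eta> by (intro mult_left_mono) auto
    finally have "weight \<eta> (\<tau> * t) * weight \<eta> ((1 - \<tau>) * t) \<le> ?A * ?g \<tau>" unfolding pq by (simp only: mult.assoc)
    moreover have "0 \<le> weight \<eta> (\<tau> * t) * weight \<eta> ((1 - \<tau>) * t)"
      unfolding weight_def using \<eta> one_plus_square_pos by (intro mult_nonneg_nonneg divide_nonneg_pos) (auto intro: less_imp_le)
    ultimately show ?thesis by simp
  qed
  have "(\<integral>\<tau>. weight \<eta> (\<tau> * t) * weight \<eta> ((1 - \<tau>) * t) \<partial>U01) \<le> (\<integral>\<tau>. ?A * ?g \<tau> \<partial>U01)"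
    using norm_integral_U01_le[of "\<lambda>\<tau>. weight \<eta> (\<tau> * t) * weight \<eta> ((1 - \<tau>) * t)" "\<lambda>\<tau>. ?A * ?g \<tau>"] le gi
    by simp
  then have "t * (\<integral>\<tau>. weight \<eta> (\<tau> * t) * weight \<eta> ((1 - \<tau>) * t) \<partial>U01) \<le> t * (?A * (\<integral>\<tau>. ?g \<tau> \<partial>U01))"
    using t by (intro mult_left_mono) auto
  also have "\<dots> = ?A / \<eta> * (\<integral>\<tau>. ?x * ?g \<tau> \<partial>U01)"
    using \<eta> gi by (simp del: of_real_mult)
  also have "(\<integral>\<tau>. ?x * ?g \<tau> \<partial>U01) = (arctan (1 * ?x) - arctan ((1 - 1) * ?x)) - (arctan (0 * ?x) - arctan ((1 - 0) * ?x))"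
  proof (rule integral_U01_FTC)
    show "continuous_on {0..1} (\<lambda>\<tau>. arctan (\<tau> * ?x) - arctan ((1 - \<tau>) * ?x))" by (intro continuous_intros)
    show "integrable U01 (\<lambda>\<tau>. ?x * ?g \<tau>)" using gi by (rule integrable_mult_right)
    show "((\<lambda>\<tau>. arctan (\<tau> * ?x) - arctan ((1 - \<tau>) * ?x)) has_vector_derivative ?x * ?g \<tau>) (at \<tau>)" for \<tau>
      unfolding has_real_derivative_iff_has_vector_derivative[symmetric]
      by (auto intro!: derivative_eq_intros simp: field_simps)
  qed
  also have "\<dots> = 2 * arctan ?x" by simp
  also have "?A / \<eta> * (2 * arctan ?x) \<le> ?A / \<eta> * pi"
    using arctan_ubound[of ?x] \<eta> A by (intro mult_left_mono divide_nonneg_pos) auto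
  also have "?A / \<eta> * pi = weight \<eta> t / 2"
    using \<eta> by (simp add: weight_def)
  also have "\<dots> \<le> weight \<eta> t"
  proof -
    have "0 \<le> weight \<eta> t" unfolding weight_def using \<eta> one_plus_square_pos[of ?x] by simp
    then show ?thesis by simp
  qed
  finally show ?thesis .
qed

lemma weight_le: "0 < \<eta> \<Longrightarrow> weight \<eta> t \<le> \<eta> / (4 * pi) * exp (\<eta> * t)"
  unfolding weight_def using one_plus_square_pos[of "\<eta> * t"]
  by (intro mult_left_mono) (auto simp: divide_le_eq)

lemma weight_mono: "0 < \<eta> \<Longrightarrow> s \<le> t \<Longrightarrow> weight \<eta> s \<le> weight \<eta> t"
  unfolding weight_def by (intro mult_left_mono exp_over_square_mono) auto

definition wedge :: "real \<Rightarrow> real \<Rightarrow> complex set" where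
  "wedge r m = {w. \<bar>Im w\<bar> < r + m * \<bar>Re w\<bar>}"

lemma borel_domain_wedge:
  assumes \<eta>: "0 < \<eta>" and r: "0 < r" and m: "0 \<le> m"
  shows "borel_domain (wedge r m) (weight \<eta>) (4 * pi / \<eta>)"
proof
  have "wedge r m = (\<lambda>w. \<bar>Im w\<bar> - m * \<bar>Re w\<bar>) -` {..<r}" by (auto simp: wedge_def)
  moreover have "open ((\<lambda>w. \<bar>Im w\<bar> - m * \<bar>Re w\<bar>) -` {..<r})"
    by (intro open_vimage continuous_intros open_lessThan)
  ultimately show "open (wedge r m)" by simp
  show "0 \<in> wedge r m" using r by (simp add: wedge_def)
  show "of_real t * w \<in> wedge r m" if "w \<in> wedge r m" "0 \<le> t" "t \<le> 1" for w t
  proof (cases "t = 0")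
    case False
    have "t * \<bar>Im w\<bar> < t * (r + m * \<bar>Re w\<bar>)" using that False by (simp add: wedge_def)
    also have "\<dots> \<le> r + m * (t * \<bar>Re w\<bar>)" using that(2,3) r by (simp add: distrib_left mult_left_le_one_le)
    finally show ?thesis using that(2) by (simp add: wedge_def abs_mult)
  qed (use r in \<open>simp add: wedge_def\<close>)
  show "0 < 4 * pi / \<eta>" using \<eta> by simp
  show "weight \<eta> s \<le> weight \<eta> t" if "0 \<le> s" "s \<le> t" for s t by (rule weight_mono[OF \<eta> that(2)])
  show "1 \<le> 4 * pi / \<eta> * weight \<eta> t" if "0 \<le> t" for t
    using exp_over_square_mono[of 0 "\<eta> * t"] that \<eta> by (simp add: weight_def)
  show "continuous_on {0..} (weight \<eta>)"
    unfolding weight_def[abs_def] using one_plus_square_pos by (intro continuous_intros) (auto simp: less_imp_neq[symmetric])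
  show "t * (\<integral>\<tau>. weight \<eta> (\<tau> * t) * weight \<eta> ((1 - \<tau>) * t) \<partial>U01) \<le> weight \<eta> t" if "0 \<le> t" for t
    by (rule weight_conv[OF \<eta> that])
qed

text \<open>Membership in the wedge gives norm \<beta> \<le> (1 + m) \<bar>Re \<beta>\<bar> + 1 /
  (16 \<pi>) for \<beta> = b w, and \<rho> is the value of \<bar>Re \<beta>\<bar> at which the two
  terms are equal. Below it norm \<beta> \<le> 1 / (8 \<pi>); above it the first term, doubled,
  dominates.\<close>

lemma wedge_dichotomy:
  assumes b: "b \<noteq> 0" and m: "0 \<le> m" and w: "w \<in> wedge (1 / (16 * pi * \<bar>b\<bar>)) m"
  defines "\<rho> \<equiv> 1 / (16 * pi * (1 + m))"
  shows "norm (2 * of_real pi * (of_real b * w)) \<le> 1/4 \<or>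
      (\<rho> \<le> \<bar>Re (of_real b * w)\<bar> \<and> norm (of_real b * w) \<le> 2 * (1 + m) * \<bar>Re (of_real b * w)\<bar>)"
proof -
  let ?\<beta> = "of_real b * w"
  have mr: "(1 + m) * \<rho> = 1 / (16 * pi)" using m by (simp add: \<rho>_def)
  have "\<bar>b\<bar> * \<bar>Im w\<bar> \<le> \<bar>b\<bar> * (1 / (16 * pi * \<bar>b\<bar>) + m * \<bar>Re w\<bar>)"
    using w by (intro mult_left_mono) (auto simp: wedge_def)
  then have "\<bar>Im ?\<beta>\<bar> \<le> 1 / (16 * pi) + m * \<bar>Re ?\<beta>\<bar>"
    using b by (simp add: abs_mult distrib_left mult.left_commute)
  then have n: "norm ?\<beta> \<le> (1 + m) * \<bar>Re ?\<beta>\<bar> + 1 / (16 * pi)"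
    using cmod_le[of ?\<beta>] by (simp only: distrib_right mult_1_left)
  show ?thesis
  proof (cases "\<rho> \<le> \<bar>Re ?\<beta>\<bar>")
    case True
    then have "(1 + m) * \<rho> \<le> (1 + m) * \<bar>Re ?\<beta>\<bar>" using m by (intro mult_left_mono) auto
    then have "norm ?\<beta> \<le> 2 * (1 + m) * \<bar>Re ?\<beta>\<bar>" using n mr by linarith
    then show ?thesis using True by blast
  next
    case False
    then have "(1 + m) * \<bar>Re ?\<beta>\<bar> \<le> (1 + m) * \<rho>" using m by (intro mult_left_mono) auto
    then have "norm ?\<beta> \<le> 1 / (16 * pi) + 1 / (16 * pi)" using n mr by linarith
    then have "2 * pi * norm ?\<beta> \<le> 2 * pi * (1 / (16 * pi) + 1 / (16 * pi))" by (intro mult_left_mono) auto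
    also have "\<dots> = 1/4" by simp
    finally have "norm (2 * of_real pi * ?\<beta>) \<le> 1/4" by (simp add: norm_mult)
    then show ?thesis by blast
  qed
qed

text \<open>The parameter \<open>t\<close> may be negative, as the wedge is symmetric about 0; the
  rays near the direction \<pi> are obtained in this way.\<close>

lemma ray_in_wedge:
  assumes \<kappa>: "\<bar>\<psi>\<bar> < \<kappa>" "\<kappa> < pi / 2" and r: "0 < r"
  shows "of_real t * cis \<psi> \<in> wedge r (tan \<kappa>)"
proof -
  have c: "cos \<psi> > 0" using \<kappa> by (intro cos_gt_zero_pi) auto
  have "\<bar>sin \<psi>\<bar> \<le> tan \<kappa> * cos \<psi>"
  proof -
    have "tan \<psi> \<le> tan \<kappa>" "tan (- \<psi>) \<le> tan \<kappa>"
      by (rule tan_mono_le; use \<kappa> in linarith)+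
    then have "tan \<psi> * cos \<psi> \<le> tan \<kappa> * cos \<psi>" "- tan \<psi> * cos \<psi> \<le> tan \<kappa> * cos \<psi>"
      using c mult_right_mono[of "tan \<psi>" "tan \<kappa>" "cos \<psi>"] mult_right_mono[of "- tan \<psi>" "tan \<kappa>" "cos \<psi>"] by auto
    moreover have "tan \<psi> * cos \<psi> = sin \<psi>" using c by (simp add: tan_def)
    ultimately show ?thesis by auto
  qed
  then have "\<bar>t\<bar> * \<bar>sin \<psi>\<bar> \<le> \<bar>t\<bar> * (tan \<kappa> * cos \<psi>)" by (intro mult_left_mono) auto
  then show ?thesis using c r by (simp add: wedge_def abs_mult mult.left_commute)
qed

lemma ray_in_wedge_minus:
  assumes "\<bar>\<psi> - pi\<bar> < \<kappa>" "\<kappa> < pi / 2" and r: "0 < r"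
  shows "of_real t * cis \<psi> \<in> wedge r (tan \<kappa>)"
proof -
  have "of_real t * cis \<psi> = of_real (- t) * cis (\<psi> - pi)"
    by (simp add: complex_eq_iff)
  then show ?thesis using ray_in_wedge[OF assms, of "- t"] by simp
qed

lemma ball_subset_wedge: "0 \<le> m \<Longrightarrow> ball 0 r \<subseteq> wedge r m"
proof
  fix w :: complex assume m: "0 \<le> m" and w: "w \<in> ball 0 r"
  have "\<bar>Im w\<bar> < r" using abs_Im_le_cmod[of w] w by simp
  moreover have "0 \<le> m * \<bar>Re w\<bar>" using m by simp
  ultimately show "w \<in> wedge r m" unfolding wedge_def by simp
qed

text \<open>The ray of argument \<open>Arg x / 2\<close> stays in the wedge although \<open>\<bar>Arg x\<bar>\<close> may exceed \<open>\<pi> / 2\<close>.\<close>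

lemma Re_cis_half_angle:
  assumes x: "x \<noteq> 0" and "\<bar>Arg x\<bar> < 2 * \<kappa>" "\<kappa> < pi / 2"
  shows "cos \<kappa> / norm x \<le> Re (cis (Arg x / 2) / x)"
proof -
  have "cis (Arg x / 2) / x = cis (- Arg x / 2) / of_real (norm x)"
  proof -
    have "cis (Arg x / 2) / x = cis (Arg x / 2) / (of_real (norm x) * cis (Arg x))"
      using rcis_cmod_Arg[of x] by (simp add: rcis_def)
    also have "\<dots> = (cis (Arg x / 2) / cis (Arg x)) / of_real (norm x)" by simp
    also have "cis (Arg x / 2) / cis (Arg x) = cis (- Arg x / 2)" by (simp add: cis_divide)
    finally show ?thesis .
  qed
  then have "Re (cis (Arg x / 2) / x) = cos (Arg x / 2) / norm x"
    by (simp add: Re_divide_of_real)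
  moreover have "cos (Arg x / 2) = cos \<bar>Arg x / 2\<bar>" by (simp only: cos_abs_real)
  moreover have "cos \<kappa> \<le> cos \<bar>Arg x / 2\<bar>" using assms by (intro cos_monotone_0_pi_le) auto
  ultimately show ?thesis by (simp add: divide_right_mono)
qed

section \<open>Invariant graphs\<close>

locale invariant_manifold = nonlinear + borel_laplace +
  fixes F G H :: "real \<times> real \<times> real \<Rightarrow> real"
  assumes a_phi0: "of_real a * \<phi>0\<^sup>2 = - (1 + of_real b)"
    and dom: "\<And>x y z. norm x < r \<Longrightarrow> norm y < r \<Longrightarrow> norm z < r \<Longrightarrow>
      (x, y, z) \<in> convergence_domain F \<inter> convergence_domain G \<inter> convergence_domain H"
    and sumF: "\<And>x y z. norm x < r \<Longrightarrow> norm y < r \<Longrightarrow> norm z < r \<Longrightarrow>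
      (\<lambda>n. case triple n of (i, j, k) \<Rightarrow> of_real (cF (i, j, k)) * (x ^ i * y ^ j * z ^ k)) sums complexify F (x, y, z)"
    and sumG: "\<And>x y z. norm x < r \<Longrightarrow> norm y < r \<Longrightarrow> norm z < r \<Longrightarrow>
      (\<lambda>n. case triple n of (i, j, k) \<Rightarrow> of_real (cG (i, j, k)) * (x ^ i * y ^ j * z ^ k)) sums complexify G (x, y, z)"
    and sumH: "\<And>x y z. norm x < r \<Longrightarrow> norm y < r \<Longrightarrow> norm z < r \<Longrightarrow>
      (\<lambda>n. case triple n of (i, j, k) \<Rightarrow> of_real (cH (i, j, k)) * (x ^ i * y ^ j * z ^ k)) sums complexify H (x, y, z)"
begin

text \<open>Forgets the radius, so that the rules for the Laplace transform become rewrite rules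
  whose side conditions can be discharged automatically.\<close>

definition admissible :: "borel_fun \<Rightarrow> bool" where
  "admissible g \<longleftrightarrow> (\<exists>R. elem R g)"

lemma admissible_add: "admissible g \<Longrightarrow> admissible h \<Longrightarrow> admissible (\<lambda>w \<theta>. g w \<theta> + h w \<theta>)"
  and admissible_diff: "admissible g \<Longrightarrow> admissible h \<Longrightarrow> admissible (\<lambda>w \<theta>. g w \<theta> - h w \<theta>)"
  and admissible_conv: "admissible g \<Longrightarrow> admissible h \<Longrightarrow> admissible (conv g h)"
  and admissible_J: "admissible g \<Longrightarrow> admissible (J g)"
  and admissible_cmult: "admissible g \<Longrightarrow> admissible (\<lambda>w \<theta>. c * g w \<theta>)"
  and admissible_cos: "admissible g \<Longrightarrow> admissible (\<lambda>w \<theta>. cos \<theta> * g w \<theta>)"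
  and admissible_sin: "admissible g \<Longrightarrow> admissible (\<lambda>w \<theta>. sin \<theta> * g w \<theta>)"
  and admissible_one: "admissible (\<lambda>w \<theta>. 1)"
  unfolding admissible_def
  by (blast intro: elem_add, blast intro: elem_diff, blast intro: elem_conv, blast intro: elem_J,
      blast intro: elem_cmult, blast intro: elem_scale[OF coef_cos], blast intro: elem_scale[OF coef_sin],
      blast intro: elem_one)

lemmas admissible_rules = admissible_add admissible_diff admissible_conv admissible_J admissible_cmult admissible_cos admissible_sin

context
  fixes f :: "borel_fun"
  assumes f: "elem (\<rho> * \<epsilon>) f"
    and fixpoint: "\<And>w \<theta>. w \<in> \<Omega> \<Longrightarrow> \<theta> \<in> strip 1 \<Longrightarrow>
      \<phi>0 * defect f w \<theta> + conv (U_op f) (defect f) w \<theta> + conv (J (twist f)) (S_op f) w \<theta> = 0"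
begin

lemma admissible_basic: "admissible f" "admissible (U_op f)" "admissible (V_op f)" "admissible (S_op f)" "admissible (J (K f))"
    "admissible (ser cF \<phi>0 (U_op f))" "admissible (ser cG \<phi>0 (U_op f))" "admissible (ser cH \<phi>0 (U_op f))"
  unfolding admissible_def
  using f basics(1-6)[unfolded first_order_def] second_order_JK[unfolded second_order_def] lipschitz_op_elem[OF _ f] by blast+

lemma admissible_quad: "admissible (quad f)"
  unfolding quad_def by (intro admissible_rules admissible_basic)

lemma admissible_high: "admissible (high f)"
  unfolding high_def by (intro admissible_rules admissible_basic admissible_quad)

lemma admissible_lead: "admissible (lead f)"
  unfolding lead_def by (intro admissible_rules admissible_basic)

lemma admissible_defect: "admissible (defect f)"
  unfolding defect_def by (intro admissible_rules admissible_basic admissible_high admissible_lead)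

lemma admissible_twist: "admissible (twist f)"
  unfolding twist_def by (intro admissible_rules admissible_basic)

context
  fixes \<psi> :: real and x \<theta> :: complex
  assumes \<psi>: "direction \<psi>" and \<theta>: "\<theta> \<in> strip 1" and conv_x: "\<eta> < Re (cis \<psi> / x)"
begin

abbreviation L where "L g \<equiv> laplace \<psi> g x \<theta>"

lemma L_add: "admissible g \<Longrightarrow> admissible h \<Longrightarrow> L (\<lambda>w \<theta>. g w \<theta> + h w \<theta>) = L g + L h"
  and L_diff: "admissible g \<Longrightarrow> admissible h \<Longrightarrow> L (\<lambda>w \<theta>. g w \<theta> - h w \<theta>) = L g - L h"
  and L_conv: "admissible g \<Longrightarrow> admissible h \<Longrightarrow> L (conv g h) = L g * L h"
  and L_J: "admissible g \<Longrightarrow> L (J g) = x * L g"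
  and L_cmult: "L (\<lambda>w \<theta>. c * g w \<theta>) = c * L g"
  and L_cos: "L (\<lambda>w \<theta>. cos \<theta> * g w \<theta>) = cos \<theta> * L g"
  and L_sin: "L (\<lambda>w \<theta>. sin \<theta> * g w \<theta>) = sin \<theta> * L g"
  unfolding admissible_def using laplace_add[OF \<psi> \<theta> conv_x] laplace_diff[OF \<psi> \<theta> conv_x] laplace_conv[OF \<psi> \<theta> conv_x] laplace_J[OF \<psi> \<theta> conv_x]
  by (blast, blast, blast, blast) (rule laplace_scale)+

lemmas L_rules = L_add L_diff L_conv L_J L_cmult L_cos L_sin admissible_rules admissible_basic

lemma L_linear:
  "L (S_op f) + of_real b * L (V_op f) + of_real (3 * b + 2) * (L (U_op f) - L (J (K f))) = L f"
proof -
  have "L f = L (\<lambda>w \<theta>. S_op f w \<theta> + of_real b * V_op f w \<theta> + of_real (3 * b + 2) * (U_op f w \<theta> - J (K f) w \<theta>))"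
    by (rule laplace_cong[OF \<psi>]) (rule linear_relation[symmetric])
  then show ?thesis by (simp only: L_rules)
qed

lemma L_defect:
  defines "u \<equiv> L (U_op f)" and "v \<equiv> L (V_op f)"
  defines "Fv \<equiv> L (ser cF \<phi>0 (U_op f))" and "Gv \<equiv> L (ser cG \<phi>0 (U_op f))" and "Hv \<equiv> L (ser cH \<phi>0 (U_op f))"
  shows "L (defect f) = L f - ((2 * of_real a * \<phi>0 * u + of_real a * (u * u)) * (v + u)
     + 3 * of_real a * \<phi>0 * (u * u) + of_real a * (u * u * u) - Fv * (v + u) - u * Fv
     - of_real (3 * b + 2) * L (J (K f)) + (cos \<theta> * Gv + sin \<theta> * Hv - \<phi>0 * Fv))"
proof -
  have Q: "L (quad f) = 2 * of_real a * \<phi>0 * u + of_real a * (u * u)"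
    unfolding quad_def u_def by (simp only: L_rules)
  have "L (high f) = L (quad f) * (v + u)
     + 3 * of_real a * \<phi>0 * (u * u) + of_real a * (u * u * u) - Fv * (v + u) - u * Fv
     - of_real (3 * b + 2) * L (J (K f))"
    unfolding high_def u_def v_def Fv_def
    by (simp only: L_add L_diff L_conv L_cmult admissible_rules admissible_basic admissible_quad)
  moreover have "L (lead f) = cos \<theta> * Gv + sin \<theta> * Hv - \<phi>0 * Fv"
    unfolding lead_def Fv_def Gv_def Hv_def by (simp only: L_rules)
  moreover have "L (defect f) = L f - (L (high f) + L (lead f))"
    unfolding defect_def by (simp only: L_rules admissible_high admissible_lead)
  ultimately show ?thesis by (simp only: Q)
qed

lemma L_fixpoint:
  "\<phi>0 * L (defect f) + L (U_op f) * L (defect f)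
    + x * (cos \<theta> * L (ser cH \<phi>0 (U_op f)) - sin \<theta> * L (ser cG \<phi>0 (U_op f))) * L (S_op f) = 0"
proof -
  have T: "L (twist f) = cos \<theta> * L (ser cH \<phi>0 (U_op f)) - sin \<theta> * L (ser cG \<phi>0 (U_op f))"
    unfolding twist_def by (simp only: L_rules)
  have "L (\<lambda>w \<theta>. \<phi>0 * defect f w \<theta> + conv (U_op f) (defect f) w \<theta> + conv (J (twist f)) (S_op f) w \<theta>) = L (\<lambda>w \<theta>. 0)"
    by (rule laplace_cong[OF \<psi>]) (rule fixpoint[OF _ \<theta>])
  also have "\<dots> = 0" using L_cmult[of 0 "\<lambda>w \<theta>. 0"] by simp
  finally show ?thesis
    by (simp only: L_rules admissible_defect admissible_twist T)
qed

lemma L_x_phi_monomial: "L (x_phi_monomial \<phi>0 (U_op f) n p) = x ^ Suc n * (\<phi>0 + L (U_op f)) ^ p \<and> admissible (x_phi_monomial \<phi>0 (U_op f) n p)"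
proof (induction p)
  case 0
  have "L ((J ^^ n) (\<lambda>w \<theta>. 1)) = x ^ Suc n \<and> admissible ((J ^^ n) (\<lambda>w \<theta>. 1))"
    by (induction n) (simp_all add: admissible_one admissible_J L_J laplace_one[OF \<psi> \<theta> conv_x])
  then show ?case by simp
next
  case (Suc p)
  then show ?case
    by (simp only: x_phi_monomial.simps L_rules admissible_conv simp_thms) (simp add: algebra_simps)
qed

text \<open>Transform term by term: multiplied by x^2, the transform of each term is the monomial at
  (x, x \<phi> cos \<theta>, x \<phi> sin \<theta>).\<close>

lemma L_ser:
  assumes c: "cubic c r" and kap: "(6 * (norm \<phi>0 + 1) / r) ^ 3 * weight_sum c r \<le> \<kappa>"
  defines "\<phi> \<equiv> \<phi>0 + L (U_op f)"
  assumes sums: "(\<lambda>n. case triple n of (i, j, k) \<Rightarrow> of_real (c (i, j, k)) * (x ^ i * (x * \<phi> * cos \<theta>) ^ j * (x * \<phi> * sin \<theta>) ^ k)) sums s"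
  shows "x\<^sup>2 * L (ser c \<phi>0 (U_op f)) = s"
proof -
  define T where "T = (\<lambda>n w \<theta>. case triple n of (i, j, k) \<Rightarrow>
     (of_real (c (i, j, k)) * (cos \<theta> ^ j * sin \<theta> ^ k)) * x_phi_monomial \<phi>0 (U_op f) (i + j + k - 3) (j + k) w \<theta>)"
  obtain B where B: "summable B" "\<And>n. elem (B n) (T n)"
    using lipschitz_op_ser(2)[OF U_lipschitz_op C_rho _ c r eps_r kap f] C_ge unfolding T_def by auto
  have "(\<lambda>n. L (T n)) sums L (\<lambda>w \<theta>. \<Sum>n. T n w \<theta>)"
    by (rule laplace_suminf[OF \<psi> \<theta> conv_x B(2,1)])
  then have "(\<lambda>n. x\<^sup>2 * L (T n)) sums (x\<^sup>2 * L (ser c \<phi>0 (U_op f)))"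
    unfolding ser_def T_def by (rule sums_mult)
  moreover have "x\<^sup>2 * L (T n) = (case triple n of (i, j, k) \<Rightarrow> of_real (c (i, j, k)) * (x ^ i * (x * \<phi> * cos \<theta>) ^ j * (x * \<phi> * sin \<theta>) ^ k))" for n
  proof (cases "triple n")
    case (fields i j k)
    have LT: "L (T n) = (of_real (c (i, j, k)) * (cos \<theta> ^ j * sin \<theta> ^ k)) * (x ^ Suc (i + j + k - 3) * \<phi> ^ (j + k))"
      unfolding T_def fields prod.case \<phi>_def
      using laplace_scale[of \<psi> "\<lambda>\<theta>. of_real (c (i, j, k)) * (cos \<theta> ^ j * sin \<theta> ^ k)"] L_x_phi_monomial by simp
    have pw: "of_real (c (i, j, k)) * (x\<^sup>2 * x ^ Suc (i + j + k - 3)) = of_real (c (i, j, k)) * x ^ (i + j + k)"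
    proof (cases "i + j + k < 3")
      case True
      then have "c (i, j, k) = 0" using c unfolding cubic_def by (metis deg.simps)
      then show ?thesis by simp
    next
      case False
      then have "i + j + k = 2 + Suc (i + j + k - 3)" by simp
      then show ?thesis by (metis power_add)
    qed
    have "x\<^sup>2 * L (T n) = (of_real (c (i, j, k)) * (x\<^sup>2 * x ^ Suc (i + j + k - 3))) * (cos \<theta> ^ j * sin \<theta> ^ k * \<phi> ^ (j + k))"
      unfolding LT by (simp only: ac_simps)
    then have "x\<^sup>2 * L (T n) = (of_real (c (i, j, k)) * x ^ (i + j + k)) * (cos \<theta> ^ j * sin \<theta> ^ k * \<phi> ^ (j + k))"
      unfolding pw .
    then show ?thesis by (simp add: fields power_add power_mult_distrib ac_simps)
  qed
  ultimately show ?thesis using sums by (simp add: sums_unique2)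
qed

text \<open>As v + u = x u_x and x s = u_\<theta>, the two coefficients are the partial derivatives
  of x \<phi>; that they are derivatives is shown separately, so this lemma is pure algebra from the
  transformed equations.\<close>

lemma tangency:
  defines "u \<equiv> L (U_op f)" and "v \<equiv> L (V_op f)" and "s \<equiv> L (S_op f)"
  defines "\<phi> \<equiv> \<phi>0 + u"
  assumes nz: "\<phi> \<noteq> 0" and small: "norm x < r" "norm (x * \<phi> * cos \<theta>) < r" "norm (x * \<phi> * sin \<theta>) < r"
  shows "(x, x * \<phi>, \<theta>) \<in> cyl_domain F G H"
    and "case cyl_vfield a b F G H (x, x * \<phi>, \<theta>) of (x', \<rho>', \<theta>') \<Rightarrow> \<rho>' = (\<phi> + (v + u)) * x' + x * (x * s) * \<theta>'"
proof -
  have x: "x \<noteq> 0" by (rule x_nz[OF \<psi> \<theta> conv_x])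
  show "(x, x * \<phi>, \<theta>) \<in> cyl_domain F G H"
    using dom[OF small] x nz by (simp add: cyl_domain_def cyl_def)
  define Fv where "Fv = L (ser cF \<phi>0 (U_op f))"
  define Gv where "Gv = L (ser cG \<phi>0 (U_op f))"
  define Hv where "Hv = L (ser cH \<phi>0 (U_op f))"
  define d where "d = L (defect f)"
  define n where "n = L (J (K f))"
  let ?p = "(x, x * \<phi> * cos \<theta>, x * \<phi> * sin \<theta>)"
  have FGH: "complexify F ?p = x\<^sup>2 * Fv" "complexify G ?p = x\<^sup>2 * Gv" "complexify H ?p = x\<^sup>2 * Hv"
    unfolding Fv_def Gv_def Hv_def
    using L_ser[OF cub(1) kap(1) sumF[OF small, unfolded \<phi>_def u_def]]
      L_ser[OF cub(2) kap(2) sumG[OF small, unfolded \<phi>_def u_def]]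
      L_ser[OF cub(3) kap(3) sumH[OF small, unfolded \<phi>_def u_def]]
    by (simp_all only: \<phi>_def u_def)
  have 1: "s + of_real b * v + of_real (3 * b + 2) * (u - n) = L f"
    unfolding s_def v_def u_def n_def by (rule L_linear)
  have 2: "d = L f - ((2 * of_real a * \<phi>0 * u + of_real a * (u * u)) * (v + u)
     + 3 * of_real a * \<phi>0 * (u * u) + of_real a * (u * u * u) - Fv * (v + u) - u * Fv
     - of_real (3 * b + 2) * n + (cos \<theta> * Gv + sin \<theta> * Hv - \<phi>0 * Fv))"
    unfolding d_def u_def v_def n_def Fv_def Gv_def Hv_def by (rule L_defect)
  have 3: "\<phi> * d + x * (cos \<theta> * Hv - sin \<theta> * Gv) * s = 0"
    using L_fixpoint unfolding d_def \<phi>_def u_def Hv_def Gv_def s_def by (simp add: algebra_simps)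
  have ap: "of_real a * \<phi>0\<^sup>2 = - (1 + complex_of_real b)" by (rule a_phi0)
  let ?P = "cos \<theta> * Gv + sin \<theta> * Hv" and ?Q = "cos \<theta> * Hv - sin \<theta> * Gv"
  \<comment> \<open>The multiple of a \<phi>0^2 + 1 + b that is left when both sides of the next
    equation are expanded: \<phi>0 + v + 2 u comes from - 1 - a \<phi>0^2, another 2 u from 2 a
    \<phi>0^2 u.\<close>
  have z: "(\<phi>0 + v + 4 * u) * (of_real a * \<phi>0\<^sup>2 + (1 + complex_of_real b)) = 0"
    using ap by simp
  have d: "d = s - of_real b * \<phi> - ?P + (\<phi> + (v + u)) * (- 1 - of_real a * \<phi>\<^sup>2 + Fv)"
    unfolding 2 1[symmetric] \<phi>_def
    using z by (simp add: power2_eq_square algebra_simps)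
  \<comment> \<open>Eliminates the square of cos \<theta>, also inside products, so that the
    polynomial identities below close by normalization.\<close>
  have cs: "cos \<theta> * (cos \<theta> * z) = z - sin \<theta> * (sin \<theta> * z)" for z
  proof -
    have "cos \<theta> * (cos \<theta> * z) = (cos \<theta>)\<^sup>2 * z" by (simp add: power2_eq_square)
    also have "\<dots> = z - (sin \<theta>)\<^sup>2 * z" unfolding cos_squared_eq by (simp add: left_diff_distrib)
    finally show ?thesis by (simp add: power2_eq_square)
  qed
  have cs2: "cos \<theta> * cos \<theta> = 1 - sin \<theta> * sin \<theta>" using cs[of 1] by simp
  let ?x' = "- x\<^sup>2 - of_real a * ((x * \<phi> * cos \<theta>)\<^sup>2 + (x * \<phi> * sin \<theta>)\<^sup>2) + x\<^sup>2 * Fv"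
  let ?y' = "of_real b * x * (x * \<phi> * cos \<theta>) - x * \<phi> * sin \<theta> + x\<^sup>2 * Gv"
  let ?z' = "of_real b * x * (x * \<phi> * sin \<theta>) + x * \<phi> * cos \<theta> + x\<^sup>2 * Hv"
  have x': "?x' = x\<^sup>2 * (- 1 - of_real a * \<phi>\<^sup>2 + Fv)"
    by (simp add: power2_eq_square algebra_simps cs cs2)
  have \<rho>': "?y' * cos \<theta> + ?z' * sin \<theta> = x\<^sup>2 * (of_real b * \<phi> + ?P)"
    by (simp add: power2_eq_square algebra_simps cs cs2)
  have \<theta>': "(?z' * cos \<theta> - ?y' * sin \<theta>) / (x * \<phi>) = 1 + x * ?Q / \<phi>"
  proof -
    have "?z' * cos \<theta> - ?y' * sin \<theta> = x * \<phi> + x * x * ?Q"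
      by (simp add: power2_eq_square algebra_simps cs cs2)
    then show ?thesis using x nz by (simp add: add_divide_distrib)
  qed
  \<comment> \<open>\<theta>' has \<phi> in its denominator. After multiplication by \<phi> the
    difference of the two sides is x^2 times the left-hand side of \<open>3\<close>.\<close>
  have "\<phi> * (x\<^sup>2 * (of_real b * \<phi> + ?P)) = \<phi> * ((\<phi> + (v + u)) * (x\<^sup>2 * (- 1 - of_real a * \<phi>\<^sup>2 + Fv)) + x * (x * s) * (1 + x * ?Q / \<phi>))"
  proof -
    have "\<phi> * (1 + x * ?Q / \<phi>) = \<phi> + x * ?Q" using nz by (simp add: distrib_left)
    then have e: "\<phi> * (x * (x * s) * (1 + x * ?Q / \<phi>)) = x * (x * s) * (\<phi> + x * ?Q)"
      by (metis mult.left_commute)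
    have "\<phi> * ((\<phi> + (v + u)) * (x\<^sup>2 * (- 1 - of_real a * \<phi>\<^sup>2 + Fv)) + x * (x * s) * (1 + x * ?Q / \<phi>))
      - \<phi> * (x\<^sup>2 * (of_real b * \<phi> + ?P)) = x\<^sup>2 * (\<phi> * d + x * ?Q * s)"
      unfolding distrib_left[of \<phi> _ "x * (x * s) * _"] e unfolding d by (simp add: power2_eq_square algebra_simps)
    then show ?thesis unfolding 3 mult_zero_right right_minus_eq by (rule sym)
  qed
  then have fin: "x\<^sup>2 * (of_real b * \<phi> + ?P) = (\<phi> + (v + u)) * (x\<^sup>2 * (- 1 - of_real a * \<phi>\<^sup>2 + Fv)) + x * (x * s) * (1 + x * ?Q / \<phi>)"
    using nz by simp
  show "case cyl_vfield a b F G H (x, x * \<phi>, \<theta>) of (x', \<rho>', \<theta>') \<Rightarrow> \<rho>' = (\<phi> + (v + u)) * x' + x * (x * s) * \<theta>'"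
    unfolding cyl_vfield_def cyl_def vfield_def prod.case FGH x' \<rho>' \<theta>' by (rule fin)
qed

end

end

text \<open>\<open>borel_coeff\<close> divides by n!, so the coefficient of x^(n + 1) is the n-th
  derivative of the Borel transform at 0 and not its Taylor coefficient.\<close>

definition series :: "borel_fun \<Rightarrow> nat \<Rightarrow> complex \<Rightarrow> complex" where
  "series f n = (case n of 0 \<Rightarrow> (\<lambda>_. \<phi>0) | Suc k \<Rightarrow> taylor (U_op f) k)"

text \<open>Any admissible ray gives the same value; on points with no admissible ray \<open>ray_at\<close> is junk.\<close>

definition ray_at :: "real \<Rightarrow> real \<Rightarrow> complex \<Rightarrow> real" where
  "ray_at \<phi> \<omega> x = (SOME \<psi>. \<bar>\<psi> - \<phi>\<bar> < \<omega> \<and> \<eta> < Re (cis \<psi> / x))"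

definition graph_fun :: "real \<Rightarrow> real \<Rightarrow> borel_fun \<Rightarrow> borel_fun" where
  "graph_fun \<phi> \<omega> f x \<theta> = \<phi>0 + laplace (ray_at \<phi> \<omega> x) (U_op f) x \<theta>"

context
  fixes f :: "borel_fun"
  assumes f: "elem (\<rho> * \<epsilon>) f"
    and fixpoint: "\<And>w \<theta>. w \<in> \<Omega> \<Longrightarrow> \<theta> \<in> strip 1 \<Longrightarrow>
      \<phi>0 * defect f w \<theta> + conv (U_op f) (defect f) w \<theta> + conv (J (twist f)) (S_op f) w \<theta> = 0"
begin

lemma U_elem: "elem 1 (U_op f)"
  by (rule elem_mono[OF bounded_op_elem[OF bounded_op_C(1) f] C_rho])

text \<open>Cauchy's inequality for the Borel transform on the disc of radius \<open>r1\<close>.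
  Taking \<open>\<tau>\<close> at least 1 as well absorbs the shift of the index.\<close>

lemma gevrey1_series:
  assumes r1: "0 < r1" "cball 0 r1 \<subseteq> \<Omega>" and \<xi>: "\<xi> \<le> 1"
  shows "gevrey1 \<xi> (series f)"
  unfolding gevrey1_def
proof (intro conjI allI)
  fix n
  show "series f n holomorphic_on strip \<xi>"
    using holomorphic_on_subset[OF taylor_holomorphic[OF U_elem r1] strip_mono[OF \<xi>]]
    by (cases n) (simp_all add: series_def)
  show "periodic_on_strip \<xi> (series f n)"
    using taylor_periodic[OF U_elem r1] strip_mono[OF \<xi>]
    by (cases n) (auto simp: series_def periodic_on_strip_def)
next
  define A where "A = norm \<phi>0 + \<mu> r1 + 1"
  define \<tau> where "\<tau> = max 1 (1 / r1)"
  have \<mu>: "0 < \<mu> r1" using mu_pos r1 by simp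
  have A: "0 < A" "norm \<phi>0 \<le> A" "\<mu> r1 \<le> A" using \<mu> by (auto simp: A_def add_nonneg_pos)
  have \<tau>: "1 \<le> \<tau>" "1 / r1 \<le> \<tau>" by (auto simp: \<tau>_def)
  have "norm (series f n \<theta>) \<le> A * \<tau> ^ n * fact n" if "\<theta> \<in> strip \<xi>" for n \<theta>
  proof (cases n)
    case 0
    then show ?thesis using A by (simp add: series_def)
  next
    case (Suc k)
    have "norm (taylor (U_op f) k \<theta>) \<le> fact k * (1 * \<mu> r1) / r1 ^ k"
      using that strip_mono[OF \<xi>] by (intro taylor_bound[OF U_elem r1]) auto
    also have "\<dots> = \<mu> r1 * (1 / r1) ^ k * fact k" by (simp add: power_divide)
    also have "\<dots> \<le> A * \<tau> ^ Suc k * fact (Suc k)"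
    proof (intro mult_mono)
      have "(1 / r1) ^ k \<le> \<tau> ^ k" using \<tau> r1 by (intro power_mono) auto
      also have "\<dots> \<le> \<tau> ^ Suc k" using \<tau> by (intro power_increasing) auto
      finally show "(1 / r1) ^ k \<le> \<tau> ^ Suc k" .
      show "fact k \<le> (fact (Suc k) :: real)" by (rule fact_mono) simp
    qed (use A \<tau> \<mu> r1 in auto)
    finally show ?thesis by (simp add: Suc series_def)
  qed
  then show "\<exists>A>0. \<exists>\<tau>>0. \<forall>n. \<forall>\<theta>\<in>strip \<xi>. norm (series f n \<theta>) \<le> A * \<tau> ^ n * fact n"
    using A(1) \<tau>(1) by (intro exI[of _ A] exI[of _ \<tau>] conjI) auto
qed

text \<open>\<open>2 * \<eta> * \<delta> \<le> \<sigma>\<close> makes \<sigma> / norm x exceed 2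
  \<eta>, so the Laplace integral converges with room to spare; the next condition keeps the sum
  within \<open>norm \<phi>0 / 2\<close> of \<phi>0, hence away from 0; the last two keep (x, y, z)
  in the polydisc of convergence.\<close>

context
  fixes \<phi> \<omega> r1 \<sigma> \<delta> :: real and S :: "complex set"
  assumes om: "0 < \<omega>" "\<omega> \<le> pi / 2" and r1: "0 < r1" "cball 0 r1 \<subseteq> \<Omega>"
    and rays: "\<And>\<psi> t. \<bar>\<psi> - \<phi>\<bar> < \<omega> \<Longrightarrow> of_real t * cis \<psi> \<in> \<Omega>"
    and \<sigma>: "0 < \<sigma>" and delta: "0 < \<delta>" "2 * \<eta> * \<delta> \<le> \<sigma>" "2 * M\<mu> * \<delta> / \<sigma> \<le> norm \<phi>0 / 2" "\<delta> \<le> r" "\<delta> * (9 * norm \<phi>0) \<le> r"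
    and S: "\<And>x. x \<in> S \<Longrightarrow> x \<noteq> 0 \<and> norm x < \<delta>"
    and Sray: "\<And>x. x \<in> S \<Longrightarrow> \<exists>\<psi>. \<bar>\<psi> - \<phi>\<bar> < \<omega> \<and> \<sigma> / norm x \<le> Re (cis \<psi> / x)"
begin

lemma dir: "\<bar>\<psi> - \<phi>\<bar> < \<omega> \<Longrightarrow> direction \<psi>"
  using rays by (simp add: direction_def)

lemma sigma_eta:
  assumes "x \<in> S" shows "\<eta> < \<sigma> / norm x" "M\<mu> / (\<sigma> / norm x - \<eta>) \<le> 2 * M\<mu> / \<sigma> * norm x"
proof -
  have x: "0 < norm x" "norm x < \<delta>" using S[OF assms] by auto
  have "2 * \<eta> * norm x < 2 * \<eta> * \<delta>" using x eta by simp
  then have "2 * \<eta> * norm x < \<sigma>" using delta(2) by linarith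
  then have h: "2 * \<eta> < \<sigma> / norm x" using x(1) by (simp add: pos_less_divide_eq)
  then show "\<eta> < \<sigma> / norm x" using eta by linarith
  have "M\<mu> / (\<sigma> / norm x - \<eta>) \<le> M\<mu> / (\<sigma> / norm x / 2)"
    using h eta \<sigma> x(1) Mmu by (intro divide_left_mono mult_pos_pos) (auto simp: field_simps)
  also have "\<dots> = 2 * M\<mu> / \<sigma> * norm x" by simp
  finally show "M\<mu> / (\<sigma> / norm x - \<eta>) \<le> 2 * M\<mu> / \<sigma> * norm x" .
qed

lemma ray_ex:
  assumes "x \<in> S" shows "\<exists>\<psi>. \<bar>\<psi> - \<phi>\<bar> < \<omega> \<and> \<eta> < Re (cis \<psi> / x)"
  using Sray[OF assms] sigma_eta(1)[OF assms] by force

lemma graph_fun_eq: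
  assumes "\<bar>\<psi> - \<phi>\<bar> < \<omega>" "\<eta> < Re (cis \<psi> / x)" and \<theta>: "\<theta> \<in> strip 1"
  shows "graph_fun \<phi> \<omega> f x \<theta> = \<phi>0 + laplace \<psi> (U_op f) x \<theta>"
proof -
  have "\<bar>ray_at \<phi> \<omega> x - \<phi>\<bar> < \<omega> \<and> \<eta> < Re (cis (ray_at \<phi> \<omega> x) / x)"
    unfolding ray_at_def by (rule someI[of _ \<psi>]) (use assms in auto)
  then show ?thesis
    unfolding graph_fun_def using laplace_ray_independent[OF U_elem dir om(2) \<theta> _ _ assms(1,2)] by auto
qed

lemma graph_fun_bound:
  assumes x: "x \<in> S" and \<theta>: "\<theta> \<in> strip 1"
  shows "norm (graph_fun \<phi> \<omega> f x \<theta> - \<phi>0) \<le> 2 * M\<mu> / \<sigma> * norm x"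
proof -
  obtain \<psi> where \<psi>: "\<bar>\<psi> - \<phi>\<bar> < \<omega>" "\<sigma> / norm x \<le> Re (cis \<psi> / x)" using Sray[OF x] by blast
  note e = sigma_eta[OF x]
  have "norm (laplace \<psi> (U_op f) x \<theta>) \<le> 1 * M\<mu> / (\<sigma> / norm x - \<eta>)"
    by (rule laplace_bound[OF U_elem dir[OF \<psi>(1)] \<theta> e(1) \<psi>(2)])
  then show ?thesis
    using e graph_fun_eq[OF \<psi>(1) _ \<theta>, of x] \<psi>(2) by simp
qed

lemma graph_fun_small:
  assumes x: "x \<in> S" and \<theta>: "\<theta> \<in> strip 1"
  defines "p \<equiv> graph_fun \<phi> \<omega> f x \<theta>"
  shows "p \<noteq> 0" "norm (x * p * cos \<theta>) < r" "norm (x * p * sin \<theta>) < r"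
proof -
  have n: "norm x < \<delta>" using S[OF x] by simp
  have "2 * M\<mu> / \<sigma> * norm x \<le> 2 * M\<mu> / \<sigma> * \<delta>" using n Mmu \<sigma> by (intro mult_left_mono) auto
  then have d: "norm (p - \<phi>0) \<le> norm \<phi>0 / 2"
    using graph_fun_bound[OF x \<theta>] delta(3) unfolding p_def by simp
  then show "p \<noteq> 0" using phi0 by auto
  have "norm p \<le> norm (p - \<phi>0) + norm \<phi>0"
    using norm_triangle_ineq[of "p - \<phi>0" \<phi>0] by simp
  then have p2: "norm p \<le> 2 * norm \<phi>0"
    using d norm_ge_zero[of \<phi>0] by linarith
  have lt: "norm (x * p * c) < r" if c: "norm c \<le> 3" for c
  proof -
    have "norm p * norm c \<le> 2 * norm \<phi>0 * 3" using p2 c by (intro mult_mono) auto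
    then have "norm x * (norm p * norm c) \<le> norm x * (2 * norm \<phi>0 * 3)" by (rule mult_left_mono) simp
    \<comment> \<open>The 6 is 2 for \<open>p\<close> times 3 for cos and sin; 9 leaves room for
      strict inequality in both factors.\<close>
    also have "\<dots> < \<delta> * (9 * norm \<phi>0)"
      by (rule mult_strict_mono) (use n phi0 delta(1) in auto)
    finally show ?thesis using delta(5) by (simp add: norm_mult mult.assoc)
  qed
  show "norm (x * p * cos \<theta>) < r" "norm (x * p * sin \<theta>) < r"
    by (rule lt, rule norm_cos_sin_le[OF \<theta>])+
qed

lemma is_one_sum_graph_fun:
  assumes \<xi>: "\<xi> \<le> 1" shows "is_one_sum \<phi> S \<xi> (series f) (graph_fun \<phi> \<omega> f)"
  unfolding is_one_sum_def
proof (rule exI[of _ \<omega>], rule conjI[OF om(1)], rule exI[of _ r1], rule conjI[OF r1(1)], rule exI[of _ \<eta>],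
    rule conjI[OF eta], rule exI[of _ "M\<mu>"], rule exI[of _ "U_op f"], intro conjI ballI allI impI)
  have sub: "ray_nbhd \<phi> \<omega> r1 \<subseteq> \<Omega>"
    using r1(2) rays ball_subset_cball by (auto simp: ray_nbhd_def)
  fix \<theta> assume "\<theta> \<in> strip \<xi>"
  then have \<theta>: "\<theta> \<in> strip 1" using strip_mono[OF \<xi>] by auto
  show "(\<lambda>w. U_op f w \<theta>) holomorphic_on ray_nbhd \<phi> \<omega> r1"
    by (rule holomorphic_on_subset[OF separately_holD(1)[OF elem_separately_hol[OF U_elem] \<theta>] sub])
  show "(\<lambda>n. borel_coeff (series f) \<theta> n * w ^ n) sums U_op f w \<theta>" if "w \<in> ball 0 r1" for w
    using taylor_sums[OF U_elem r1 \<theta> that] by (simp add: borel_coeff_def series_def)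
  show "norm (U_op f w \<theta>) \<le> M\<mu> * exp (\<eta> * norm w)" if "w \<in> ray_nbhd \<phi> \<omega> r1" for w
    using elemD[OF U_elem _ \<theta>, of w] that sub mu_exp[of "norm w"] by auto
next
  fix x assume x: "x \<in> S"
  show "\<exists>\<psi>. \<bar>\<psi> - \<phi>\<bar> < \<omega> \<and> \<eta> < Re (cis \<psi> / x)" by (rule ray_ex[OF x])
  fix \<psi> \<theta> assume \<psi>: "\<bar>\<psi> - \<phi>\<bar> < \<omega> \<and> \<eta> < Re (cis \<psi> / x)" and "\<theta> \<in> strip \<xi>"
  then have \<theta>: "\<theta> \<in> strip 1" using strip_mono[OF \<xi>] by auto
  show "graph_fun \<phi> \<omega> f x \<theta> = series f 0 \<theta> + laplace_ray \<psi> (\<lambda>w. U_op f w \<theta>) x"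
    using graph_fun_eq[OF _ _ \<theta>] \<psi> by (simp add: series_def laplace_def)
qed

lemma periodic_graph_fun:
  assumes x: "x \<in> S" and \<xi>: "\<xi> \<le> 1" shows "periodic_on_strip \<xi> (graph_fun \<phi> \<omega> f x)"
  unfolding periodic_on_strip_def
proof
  fix \<theta> assume "\<theta> \<in> strip \<xi>"
  then have \<theta>: "\<theta> \<in> strip 1" using strip_mono[OF \<xi>] by auto
  obtain \<psi> where \<psi>: "\<bar>\<psi> - \<phi>\<bar> < \<omega>" "\<eta> < Re (cis \<psi> / x)" using ray_ex[OF x] by blast
  have "laplace_integrand \<psi> (U_op f) x (\<theta> + 2 * of_real pi) = laplace_integrand \<psi> (U_op f) x \<theta>"
    using separately_holD(3)[OF elem_separately_hol[OF U_elem] rays[OF \<psi>(1)] \<theta>] by (simp add: laplace_integrand_def fun_eq_iff)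
  then show "graph_fun \<phi> \<omega> f x (\<theta> + 2 * of_real pi) = graph_fun \<phi> \<omega> f x \<theta>"
    by (simp add: graph_fun_eq[OF \<psi>] \<theta> strip_add_2pi laplace_eq)
qed

lemma graph_fun_limit:
  assumes \<theta>: "\<theta> \<in> strip 1" shows "((\<lambda>x. graph_fun \<phi> \<omega> f x \<theta>) \<longlongrightarrow> \<phi>0) (at 0 within S)"
proof (rule Lim_transform)
  have "((\<lambda>x. 2 * M\<mu> / \<sigma> * norm x) \<longlongrightarrow> 2 * M\<mu> / \<sigma> * norm (0::complex)) (at 0 within S)"
    by (intro tendsto_intros)
  then have "((\<lambda>x. 2 * M\<mu> / \<sigma> * norm x) \<longlongrightarrow> 0) (at (0::complex) within S)" by simp
  moreover have "\<forall>\<^sub>F x in at 0 within S. norm (graph_fun \<phi> \<omega> f x \<theta> - \<phi>0) \<le> 2 * M\<mu> / \<sigma> * norm x"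
    using graph_fun_bound[OF _ \<theta>] by (auto simp: eventually_at_filter)
  ultimately show "((\<lambda>x. graph_fun \<phi> \<omega> f x \<theta> - \<phi>0) \<longlongrightarrow> 0) (at 0 within S)"
    by (rule Lim_null_comparison[rotated])
qed (rule tendsto_const)

text \<open>A ray admissible at \<open>x0\<close> stays admissible for nearby x, so by ray
  independence the derivative may be computed with one fixed ray, although \<open>ray_at\<close>
  need not vary continuously.\<close>

lemma graph_fun_tangent:
  assumes x0: "x0 \<in> S" and \<theta>: "\<theta> \<in> strip 1"
  shows "(x0, x0 * graph_fun \<phi> \<omega> f x0 \<theta>, \<theta>) \<in> cyl_domain F G H \<and>
     (\<exists>A B. ((\<lambda>(x, \<theta>). x * graph_fun \<phi> \<omega> f x \<theta>) has_derivative (\<lambda>(u, v). A * u + B * v)) (at (x0, \<theta>)) \<and>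
       (case cyl_vfield a b F G H (x0, x0 * graph_fun \<phi> \<omega> f x0 \<theta>, \<theta>) of
         (x', \<rho>', \<theta>') \<Rightarrow> \<rho>' = A * x' + B * \<theta>'))"
proof -
  obtain \<psi> where \<psi>: "\<bar>\<psi> - \<phi>\<bar> < \<omega>" "\<eta> < Re (cis \<psi> / x0)" using ray_ex[OF x0] by blast
  have d: "direction \<psi>" by (rule dir[OF \<psi>(1)])
  have nz: "x0 \<noteq> 0" "norm x0 < r" using S[OF x0] delta(4) by auto
  let ?u = "laplace \<psi> (U_op f) x0 \<theta>" and ?v = "laplace \<psi> (V_op f) x0 \<theta>" and ?s = "laplace \<psi> (S_op f) x0 \<theta>"
  have p: "graph_fun \<phi> \<omega> f x0 \<theta> = \<phi>0 + ?u" by (rule graph_fun_eq[OF \<psi> \<theta>])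
  note sm = graph_fun_small[OF x0 \<theta>, unfolded p]
  note t = tangency[OF f fixpoint d \<theta> \<psi>(2) sm(1) nz(2) sm(2,3)]
  define g where "g = J (\<lambda>w \<theta>. V_op f w \<theta> + U_op f w \<theta>)"
  define h where "h = J (S_op f)"
  note V = bounded_op_elem[OF bounded_op_C(2) f] and U = bounded_op_elem[OF bounded_op_C(1) f] and Sf = bounded_op_elem[OF bounded_op_C(3) f]
  have lg: "laplace \<psi> g x0 \<theta> = x0 * (?v + ?u)"
    unfolding g_def laplace_J[OF d \<theta> \<psi>(2) elem_add[OF V U]] laplace_add[OF d \<theta> \<psi>(2) V U] ..
  have lh: "laplace \<psi> h x0 \<theta> = x0 * ?s"
    unfolding h_def by (rule laplace_J[OF d \<theta> \<psi>(2) Sf])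
  have "((\<lambda>(x, \<theta>). laplace \<psi> (U_op f) x \<theta>) has_derivative
      (\<lambda>(u, v). laplace \<psi> g x0 \<theta> / x0\<^sup>2 * u + laplace \<psi> h x0 \<theta> * v)) (at (x0, \<theta>))"
    by (rule laplace_has_derivative[OF U_elem _ _ d \<theta> \<psi>(2)])
      (simp_all add: g_def h_def w_U_op_eq[OF alpha f] U_op_deriv_theta[OF f])
  then have D: "((\<lambda>p. laplace \<psi> (U_op f) (fst p) (snd p)) has_derivative
      (\<lambda>q. (?v + ?u) / x0 * fst q + x0 * ?s * snd q)) (at (x0, \<theta>))"
    using nz(1) unfolding case_prod_unfold lg lh by (simp add: power2_eq_square)
  have "((\<lambda>p. fst p * (\<phi>0 + laplace \<psi> (U_op f) (fst p) (snd p))) has_derivative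
      (\<lambda>q. (\<phi>0 + ?u + (?v + ?u)) * fst q + x0 * (x0 * ?s) * snd q)) (at (x0, \<theta>))"
    by (rule has_derivative_eq_rhs, rule has_derivative_mult[OF has_derivative_fst[OF has_derivative_ident] has_derivative_add[OF has_derivative_const D]])
      (use nz(1) in \<open>simp add: fun_eq_iff field_simps\<close>)
  then have D': "((\<lambda>(x, \<theta>). x * (\<phi>0 + laplace \<psi> (U_op f) x \<theta>)) has_derivative
      (\<lambda>(u, v). (\<phi>0 + ?u + (?v + ?u)) * u + x0 * (x0 * ?s) * v)) (at (x0, \<theta>))"
    unfolding case_prod_unfold .
  obtain \<delta>1 m where near: "0 < \<delta>1" "\<eta> < m" "\<And>x. x \<in> ball x0 \<delta>1 \<Longrightarrow> m \<le> Re (cis \<psi> / x)"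
    using near_x[OF \<psi>(2)] by blast
  have HD: "((\<lambda>(x, \<theta>). x * graph_fun \<phi> \<omega> f x \<theta>) has_derivative
      (\<lambda>(u, v). (\<phi>0 + ?u + (?v + ?u)) * u + x0 * (x0 * ?s) * v)) (at (x0, \<theta>))"
  proof (rule has_derivative_transform_within_open[OF D'])
    show "open (ball x0 \<delta>1 \<times> strip 1)" by (intro open_Times open_ball open_strip)
    show "(x0, \<theta>) \<in> ball x0 \<delta>1 \<times> strip 1" using near(1) \<theta> by simp
    show "(\<lambda>(x, \<theta>). x * (\<phi>0 + laplace \<psi> (U_op f) x \<theta>)) p = (\<lambda>(x, \<theta>). x * graph_fun \<phi> \<omega> f x \<theta>) p"
      if "p \<in> ball x0 \<delta>1 \<times> strip 1" for p
      using that near(2) near(3)[of "fst p"] graph_fun_eq[OF \<psi>(1), of "fst p" "snd p"] by (auto split: prod.splits)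
  qed
  show ?thesis
    unfolding p
    by (rule conjI, rule t(1), assumption, assumption, rule exI[of _ "\<phi>0 + ?u + (?v + ?u)"],
        rule exI[of _ "x0 * (x0 * ?s)"], rule conjI[OF HD], rule t(2))
qed

lemma invariant_graph_graph_fun:
  assumes \<xi>: "\<xi> \<le> 1"
  shows "invariant_graph (cyl_vfield a b F G H) (cyl_domain F G H) (S \<times> strip \<xi>) (\<lambda>(x, \<theta>). x * graph_fun \<phi> \<omega> f x \<theta>)"
  unfolding invariant_graph_def
proof (rule ballI, erule SigmaE)
  fix p x \<theta> assume "x \<in> S" "\<theta> \<in> strip \<xi>" and p: "p = (x, \<theta>)"
  then show "case p of (x, \<theta>) \<Rightarrow> (x, (case (x, \<theta>) of (x, \<theta>) \<Rightarrow> x * graph_fun \<phi> \<omega> f x \<theta>), \<theta>) \<in> cyl_domain F G H \<and>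
     (\<exists>A B. ((\<lambda>(x, \<theta>). x * graph_fun \<phi> \<omega> f x \<theta>) has_derivative (\<lambda>(u, v). A * u + B * v)) (at (x, \<theta>)) \<and>
       (case cyl_vfield a b F G H (x, (case (x, \<theta>) of (x, \<theta>) \<Rightarrow> x * graph_fun \<phi> \<omega> f x \<theta>), \<theta>) of
         (x', \<rho>', \<theta>') \<Rightarrow> \<rho>' = A * x' + B * \<theta>'))"
    using strip_mono[OF \<xi>] unfolding p prod.case by (intro graph_fun_tangent) auto
qed

end

end

end

section \<open>Choice of the constants and conclusion\<close>

lemma cubic_mono:
  assumes c: "cubic c r" and s: "0 \<le> s" "s \<le> r" shows "cubic c s"
  unfolding cubic_def
proof (intro conjI)
  show "\<forall>m. deg m < 3 \<longrightarrow> c m = 0" using c by (simp add: cubic_def)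
  show "summable (\<lambda>n. \<bar>c (triple n)\<bar> * s ^ deg (triple n))"
  proof (rule summable_comparison_test'[where N=0])
    show "summable (\<lambda>n. \<bar>c (triple n)\<bar> * r ^ deg (triple n))" using c by (simp add: cubic_def)
    show "norm (\<bar>c (triple n)\<bar> * s ^ deg (triple n)) \<le> \<bar>c (triple n)\<bar> * r ^ deg (triple n)" for n
      using s by (simp add: mult_left_mono power_mono)
  qed
qed

lemma weight_sum_nonneg: "cubic c r \<Longrightarrow> 0 \<le> r \<Longrightarrow> 0 \<le> weight_sum c r"
  unfolding weight_sum_def by (intro suminf_nonneg) (auto simp: cubic_def)

lemma small_multiple: "0 < B \<Longrightarrow> \<forall>\<^sub>F \<epsilon> in at_right (0::real). A * \<epsilon> \<le> B" for A B :: real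
proof -
  assume B: "0 < B"
  have "((\<lambda>\<epsilon>. A * \<epsilon>) \<longlongrightarrow> A * 0) (at_right 0)" by (intro tendsto_intros)
  then have "\<forall>\<^sub>F \<epsilon> in at_right 0. A * \<epsilon> < B" using B by (auto dest: order_tendstoD)
  then show ?thesis by eventually_elim simp
qed

text \<open>\<open>\<kappa>\<close> is half of the half-opening (pi + \<omega>) / 2, so \<bar>Arg
  x\<bar> < 2 \<kappa> and the ray of argument Arg x / 2 serves.\<close>

lemma sector_plus_rays:
  assumes "x \<in> sector_plus \<delta> \<omega>" and \<omega>: "\<omega> < pi" and \<kappa>: "\<kappa> = (\<omega> + pi) / 4"
  shows "x \<noteq> 0 \<and> norm x < \<delta>" "\<exists>\<psi>. \<bar>\<psi> - 0\<bar> < \<kappa> \<and> cos \<kappa> / norm x \<le> Re (cis \<psi> / x)"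
proof -
  have x: "x \<noteq> 0" "norm x < \<delta>" "\<bar>Arg x\<bar> < 2 * \<kappa>" using assms by (auto simp: sector_plus_def field_simps)
  then show "x \<noteq> 0 \<and> norm x < \<delta>" by simp
  have "cos \<kappa> / norm x \<le> Re (cis (Arg x / 2) / x)"
    by (rule Re_cis_half_angle[OF x(1,3)]) (use \<omega> \<kappa> in simp)
  moreover have "\<bar>Arg x / 2 - 0\<bar> < \<kappa>" using x(3) by simp
  ultimately show "\<exists>\<psi>. \<bar>\<psi> - 0\<bar> < \<kappa> \<and> cos \<kappa> / norm x \<le> Re (cis \<psi> / x)" by blast
qed

lemma sector_minus_rays:
  assumes "x \<in> sector_minus \<delta> \<omega>" and \<omega>: "\<omega> < pi" and \<kappa>: "\<kappa> = (\<omega> + pi) / 4"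
  shows "x \<noteq> 0 \<and> norm x < \<delta>" "\<exists>\<psi>. \<bar>\<psi> - pi\<bar> < \<kappa> \<and> cos \<kappa> / norm x \<le> Re (cis \<psi> / x)"
proof -
  have m: "- x \<in> sector_plus \<delta> \<omega>" using assms(1) by (auto simp: sector_plus_def sector_minus_def)
  show "x \<noteq> 0 \<and> norm x < \<delta>" using sector_plus_rays(1)[OF m \<omega> \<kappa>] by simp
  obtain \<psi> where \<psi>: "\<bar>\<psi>\<bar> < \<kappa>" "cos \<kappa> / norm x \<le> Re (cis \<psi> / (- x))"
    using sector_plus_rays(2)[OF m \<omega> \<kappa>] by auto
  have "cis (\<psi> + pi) / x = cis \<psi> / (- x)" by (simp add: cis_mult[symmetric])
  then show "\<exists>\<psi>. \<bar>\<psi> - pi\<bar> < \<kappa> \<and> cos \<kappa> / norm x \<le> Re (cis \<psi> / x)"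
    using \<psi> by (intro exI[of _ "\<psi> + pi"]) simp
qed

theorem proposition1p4:
  fixes a b \<omega> :: real
    and F G H :: "real \<times> real \<times> real \<Rightarrow> real"
  assumes "a \<noteq> 0" and "b \<notin> {-1..0}"
    and "real_analytic_at_0 F" and "real_analytic_at_0 G" and "real_analytic_at_0 H"
    and "F \<in> O[nhds 0](\<lambda>p. norm p ^ 3)"
    and "G \<in> O[nhds 0](\<lambda>p. norm p ^ 3)"
    and "H \<in> O[nhds 0](\<lambda>p. norm p ^ 3)"
    and "\<forall>\<^sub>F (x, y, z) in nhds 0. F (- x, - z, - y) = F (x, y, z)"
    and "\<forall>\<^sub>F (x, y, z) in nhds 0. G (- x, - z, - y) = H (x, y, z)"
    and "0 < \<omega>" and "\<omega> < pi"
  shows "\<exists>\<delta>\<^sub>0>0. \<exists>\<xi>\<^sub>0>0. \<forall>\<delta> \<xi>. 0 < \<delta> \<and> \<delta> < \<delta>\<^sub>0 \<and> 0 < \<xi> \<and> \<xi> < \<xi>\<^sub>0 \<longrightarrow>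
    (\<exists>(W :: nat \<Rightarrow> complex \<Rightarrow> complex)
      (\<Phi>p :: complex \<Rightarrow> complex \<Rightarrow> complex) (\<Phi>m :: complex \<Rightarrow> complex \<Rightarrow> complex).
      gevrey1 \<xi> W \<and>
      is_one_sum 0 (sector_plus \<delta> \<omega>) \<xi> W \<Phi>p \<and>
      is_one_sum pi (sector_minus \<delta> \<omega>) \<xi> W \<Phi>m \<and>
      (\<forall>x\<in>sector_plus \<delta> \<omega>. periodic_on_strip \<xi> (\<Phi>p x)) \<and>
      (\<forall>x\<in>sector_minus \<delta> \<omega>. periodic_on_strip \<xi> (\<Phi>m x)) \<and>
      invariant_graph (cyl_vfield a b F G H) (cyl_domain F G H)
        (sector_plus \<delta> \<omega> \<times> strip \<xi>) (\<lambda>(x, \<theta>). x * \<Phi>p x \<theta>) \<and>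
      invariant_graph (cyl_vfield a b F G H) (cyl_domain F G H)
        (sector_minus \<delta> \<omega> \<times> strip \<xi>) (\<lambda>(x, \<theta>). x * \<Phi>m x \<theta>) \<and>
      (\<forall>\<theta>\<in>strip \<xi>.
        ((\<lambda>x. \<Phi>p x \<theta>) \<longlongrightarrow> \<i> * csqrt (of_real ((1 + b) / a))) (at 0 within sector_plus \<delta> \<omega>)) \<and>
      (\<forall>\<theta>\<in>strip \<xi>.
        ((\<lambda>x. \<Phi>m x \<theta>) \<longlongrightarrow> \<i> * csqrt (of_real ((1 + b) / a))) (at 0 within sector_minus \<delta> \<omega>)))"
proof -
  define \<phi>0 where "\<phi>0 = \<i> * csqrt (of_real ((1 + b) / a))"
  have b: "b \<noteq> 0" "1 + b \<noteq> 0" using assms(2) by auto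
  have phi0_sq: "of_real a * \<phi>0\<^sup>2 = - (1 + complex_of_real b)"
    using assms(1) by (simp add: \<phi>0_def power_mult_distrib)
  have "1 + complex_of_real b \<noteq> 0" using b(2) by (metis of_real_1 of_real_add of_real_eq_0_iff)
  then have phi0: "\<phi>0 \<noteq> 0" using assms(1) by (simp add: \<phi>0_def)
  \<comment> \<open>For b > 0 this is 2 b + 2 > 0; for b < 0 the division reverses the inequality
    and it becomes b < - 1.\<close>
  have al: "1 < (3 * b + 2) / b"
    using assms(2) by (cases "b > 0") (auto simp: field_simps)

  \<comment> \<open>Below pi / 2 because \<open>\<omega> < pi\<close>, so the slope
    \<open>tan \<kappa>\<close> of the wedge is finite.\<close>
  define \<kappa> where "\<kappa> = (\<omega> + pi) / 4"
  have \<kappa>: "0 < \<kappa>" "\<kappa> < pi / 2" using assms by (auto simp: \<kappa>_def)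
  define m where "m = tan \<kappa>"
  have m: "0 \<le> m" unfolding m_def using \<kappa> by (intro less_imp_le tan_gt_zero)
  \<comment> \<open>\<open>r\<^sub>\<Omega>\<close>, \<open>\<rho>0\<close> and \<open>C0\<close>
    are the constants of \<open>wedge_dichotomy\<close>.\<close>
  define r\<^sub>\<Omega> where "r\<^sub>\<Omega> = 1 / (16 * pi * \<bar>b\<bar>)"
  have r\<Omega>: "0 < r\<^sub>\<Omega>" using b by (simp add: r\<^sub>\<Omega>_def)
  define \<rho>0 where "\<rho>0 = 1 / (16 * pi * (1 + m))"
  have \<rho>0: "0 < \<rho>0" using m by (simp add: \<rho>0_def)
  define C0 where "C0 = 2 * (1 + m)"

  let ?cF = "taylor_coeffs F" and ?cG = "taylor_coeffs G" and ?cH = "taylor_coeffs H"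
  obtain rF where rF: "0 < rF" "cubic ?cF rF"
    "\<And>x y z. norm x < rF \<Longrightarrow> norm y < rF \<Longrightarrow> norm z < rF \<Longrightarrow> (x, y, z) \<in> convergence_domain F"
    "\<And>x y z. norm x < rF \<Longrightarrow> norm y < rF \<Longrightarrow> norm z < rF \<Longrightarrow>
      (\<lambda>n. case triple n of (i, j, k) \<Rightarrow> of_real (?cF (i, j, k)) * (x ^ i * y ^ j * z ^ k)) sums complexify F (x, y, z)"
    by (rule complexify_facts[OF assms(3,6)], rule that)
  obtain rG where rG: "0 < rG" "cubic ?cG rG"
    "\<And>x y z. norm x < rG \<Longrightarrow> norm y < rG \<Longrightarrow> norm z < rG \<Longrightarrow> (x, y, z) \<in> convergence_domain G"
    "\<And>x y z. norm x < rG \<Longrightarrow> norm y < rG \<Longrightarrow> norm z < rG \<Longrightarrow>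
      (\<lambda>n. case triple n of (i, j, k) \<Rightarrow> of_real (?cG (i, j, k)) * (x ^ i * y ^ j * z ^ k)) sums complexify G (x, y, z)"
    by (rule complexify_facts[OF assms(4,7)], rule that)
  obtain rH where rH: "0 < rH" "cubic ?cH rH"
    "\<And>x y z. norm x < rH \<Longrightarrow> norm y < rH \<Longrightarrow> norm z < rH \<Longrightarrow> (x, y, z) \<in> convergence_domain H"
    "\<And>x y z. norm x < rH \<Longrightarrow> norm y < rH \<Longrightarrow> norm z < rH \<Longrightarrow>
      (\<lambda>n. case triple n of (i, j, k) \<Rightarrow> of_real (?cH (i, j, k)) * (x ^ i * y ^ j * z ^ k)) sums complexify H (x, y, z)"
    by (rule complexify_facts[OF assms(5,8)], rule that)
  define r where "r = min rF (min rG rH)"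
  have r: "0 < r" "r \<le> rF" "r \<le> rG" "r \<le> rH" using rF(1) rG(1) rH(1) by (auto simp: r_def)
  have cub: "cubic ?cF r" "cubic ?cG r" "cubic ?cH r"
    using cubic_mono[OF rF(2)] cubic_mono[OF rG(2)] cubic_mono[OF rH(2)] r by auto

  define A0 where "A0 = (6 * (norm \<phi>0 + 1) / r) ^ 3"
  have A0: "0 \<le> A0" using r by (simp add: A0_def)
  define k where "k = A0 * weight_sum ?cF r + A0 * weight_sum ?cG r + A0 * weight_sum ?cH r"
  have ws: "0 \<le> A0 * weight_sum ?cF r" "0 \<le> A0 * weight_sum ?cG r" "0 \<le> A0 * weight_sum ?cH r"
    using weight_sum_nonneg cub r(1) A0 by auto
  \<comment> \<open>The absolute values make each summand a lower bound of the sum without any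
    knowledge of signs; likewise in \<open>\<Lambda>\<close>.\<close>
  define C where "C = \<bar>1 / \<bar>b\<bar> + (48 + 2 / \<rho>0)\<bar> + \<bar>(1 + (3 * b + 2) / b) / \<bar>b\<bar> + (2 + 2 * \<bar>C0\<bar>) / \<bar>b\<bar>\<bar> + (4 + 2 * \<bar>C0\<bar>)"
  define \<rho> where "\<rho> = (norm \<phi>0 + 6) * k + 1"
  define \<Lambda> where "\<Lambda> = \<bar>C * \<rho>\<bar> + \<bar>C\<bar> + \<bar>k\<bar> + \<bar>C * k\<bar> + \<bar>\<rho>\<bar> + 1"
  \<comment> \<open>Every condition bounds a multiple of \<epsilon> by a positive constant, so all
    hold for small \<epsilon>. The exponential rate \<open>\<eta>\<close> of the weight is then
    determined by \<epsilon>.\<close>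
  have "\<forall>\<^sub>F \<epsilon> in at_right (0::real). 0 < \<epsilon> \<and> 1 * \<epsilon> \<le> 1 \<and> (6 * (norm \<phi>0 + 1)) * \<epsilon> \<le> r \<and> (C * \<rho>) * \<epsilon> \<le> 1 \<and>
      ch2 \<Lambda> a b \<phi>0 * \<epsilon> \<le> 1 \<and> ((norm \<phi>0 + 6) * (C * k) + ch2 \<Lambda> a b \<phi>0) * \<epsilon> \<le> 1/2"
    by (intro eventually_conj small_multiple eventually_at_right_less) (use r in auto)
  then obtain \<epsilon> where \<epsilon>: "0 < \<epsilon>" "1 * \<epsilon> \<le> 1" "(6 * (norm \<phi>0 + 1)) * \<epsilon> \<le> r" "(C * \<rho>) * \<epsilon> \<le> 1"
      "ch2 \<Lambda> a b \<phi>0 * \<epsilon> \<le> 1" "((norm \<phi>0 + 6) * (C * k) + ch2 \<Lambda> a b \<phi>0) * \<epsilon> \<le> 1/2"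
    using eventually_happens'[OF trivial_limit_at_right_real] by blast
  define \<eta> where "\<eta> = 4 * pi / \<epsilon>"
  have \<eta>: "0 < \<eta>" "4 * pi / \<eta> = \<epsilon>" using \<epsilon>(1) by (auto simp: \<eta>_def)

  have bd: "borel_domain (wedge r\<^sub>\<Omega> m) (weight \<eta>) \<epsilon>"
    using borel_domain_wedge[OF \<eta>(1) r\<Omega> m] unfolding \<eta>(2) .
  have bk: "borel_kernel (wedge r\<^sub>\<Omega> m) (weight \<eta>) \<epsilon> b \<rho>0 C0"
    by (intro borel_kernel.intro bd borel_kernel_axioms.intro b \<rho>0)
      (use wedge_dichotomy[OF b(1) m] in \<open>simp only: r\<^sub>\<Omega>_def \<rho>0_def C0_def\<close>)
  have al': "borel_kernel.al b = (3 * b + 2) / b" by (rule borel_kernel.al_def[OF bk])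
  interpret M: invariant_manifold "wedge r\<^sub>\<Omega> m" "weight \<eta>" \<epsilon> b \<rho>0 C0 a r k C \<rho> \<Lambda> \<phi>0 ?cF ?cG ?cH \<eta> "\<eta> / (4 * pi)" F G H
  proof (intro invariant_manifold.intro nonlinear.intro bk nonlinear_axioms.intro borel_laplace.intro bd
      borel_laplace_axioms.intro invariant_manifold_axioms.intro phi0_sq phi0 r(1) cub \<eta>(1) weight_le)
    show "1 < borel_kernel.al b" using al al' by simp
    show "1 / \<bar>b\<bar> + (48 + 2 / \<rho>0) \<le> C" "4 + 2 * \<bar>C0\<bar> \<le> C" by (auto simp: C_def)
    show "(1 + borel_kernel.al b) / \<bar>b\<bar> + (2 + 2 * \<bar>C0\<bar>) / \<bar>b\<bar> \<le> C" unfolding al' C_def by linarith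
    show "(6 * (norm \<phi>0 + 1) / r) ^ 3 * weight_sum ?cF r \<le> k"
      "(6 * (norm \<phi>0 + 1) / r) ^ 3 * weight_sum ?cG r \<le> k"
      "(6 * (norm \<phi>0 + 1) / r) ^ 3 * weight_sum ?cH r \<le> k"
      unfolding A0_def[symmetric] using ws by (simp_all add: k_def)
    show "C * \<rho> \<le> \<Lambda>" "C \<le> \<Lambda>" "k \<le> \<Lambda>" "C * k \<le> \<Lambda>" "\<rho> \<le> \<Lambda>" "1 \<le> \<Lambda>" by (auto simp: \<Lambda>_def)
    show "(norm \<phi>0 + 6) * k + 1 \<le> \<rho>" by (simp add: \<rho>_def)
    show "\<epsilon> \<le> 1" using \<epsilon>(2) by simp
    show "\<epsilon> * (6 * (norm \<phi>0 + 1)) \<le> r" using \<epsilon>(3) by (simp only: mult.commute)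
    show "C * (\<rho> * \<epsilon>) \<le> 1" using \<epsilon>(4) by (simp only: mult.assoc)
    show "ch2 \<Lambda> a b \<phi>0 * \<epsilon> \<le> 1" "((norm \<phi>0 + 6) * (C * k) + ch2 \<Lambda> a b \<phi>0) * \<epsilon> \<le> 1/2" by (fact \<epsilon>)+
  next
    fix x y z :: complex assume n: "norm x < r" "norm y < r" "norm z < r"
    have nF: "norm x < rF" "norm y < rF" "norm z < rF" and nG: "norm x < rG" "norm y < rG" "norm z < rG"
      and nH: "norm x < rH" "norm y < rH" "norm z < rH" using n r by auto
    show "(x, y, z) \<in> convergence_domain F \<inter> convergence_domain G \<inter> convergence_domain H"
      using rF(3)[OF nF] rG(3)[OF nG] rH(3)[OF nH] by simp
    show "(\<lambda>n. case triple n of (i, j, k) \<Rightarrow> of_real (?cF (i, j, k)) * (x ^ i * y ^ j * z ^ k)) sums complexify F (x, y, z)"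
      by (rule rF(4)[OF nF])
    show "(\<lambda>n. case triple n of (i, j, k) \<Rightarrow> of_real (?cG (i, j, k)) * (x ^ i * y ^ j * z ^ k)) sums complexify G (x, y, z)"
      by (rule rG(4)[OF nG])
    show "(\<lambda>n. case triple n of (i, j, k) \<Rightarrow> of_real (?cH (i, j, k)) * (x ^ i * y ^ j * z ^ k)) sums complexify H (x, y, z)"
      by (rule rH(4)[OF nH])
  qed

  obtain f where f: "M.elem (\<rho> * \<epsilon>) f"
    "\<And>w \<theta>. w \<in> wedge r\<^sub>\<Omega> m \<Longrightarrow> \<theta> \<in> strip 1 \<Longrightarrow>
      \<phi>0 * M.defect f w \<theta> + M.conv (M.U_op f) (M.defect f) w \<theta> + M.conv (M.J (M.twist f)) (M.S_op f) w \<theta> = 0"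
    using M.solution_exists by blast
  \<comment> \<open>Only the open disc of radius \<open>r\<^sub>\<Omega>\<close> is known to lie in
    the wedge, and the Cauchy estimates use a closed one.\<close>
  have r1: "0 < r\<^sub>\<Omega> / 2" "cball 0 (r\<^sub>\<Omega> / 2) \<subseteq> wedge r\<^sub>\<Omega> m"
    using r\<Omega> ball_subset_wedge[OF m, of r\<^sub>\<Omega>] by force+
  have \<sigma>: "0 < cos \<kappa>" using \<kappa> by (intro cos_gt_zero) auto
  \<comment> \<open>The four entries are the solutions for \<delta> of the four inequalities in
    \<open>D\<close>.\<close>
  define \<delta>0 where "\<delta>0 = min (min (cos \<kappa> / (2 * \<eta>)) (norm \<phi>0 / 2 * cos \<kappa> / (2 * (\<eta> / (4 * pi))))) (min r (r / (9 * norm \<phi>0)))"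
  have \<delta>0: "0 < \<delta>0" unfolding \<delta>0_def using \<sigma> \<eta>(1) phi0 r(1) by simp
  have D: "2 * \<eta> * \<delta> \<le> cos \<kappa>" "2 * (\<eta> / (4 * pi)) * \<delta> / cos \<kappa> \<le> norm \<phi>0 / 2" "\<delta> \<le> r" "\<delta> * (9 * norm \<phi>0) \<le> r"
    if "\<delta> < \<delta>0" for \<delta>
  proof -
    have m: "\<delta> \<le> cos \<kappa> / (2 * \<eta>)" "\<delta> \<le> norm \<phi>0 / 2 * cos \<kappa> / (2 * (\<eta> / (4 * pi)))" "\<delta> \<le> r" "\<delta> \<le> r / (9 * norm \<phi>0)"
      using that by (auto simp: \<delta>0_def)
    show "2 * \<eta> * \<delta> \<le> cos \<kappa>" using m(1) \<eta>(1) by (simp add: pos_le_divide_eq mult.commute)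
    have "0 < 2 * (\<eta> / (4 * pi))" using \<eta>(1) by simp
    from m(2)[unfolded pos_le_divide_eq[OF this]]
    show "2 * (\<eta> / (4 * pi)) * \<delta> / cos \<kappa> \<le> norm \<phi>0 / 2"
      unfolding pos_divide_le_eq[OF \<sigma>] by (simp only: mult.commute)
    show "\<delta> \<le> r" by (rule m)
    show "\<delta> * (9 * norm \<phi>0) \<le> r" using m(4) phi0 by (simp add: pos_le_divide_eq)
  qed
  have rays_plus: "of_real t * cis \<psi> \<in> wedge r\<^sub>\<Omega> m" if "\<bar>\<psi> - 0\<bar> < \<kappa>" for \<psi> t
    unfolding m_def using ray_in_wedge[OF _ \<kappa>(2) r\<Omega>] that by simp
  have rays_minus: "of_real t * cis \<psi> \<in> wedge r\<^sub>\<Omega> m" if "\<bar>\<psi> - pi\<bar> < \<kappa>" for \<psi> t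
    unfolding m_def by (rule ray_in_wedge_minus[OF that \<kappa>(2) r\<Omega>])
  note common = f \<kappa>(1) less_imp_le[OF \<kappa>(2)] r1 \<sigma>
  show ?thesis
  \<comment> \<open>The bound 1 for \<xi> is available because all functions were constructed on
    \<open>strip 1\<close> and are merely restricted here.\<close>
  proof (rule exI[of _ \<delta>0], rule conjI[OF \<delta>0], rule exI[of _ 1], rule conjI[OF zero_less_one], intro allI impI, elim conjE)
    fix \<delta> \<xi> :: real assume d: "0 < \<delta>" "\<delta> < \<delta>0" and "0 < \<xi>" and "\<xi> < 1"
    then have \<xi>: "\<xi> \<le> 1" by simp
    have sub: "\<theta> \<in> strip 1" if "\<theta> \<in> strip \<xi>" for \<theta> using that strip_mono[OF \<xi>] by auto
    note plus = common rays_plus d(1) D[OF d(2)] sector_plus_rays[OF _ assms(12) \<kappa>_def] \<xi>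
    note minus = common rays_minus d(1) D[OF d(2)] sector_minus_rays[OF _ assms(12) \<kappa>_def] \<xi>
    let ?P = "M.graph_fun 0 \<kappa> f" and ?M = "M.graph_fun pi \<kappa> f"
    have "is_one_sum 0 (sector_plus \<delta> \<omega>) \<xi> (M.series f) ?P"
      by (rule M.is_one_sum_graph_fun[where ?r1.0="r\<^sub>\<Omega> / 2" and \<sigma>="cos \<kappa>" and \<delta>=\<delta>]) (fact plus)+
    moreover have "is_one_sum pi (sector_minus \<delta> \<omega>) \<xi> (M.series f) ?M"
      by (rule M.is_one_sum_graph_fun[where ?r1.0="r\<^sub>\<Omega> / 2" and \<sigma>="cos \<kappa>" and \<delta>=\<delta>]) (fact minus)+
    moreover have "gevrey1 \<xi> (M.series f)"
      by (rule M.gevrey1_series[where ?r1.0="r\<^sub>\<Omega> / 2"]) (fact plus)+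
    moreover have "periodic_on_strip \<xi> (?P x)" if "x \<in> sector_plus \<delta> \<omega>" for x
      by (rule M.periodic_graph_fun[where ?r1.0="r\<^sub>\<Omega> / 2" and \<sigma>="cos \<kappa>" and \<delta>=\<delta> and S="sector_plus \<delta> \<omega>"]) (fact plus that)+
    moreover have "periodic_on_strip \<xi> (?M x)" if "x \<in> sector_minus \<delta> \<omega>" for x
      by (rule M.periodic_graph_fun[where ?r1.0="r\<^sub>\<Omega> / 2" and \<sigma>="cos \<kappa>" and \<delta>=\<delta> and S="sector_minus \<delta> \<omega>"]) (fact minus that)+
    moreover have "invariant_graph (cyl_vfield a b F G H) (cyl_domain F G H) (sector_plus \<delta> \<omega> \<times> strip \<xi>) (\<lambda>(x, \<theta>). x * ?P x \<theta>)"
      by (rule M.invariant_graph_graph_fun[where ?r1.0="r\<^sub>\<Omega> / 2" and \<sigma>="cos \<kappa>" and \<delta>=\<delta>]) (fact plus)+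
    moreover have "invariant_graph (cyl_vfield a b F G H) (cyl_domain F G H) (sector_minus \<delta> \<omega> \<times> strip \<xi>) (\<lambda>(x, \<theta>). x * ?M x \<theta>)"
      by (rule M.invariant_graph_graph_fun[where ?r1.0="r\<^sub>\<Omega> / 2" and \<sigma>="cos \<kappa>" and \<delta>=\<delta>]) (fact minus)+
    moreover have "((\<lambda>x. ?P x \<theta>) \<longlongrightarrow> \<phi>0) (at 0 within sector_plus \<delta> \<omega>)" if "\<theta> \<in> strip \<xi>" for \<theta>
      by (rule M.graph_fun_limit[where ?r1.0="r\<^sub>\<Omega> / 2" and \<sigma>="cos \<kappa>" and \<delta>=\<delta>]) (fact plus sub[OF that])+
    moreover have "((\<lambda>x. ?M x \<theta>) \<longlongrightarrow> \<phi>0) (at 0 within sector_minus \<delta> \<omega>)" if "\<theta> \<in> strip \<xi>" for \<theta>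
      by (rule M.graph_fun_limit[where ?r1.0="r\<^sub>\<Omega> / 2" and \<sigma>="cos \<kappa>" and \<delta>=\<delta>]) (fact minus sub[OF that])+
    ultimately show "\<exists>W \<Phi>p \<Phi>m.
      gevrey1 \<xi> W \<and>
      is_one_sum 0 (sector_plus \<delta> \<omega>) \<xi> W \<Phi>p \<and>
      is_one_sum pi (sector_minus \<delta> \<omega>) \<xi> W \<Phi>m \<and>
      (\<forall>x\<in>sector_plus \<delta> \<omega>. periodic_on_strip \<xi> (\<Phi>p x)) \<and>
      (\<forall>x\<in>sector_minus \<delta> \<omega>. periodic_on_strip \<xi> (\<Phi>m x)) \<and>
      invariant_graph (cyl_vfield a b F G H) (cyl_domain F G H)
        (sector_plus \<delta> \<omega> \<times> strip \<xi>) (\<lambda>(x, \<theta>). x * \<Phi>p x \<theta>) \<and>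
      invariant_graph (cyl_vfield a b F G H) (cyl_domain F G H)
        (sector_minus \<delta> \<omega> \<times> strip \<xi>) (\<lambda>(x, \<theta>). x * \<Phi>m x \<theta>) \<and>
      (\<forall>\<theta>\<in>strip \<xi>.
        ((\<lambda>x. \<Phi>p x \<theta>) \<longlongrightarrow> \<i> * csqrt (of_real ((1 + b) / a))) (at 0 within sector_plus \<delta> \<omega>)) \<and>
      (\<forall>\<theta>\<in>strip \<xi>.
        ((\<lambda>x. \<Phi>m x \<theta>) \<longlongrightarrow> \<i> * csqrt (of_real ((1 + b) / a))) (at 0 within sector_minus \<delta> \<omega>))"
      unfolding \<phi>0_def[symmetric]
      by (rule_tac exI[of _ "M.series f"], rule_tac exI[of _ ?P], rule_tac exI[of _ ?M], intro conjI ballI)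
  qed
qed

end
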